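(* The $s$-$t$ Flow Edge Interdiction problem ($s$-$t$ FEI) is W[1]-hard when parameterized by $b$, even when restricted to instances whose underlying undirected graph is bipartite and in which every arc has capacity $1$.
   Context: $s$-$t$ FEI: given a directed graph $G=(N,A)$ with distinguished vertices $s$ and $t$, a positive integer capacity $u_{ij}$ for each arc $(i,j)\in A$, an interdiction cost function $c:A\to\mathbb{Z}_{\ge 0}$, and two positive integers $b$ and $r$, decide whether there is a set of arcs $A'\subseteq A$ with $c(A')=\sum_{a\in A'}c(a)\le b$ such that the maximum $s$-$t$ flow value in the graph $G-A'$ (obtained by deleting the arcs of $A'$) is at most $r$. *)

theory Defs
  imports Complex_Main "Graph_Theory.Pair_Digraph"
begin

section \<open>Model of computation\<close>

text \<open>
  Inputs and outputs are binary trees, processed by while programs over tree-valued variables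
  (the WHILE language of N. D. Jones). A step is not charged unit cost: evaluating an expression
  costs the total size of the values of all its subexpressions, i.e. values are copied and never
  shared. The store is therefore never larger than the input plus the time used, and running times agree
  with those of multi-tape Turing machines up to a polynomial.
\<close>

datatype tree = Leaf | Branch tree tree

primrec tsize :: "tree \<Rightarrow> nat" where
  "tsize Leaf = 1"
| "tsize (Branch a b) = 1 + tsize a + tsize b"

datatype expr = EVar nat | ELeaf | EBranch expr expr | EFst expr | ESnd expr | EEq expr expr

datatype prog = Assign nat expr | Seq prog prog | If expr prog prog | While expr prog

type_synonym store = "nat \<Rightarrow> tree"

fun tfst :: "tree \<Rightarrow> tree" where
  "tfst Leaf = Leaf"
| "tfst (Branch a b) = a"

fun tsnd :: "tree \<Rightarrow> tree" where
  "tsnd Leaf = Leaf"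
| "tsnd (Branch a b) = b"

definition enc_bool :: "bool \<Rightarrow> tree" where
  "enc_bool p = (if p then Branch Leaf Leaf else Leaf)"

primrec eval_expr :: "expr \<Rightarrow> store \<Rightarrow> tree" where
  "eval_expr (EVar v) s = s v"
| "eval_expr ELeaf s = Leaf"
| "eval_expr (EBranch e1 e2) s = Branch (eval_expr e1 s) (eval_expr e2 s)"
| "eval_expr (EFst e) s = tfst (eval_expr e s)"
| "eval_expr (ESnd e) s = tsnd (eval_expr e s)"
| "eval_expr (EEq e1 e2) s = enc_bool (eval_expr e1 s = eval_expr e2 s)"

primrec expr_cost :: "expr \<Rightarrow> store \<Rightarrow> nat" where
  "expr_cost (EVar v) s = tsize (s v)"
| "expr_cost ELeaf s = 1"
| "expr_cost (EBranch e1 e2) s =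
     expr_cost e1 s + expr_cost e2 s + tsize (eval_expr (EBranch e1 e2) s)"
| "expr_cost (EFst e) s = expr_cost e s + tsize (eval_expr (EFst e) s)"
| "expr_cost (ESnd e) s = expr_cost e s + tsize (eval_expr (ESnd e) s)"
| "expr_cost (EEq e1 e2) s =
     expr_cost e1 s + expr_cost e2 s + tsize (eval_expr (EEq e1 e2) s)"

text \<open>\<open>exec p s n s'\<close>: started in store \<open>s\<close>, program \<open>p\<close> halts after time \<open>n\<close> in store \<open>s'\<close>.
  A test succeeds iff its value is not \<open>Leaf\<close>.\<close>

inductive exec :: "prog \<Rightarrow> store \<Rightarrow> nat \<Rightarrow> store \<Rightarrow> bool" where
  exec_Assign: "exec (Assign v e) s (expr_cost e s) (s(v := eval_expr e s))"
| exec_Seq: "exec p s m s' \<Longrightarrow> exec q s' n s'' \<Longrightarrow> exec (Seq p q) s (m + n) s''"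
| exec_IfTrue: "eval_expr e s \<noteq> Leaf \<Longrightarrow> exec p s n s' \<Longrightarrow>
    exec (If e p q) s (expr_cost e s + n) s'"
| exec_IfFalse: "eval_expr e s = Leaf \<Longrightarrow> exec q s n s' \<Longrightarrow>
    exec (If e p q) s (expr_cost e s + n) s'"
| exec_WhileFalse: "eval_expr e s = Leaf \<Longrightarrow> exec (While e p) s (expr_cost e s) s"
| exec_WhileTrue: "eval_expr e s \<noteq> Leaf \<Longrightarrow> exec p s m s' \<Longrightarrow> exec (While e p) s' n s'' \<Longrightarrow>
    exec (While e p) s (expr_cost e s + m + n) s''"

text \<open>Input and output are passed in variable 0; all other variables initially hold \<open>Leaf\<close>.\<close>

definition runs :: "prog \<Rightarrow> tree \<Rightarrow> nat \<Rightarrow> tree \<Rightarrow> bool" where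
  "runs p x n y \<longleftrightarrow> (\<exists>s'. exec p ((\<lambda>_. Leaf)(0 := x)) n s' \<and> s' 0 = y)"

section \<open>Encodings\<close>

primrec enc_list :: "tree list \<Rightarrow> tree" where
  "enc_list [] = Leaf"
| "enc_list (x # xs) = Branch x (enc_list xs)"

definition enc_unary :: "nat \<Rightarrow> tree" where
  "enc_unary n = enc_list (replicate n Leaf)"

text \<open>Least significant bit first, no leading zeros.\<close>

fun bits :: "nat \<Rightarrow> bool list" where
  "bits n = (if n = 0 then [] else odd n # bits (n div 2))"

declare bits.simps [simp del]

definition enc_nat :: "nat \<Rightarrow> tree" where
  "enc_nat n = enc_list (map enc_bool (bits n))"

section \<open>Parameterized problems and reductions\<close>

text \<open>A parameterized problem is a set of pairs (input, parameter). As usual the size of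
  \<open>(x, k)\<close> is the size of \<open>x\<close> plus \<open>k\<close>, that is, parameters are passed in unary.\<close>

type_synonym param_problem = "(tree \<times> nat) set"

definition computable :: "(nat \<Rightarrow> nat) \<Rightarrow> bool" where
  "computable f \<longleftrightarrow> (\<exists>p. \<forall>n. \<exists>t. runs p (enc_unary n) t (enc_unary (f n)))"

text \<open>
  \<open>fpt_reduction P Q D\<close>: there is a parameterized (many-one) reduction from \<open>P\<close> to \<open>Q\<close> all of
  whose outputs lie in the set \<open>D\<close> of instances, i.e. a reduction from \<open>P\<close> to the restriction
  of \<open>Q\<close> to \<open>D\<close>.
\<close>

definition fpt_reduction :: "param_problem \<Rightarrow> param_problem \<Rightarrow> (tree \<times> nat) set \<Rightarrow> bool" where
  "fpt_reduction P Q D \<longleftrightarrow>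
     (\<exists>p f g c. computable f \<and> computable g \<and>
        (\<forall>x k. \<exists>n y l.
           runs p (Branch x (enc_unary k)) n (Branch y (enc_unary l)) \<and>
           n \<le> f k * (tsize x + k) ^ c \<and>
           l \<le> g k \<and>
           (y, l) \<in> D \<and>
           ((x, k) \<in> P \<longleftrightarrow> (y, l) \<in> Q)))"

section \<open>Boolean circuits and the W-hierarchy\<close>

text \<open>
  A circuit is a directed acyclic graph whose nodes are listed in a topological order, and a
  distinguished output node. A gate carries the positions of its predecessors.
\<close>

datatype gate = InputG | NotG nat | AndG "nat list" | OrG "nat list"

type_synonym circuit = "gate list \<times> nat"

primrec preds :: "gate \<Rightarrow> nat list" where
  "preds InputG = []"
| "preds (NotG i) = [i]"
| "preds (AndG is) = is"
| "preds (OrG is) = is"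

fun indegree_ok :: "gate \<Rightarrow> bool" where
  "indegree_ok (AndG is) \<longleftrightarrow> length is \<ge> 2"
| "indegree_ok (OrG is) \<longleftrightarrow> length is \<ge> 2"
| "indegree_ok _ \<longleftrightarrow> True"

fun wf_circuit :: "circuit \<Rightarrow> bool" where
  "wf_circuit (gs, out) \<longleftrightarrow>
     (\<forall>j < length gs. indegree_ok (gs ! j) \<and> distinct (preds (gs ! j)) \<and>
        (\<forall>i \<in> set (preds (gs ! j)). i < j)) \<and>
     out < length gs \<and>
     (\<forall>j < length gs. out \<notin> set (preds (gs ! j)))"

fun io_path :: "circuit \<Rightarrow> nat list \<Rightarrow> bool" where
  "io_path (gs, out) vs \<longleftrightarrow>
     vs \<noteq> [] \<and> set vs \<subseteq> {..<length gs} \<and> gs ! hd vs = InputG \<and> last vs = out \<and>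
     (\<forall>m. Suc m < length vs \<longrightarrow> vs ! m \<in> set (preds (gs ! (vs ! Suc m))))"

definition large :: "gate \<Rightarrow> bool" where
  "large g \<longleftrightarrow> length (preds g) > 2"

definition depth_le :: "circuit \<Rightarrow> nat \<Rightarrow> bool" where
  "depth_le C d \<longleftrightarrow> (\<forall>vs. io_path C vs \<longrightarrow> length vs - 1 \<le> d)"

definition weft_le :: "circuit \<Rightarrow> nat \<Rightarrow> bool" where
  "weft_le C t \<longleftrightarrow> (\<forall>vs. io_path C vs \<longrightarrow> length (filter (\<lambda>v. large (fst C ! v)) vs) \<le> t)"

definition input_nodes :: "circuit \<Rightarrow> nat set" where
  "input_nodes C = {i. i < length (fst C) \<and> fst C ! i = InputG}"

text \<open>Values of the gates, computed in topological order; \<open>S\<close> is the set of inputs set to true,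
  \<open>bs\<close> the list of values of all earlier gates.\<close>

primrec gate_value :: "nat set \<Rightarrow> bool list \<Rightarrow> gate \<Rightarrow> bool" where
  "gate_value S bs InputG = (length bs \<in> S)"
| "gate_value S bs (NotG i) = (\<not> bs ! i)"
| "gate_value S bs (AndG is) = (\<forall>i \<in> set is. bs ! i)"
| "gate_value S bs (OrG is) = (\<exists>i \<in> set is. bs ! i)"

definition gate_values :: "nat set \<Rightarrow> gate list \<Rightarrow> bool list" where
  "gate_values S gs = foldl (\<lambda>bs g. bs @ [gate_value S bs g]) [] gs"

definition satisfies :: "nat set \<Rightarrow> circuit \<Rightarrow> bool" where
  "satisfies S C \<longleftrightarrow> gate_values S (fst C) ! snd C"

primrec enc_gate :: "gate \<Rightarrow> tree" where
  "enc_gate InputG = Branch (enc_nat 0) Leaf"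
| "enc_gate (NotG i) = Branch (enc_nat 1) (enc_nat i)"
| "enc_gate (AndG is) = Branch (enc_nat 2) (enc_list (map enc_nat is))"
| "enc_gate (OrG is) = Branch (enc_nat 3) (enc_list (map enc_nat is))"

definition enc_circuit :: "circuit \<Rightarrow> tree" where
  "enc_circuit C = Branch (enc_list (map enc_gate (fst C))) (enc_nat (snd C))"

text \<open>Weighted circuit satisfiability for circuits of weft at most \<open>t\<close> and depth at most \<open>d\<close>.\<close>

definition WCS_instances :: "nat \<Rightarrow> nat \<Rightarrow> (tree \<times> nat) set" where
  "WCS_instances t d =
     {(enc_circuit C, k) | C k. wf_circuit C \<and> weft_le C t \<and> depth_le C d}"

definition WCS :: "nat \<Rightarrow> nat \<Rightarrow> param_problem" where
  "WCS t d =
     {(enc_circuit C, k) | C k. wf_circuit C \<and> weft_le C t \<and> depth_le C d \<and>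
        (\<exists>S \<subseteq> input_nodes C. card S = k \<and> satisfies S C)}"

definition W :: "nat \<Rightarrow> param_problem set" where
  "W t = {P. \<exists>d \<ge> 1. fpt_reduction P (WCS t d) (WCS_instances t d)}"

text \<open>\<open>Q\<close> is W[\<open>t\<close>]-hard even when restricted to the instances in \<open>D\<close>.\<close>

definition W_hard_on :: "nat \<Rightarrow> param_problem \<Rightarrow> (tree \<times> nat) set \<Rightarrow> bool" where
  "W_hard_on t Q D \<longleftrightarrow> (\<forall>P \<in> W t. fpt_reduction P Q D)"

section \<open>Flow edge interdiction\<close>

definition is_flow ::
  "nat pair_pre_digraph \<Rightarrow> (nat \<times> nat \<Rightarrow> nat) \<Rightarrow> nat \<Rightarrow> nat \<Rightarrow> (nat \<times> nat \<Rightarrow> real) \<Rightarrow> bool" where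
  "is_flow G u s t f \<longleftrightarrow>
     (\<forall>a \<in> parcs G. 0 \<le> f a \<and> f a \<le> real (u a)) \<and>
     (\<forall>v \<in> pverts G - {s, t}. sum f (in_arcs G v) = sum f (out_arcs G v))"

definition flow_value :: "nat pair_pre_digraph \<Rightarrow> nat \<Rightarrow> (nat \<times> nat \<Rightarrow> real) \<Rightarrow> real" where
  "flow_value G s f = sum f (out_arcs G s) - sum f (in_arcs G s)"

definition max_flow_value ::
  "nat pair_pre_digraph \<Rightarrow> (nat \<times> nat \<Rightarrow> nat) \<Rightarrow> nat \<Rightarrow> nat \<Rightarrow> real" where
  "max_flow_value G u s t = (SUP f \<in> {f. is_flow G u s t f}. flow_value G s f)"

definition delete_arcs :: "nat pair_pre_digraph \<Rightarrow> (nat \<times> nat) set \<Rightarrow> nat pair_pre_digraph" where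
  "delete_arcs G A' = G\<lparr>parcs := parcs G - A'\<rparr>"

text \<open>Whether the underlying undirected graph is bipartite.\<close>

definition underlying_bipartite :: "'a pair_pre_digraph \<Rightarrow> bool" where
  "underlying_bipartite G \<longleftrightarrow>
     (\<exists>X Y. X \<union> Y = pverts G \<and> X \<inter> Y = {} \<and>
        (\<forall>(i, j) \<in> parcs G. i \<in> X \<and> j \<in> Y \<or> i \<in> Y \<and> j \<in> X))"

record fei_instance =
  graph :: "nat pair_pre_digraph"
  source :: nat
  sink :: nat
  capacity :: "nat \<times> nat \<Rightarrow> nat"
  cost :: "nat \<times> nat \<Rightarrow> nat"
  budget :: nat
  threshold :: nat

definition fei_valid :: "fei_instance \<Rightarrow> bool" where
  "fei_valid I \<longleftrightarrow>
     pair_fin_digraph (graph I) \<and>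
     source I \<in> pverts (graph I) \<and> sink I \<in> pverts (graph I) \<and> source I \<noteq> sink I \<and>
     (\<forall>a \<in> parcs (graph I). capacity I a > 0) \<and>
     budget I > 0 \<and> threshold I > 0"

definition fei_yes :: "fei_instance \<Rightarrow> bool" where
  "fei_yes I \<longleftrightarrow>
     (\<exists>A' \<subseteq> parcs (graph I).
        sum (cost I) A' \<le> budget I \<and>
        max_flow_value (delete_arcs (graph I) A') (capacity I) (source I) (sink I)
          \<le> real (threshold I))"

text \<open>\<open>x\<close> encodes \<open>I\<close>: nodes and arcs are listed in an arbitrary order, arcs together with their
  capacity and cost, and all numbers are written in binary.\<close>

definition fei_encodes :: "tree \<Rightarrow> fei_instance \<Rightarrow> bool" where
  "fei_encodes x I \<longleftrightarrow>
     (\<exists>ns as. distinct ns \<and> set ns = pverts (graph I) \<and>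
        distinct as \<and> set as = parcs (graph I) \<and>
        x = enc_list
          [enc_list (map enc_nat ns),
           enc_list (map (\<lambda>a. enc_list
             [enc_nat (fst a), enc_nat (snd a), enc_nat (capacity I a), enc_nat (cost I a)]) as),
           enc_nat (source I), enc_nat (sink I), enc_nat (budget I), enc_nat (threshold I)])"

text \<open>The flow edge interdiction problem, parameterized by the budget.\<close>

definition FEI :: param_problem where
  "FEI = {(x, budget I) | x I. fei_encodes x I \<and> fei_valid I \<and> fei_yes I}"

definition FEI_bipartite_unit_instances :: "(tree \<times> nat) set" where
  "FEI_bipartite_unit_instances =
     {(x, budget I) | x I. fei_encodes x I \<and> fei_valid I \<and>
        underlying_bipartite (graph I) \<and> (\<forall>a \<in> parcs (graph I). capacity I a = 1)}"

end

theory Submission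
  imports Defs
begin

text \<open>
  Expanding the small gates above the large ones of a weft-1, depth-\<open>d\<close> circuit into disjunctive normal
  form, and the gates below them likewise, shows that a set \<open>S\<close> of inputs satisfies the circuit iff for
  one of polynomially many families \<open>\<Phi>\<close> of partial assignments to at most \<open>q = 2^(d+1)\<close> inputs,
  \<open>S\<close> agrees with no member of \<open>\<Phi>\<close>. List \<open>S\<close> as \<open>s_1 < \<dots> < s_k\<close>. Membership of an input in \<open>S\<close> is
  witnessed by a single one of the \<open>k + 1\<close> gaps between consecutive elements, hence a violation by \<open>q\<close> of
  them. Let the vertices be the pairs of a family and a \<open>q\<close>-tuple of gaps that does not reveal a
  violation, with consistent vertices adjacent. A satisfying \<open>S\<close> of size \<open>k\<close> is then a clique of
  size \<open>K = (k+1)^q\<close> (plus 1, for a universal vertex).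

  Cliques reduce to flow interdiction as follows. Each ordered pair \<open>e = (u, v)\<close> of adjacent vertices
  (loops included) gets unit arcs \<open>s \<rightarrow> e \<rightarrow> t\<close>, \<open>e \<rightarrow> u\<close>, \<open>e \<rightarrow> v\<close>, and each vertex a path to \<open>t\<close>. Only the
  arcs \<open>e \<rightarrow> t\<close> are affordable, and the budget is \<open>K^2\<close>. The pairs whose arc is deleted have to be matched
  to their endpoints. By the deficiency version of Hall's theorem this loses \<open>K^2 - K\<close> units of flow only
  if some \<open>K^2\<close> of these pairs touch just \<open>K\<close> vertices, that is, if they form a clique.
\<close>

section \<open>While programs\<close>

text \<open>The new parameter may be any computable function of \<open>k\<close>, but the number of
  vertices must be polynomial with an exponent depending on \<open>d\<close> only. So a vertex
  cannot carry a whole assignment, just \<open>q\<close> facts about it. That an input is not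
  selected concerns all \<open>k\<close> selected elements at once; with gaps it becomes one fact.
  \<open>(k+1)^q\<close> counts the lists of \<open>q\<close> slots: two distinct related vertices
  never share a list, so a clique of that size realises every list, fixes every gap and meets every
  potential violation.

  The universal vertex serves \<open>k = 0\<close>, where the count is 1: for \<open>K = 1\<close>
  the demanded loss \<open>K^2 - K\<close> is 0 and every instance would be a yes-instance. Loops
  make a clique of size \<open>K\<close> consist of exactly \<open>K^2\<close> pairs, and they test
  a vertex against itself. Arcs are protected by their cost, not by capacity, so all capacities can
  be 1.

  A problem in W[1] comes with a reduction into well-formed circuits, so the map need be correct
  only on those. Its running time is derived in the concrete machine model by closure properties,
  chiefly a recursion over lists whose steps grow additively.\<close>

primrec vars_e :: "expr \<Rightarrow> nat set" where
  "vars_e (EVar v) = {v}"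
| "vars_e ELeaf = {}"
| "vars_e (EBranch a b) = vars_e a \<union> vars_e b"
| "vars_e (EFst a) = vars_e a"
| "vars_e (ESnd a) = vars_e a"
| "vars_e (EEq a b) = vars_e a \<union> vars_e b"

lemma eval_expr_cong: "(\<And>v. v \<in> vars_e e \<Longrightarrow> s v = s' v) \<Longrightarrow> eval_expr e s = eval_expr e s'"
  by (induction e) auto

lemma expr_cost_cong: "(\<And>v. v \<in> vars_e e \<Longrightarrow> s v = s' v) \<Longrightarrow> expr_cost e s = expr_cost e s'"
proof (induction e)
  case (EBranch a b)
  then show ?case using eval_expr_cong[of "EBranch a b" s s'] by auto
next
  case (EFst a)
  then show ?case using eval_expr_cong[of a s s'] by auto
next
  case (ESnd a)
  then show ?case using eval_expr_cong[of a s s'] by auto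
next
  case (EEq a b)
  then show ?case using eval_expr_cong[of a s s'] eval_expr_cong[of b s s'] by auto
qed auto

lemma tsize_pos[simp]: "tsize t > 0"
  by (cases t) auto

lemma tsize_eval_le_cost: "tsize (eval_expr e s) \<le> expr_cost e s"
  by (induction e) auto

text \<open>An assignment pays at least the size of the value it stores. Hence every time bound is
  also a bound on output size, which is what makes compositions polynomial.\<close>

lemma exec_tsize: "exec p s n s' \<Longrightarrow> tsize (s' v) \<le> tsize (s v) + n"
proof (induction rule: exec.induct)
  case (exec_Assign w e s)
  then show ?case using tsize_eval_le_cost[of e s] by (auto simp: trans_le_add2)
qed auto

definition exec_le :: "prog \<Rightarrow> store \<Rightarrow> nat \<Rightarrow> store \<Rightarrow> bool" where
  "exec_le p s T s' \<longleftrightarrow> (\<exists>n\<le>T. exec p s n s')"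

lemma exec_le_Assign: "expr_cost e s \<le> T \<Longrightarrow> exec_le (Assign v e) s T (s(v := eval_expr e s))"
  unfolding exec_le_def using exec_Assign by blast

lemma exec_le_Seq: "exec_le p s T s' \<Longrightarrow> exec_le q s' T' s'' \<Longrightarrow> T + T' \<le> T'' \<Longrightarrow> exec_le (Seq p q) s T'' s''"
  unfolding exec_le_def using exec_Seq by (meson add_mono order_trans)

lemma exec_le_If:
  assumes "if eval_expr e s \<noteq> Leaf then exec_le p s T s' else exec_le q s T s'" "expr_cost e s + T \<le> T'"
  shows "exec_le (If e p q) s T' s'"
proof (cases "eval_expr e s = Leaf")
  case True
  then obtain n where "n \<le> T" "exec q s n s'" using assms by (auto simp: exec_le_def)
  then show ?thesis using exec_IfFalse[OF True, of q n s' p] assms unfolding exec_le_def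
    by (intro exI[of _ "expr_cost e s + n"]) auto
next
  case False
  then obtain n where "n \<le> T" "exec p s n s'" using assms by (auto simp: exec_le_def)
  then show ?thesis using exec_IfTrue[OF False, of p n s' q] assms unfolding exec_le_def
    by (intro exI[of _ "expr_cost e s + n"]) auto
qed

lemma exec_le_WhileFalse: "eval_expr e s = Leaf \<Longrightarrow> expr_cost e s \<le> T \<Longrightarrow> exec_le (While e p) s T s"
  unfolding exec_le_def using exec_WhileFalse by blast

lemma exec_le_WhileTrue:
  assumes "eval_expr e s \<noteq> Leaf" "exec_le p s T s'" "exec_le (While e p) s' T' s''"
    "expr_cost e s + T + T' \<le> T''"
  shows "exec_le (While e p) s T'' s''"
proof -
  obtain m n where "m \<le> T" "exec p s m s'" "n \<le> T'" "exec (While e p) s' n s''"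
    using assms by (auto simp: exec_le_def)
  then show ?thesis using exec_WhileTrue[OF assms(1), of p m s' n s''] assms(4) unfolding exec_le_def
    by (intro exI[of _ "expr_cost e s + m + n"]) auto
qed

lemma exec_le_mono: "exec_le p s T s' \<Longrightarrow> T \<le> T' \<Longrightarrow> exec_le p s T' s'"
  unfolding exec_le_def by (meson order_trans)

text \<open>The initial store is arbitrary and variables from \<open>N\<close> on are preserved, so that programs compose
  without renaming: a caller keeps its data above \<open>N\<close>.\<close>

definition computes :: "prog \<Rightarrow> nat \<Rightarrow> (tree \<Rightarrow> tree) \<Rightarrow> nat \<Rightarrow> bool" where
  "computes p N F c \<longleftrightarrow> (\<forall>s. \<exists>s'. exec_le p s ((tsize (s 0) + 2) ^ c) s' \<and> s' 0 = F (s 0) \<and> (\<forall>v\<ge>N. s' v = s v))"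

definition ptime :: "(tree \<Rightarrow> tree) \<Rightarrow> bool" where
  "ptime F \<longleftrightarrow> (\<exists>p N c. computes p N F c)"

lemma computes_mono: "computes p N F c \<Longrightarrow> N \<le> N' \<Longrightarrow> c \<le> c' \<Longrightarrow> computes p N' F c'"
  unfolding computes_def
proof (intro allI)
  fix s
  assume "\<forall>s. \<exists>s'. exec_le p s ((tsize (s 0) + 2) ^ c) s' \<and> s' 0 = F (s 0) \<and> (\<forall>v\<ge>N. s' v = s v)" and l: "N \<le> N'" "c \<le> c'"
  then obtain s' where "exec_le p s ((tsize (s 0) + 2) ^ c) s'" "s' 0 = F (s 0)" "\<forall>v\<ge>N. s' v = s v" by blast
  then show "\<exists>s'. exec_le p s ((tsize (s 0) + 2) ^ c') s' \<and> s' 0 = F (s 0) \<and> (\<forall>v\<ge>N'. s' v = s v)"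
    using l exec_le_mono[OF _ power_increasing[OF l(2)]] by (intro exI[of _ s']) simp
qed

lemma computes_tsize: assumes "computes p N F c" shows "tsize (F x) \<le> (tsize x + 2) ^ (c + 1)"
proof -
  obtain s' n where "exec p (\<lambda>_. x) n s'" "n \<le> (tsize x + 2) ^ c" "s' 0 = F x"
    using assms unfolding computes_def exec_le_def by meson
  with exec_tsize[OF this(1), of 0] have "tsize (F x) \<le> tsize x + (tsize x + 2) ^ c" by simp
  moreover have "tsize x + (tsize x + 2)^c \<le> (tsize x + 2) * (tsize x + 2) ^ c"
  proof -
    have "tsize x * 1 \<le> tsize x * (tsize x + 2) ^ c" by (intro mult_le_mono) auto
    then show ?thesis unfolding distrib_right by linarith
  qed
  ultimately show ?thesis by simp
qed

lemma ptime_tsize: assumes "ptime F" obtains c where "\<And>x. tsize (F x) \<le> (tsize x + 2) ^ c"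
  using assms computes_tsize unfolding ptime_def by metis

text \<open>The base is at least 2, so a factor 2 costs one more power. This is why all bounds have
  the form \<open>(tsize x + 2) ^ c\<close>, without coefficients.\<close>

lemma pow_sum: assumes "a \<le> ((m::nat) + 2) ^ c" "b \<le> (m + 2) ^ d" shows "a + b \<le> (m + 2) ^ (c + d + 1)"
proof -
  have "(m+2)^c * 1 \<le> (m+2)^c * (m+2)^d" "1 * (m+2)^d \<le> (m+2)^c * (m+2)^d"
    by (intro mult_le_mono; simp)+
  then have "a + b \<le> 2 * (m+2)^(c+d)" using assms unfolding power_add by linarith
  also have "\<dots> \<le> (m+2) * (m+2)^(c+d)" by (intro mult_le_mono) auto
  finally show ?thesis by simp
qed

lemma pow_prod: assumes "a \<le> ((m::nat) + 2) ^ c" "b \<le> (m + 2) ^ d" shows "a * b \<le> (m + 2) ^ (c + d)"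
  using assms by (simp add: power_add mult_le_mono)

section \<open>Polynomially bounded measures of trees\<close>

definition polyb :: "(tree \<Rightarrow> nat) \<Rightarrow> bool" where
  "polyb h \<longleftrightarrow> (\<exists>c. \<forall>x. h x \<le> (tsize x + 2) ^ c)"

lemma polyb_add: "polyb f \<Longrightarrow> polyb g \<Longrightarrow> polyb (\<lambda>x. f x + g x)"
  unfolding polyb_def using pow_sum by metis

lemma polyb_mult: "polyb f \<Longrightarrow> polyb g \<Longrightarrow> polyb (\<lambda>x. f x * g x)"
  unfolding polyb_def using pow_prod by metis

lemma polyb_const: "polyb (\<lambda>_. k)"
proof -
  have "k \<le> (tsize x + 2) ^ k" for x
    using less_exp[of k] power_mono[of 2 "tsize x + 2" k] by simp
  then show ?thesis unfolding polyb_def by blast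
qed

lemma polyb_size: "polyb tsize"
  unfolding polyb_def by (intro exI[of _ 1]) simp

lemma polyb_le: "polyb g \<Longrightarrow> (\<And>x. f x \<le> g x) \<Longrightarrow> polyb f"
  unfolding polyb_def by (meson order_trans)

lemma polyb_pow: "polyb f \<Longrightarrow> polyb (\<lambda>x. f x ^ k)"
  by (induction k) (auto simp: polyb_const intro: polyb_mult)

lemma polyb_ptime: "ptime F \<Longrightarrow> polyb (\<lambda>x. tsize (F x))"
  unfolding polyb_def using ptime_tsize by metis

lemmas polyb_intros = polyb_add polyb_mult polyb_const polyb_size polyb_pow polyb_ptime

lemma ptimeI:
  assumes "polyb T"
    and "\<And>s. \<exists>s'. exec_le p s (T (s 0)) s' \<and> s' 0 = F (s 0) \<and> (\<forall>v\<ge>N. s' v = s v)"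
  shows "ptime F"
proof -
  obtain c where "\<And>x. T x \<le> (tsize x + 2) ^ c" using assms(1) unfolding polyb_def by blast
  then have "computes p N F c" unfolding computes_def using assms(2) exec_le_mono by meson
  then show ?thesis unfolding ptime_def by blast
qed

lemma ptimeE:
  assumes "ptime F"
  obtains p N c where "computes p N F c" "N > 0"
proof -
  obtain p N c where "computes p N F c" using assms unfolding ptime_def by blast
  then have "computes p (Suc N) F c" by (rule computes_mono) auto
  then show ?thesis using that by blast
qed

lemma computesD:
  "computes p N F c \<Longrightarrow> \<exists>s'. exec_le p s ((tsize (s 0) + 2) ^ c) s' \<and> s' 0 = F (s 0) \<and> (\<forall>v\<ge>N. s' v = s v)"
  unfolding computes_def by blast

section \<open>Basic polynomial-time functions and closure properties\<close>

lemma ptime_expr: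
  assumes "\<And>s. eval_expr e s = F (s 0)" "polyb (\<lambda>x. expr_cost e (\<lambda>_. x))" "vars_e e \<subseteq> {0}"
  shows "ptime F"
proof (rule ptimeI[OF assms(2), where p = "Assign 0 e" and N = 1])
  fix s :: store
  have "expr_cost e s = expr_cost e (\<lambda>_. s 0)" using assms(3) by (intro expr_cost_cong) auto
  then show "\<exists>s'. exec_le (Assign 0 e) s (expr_cost e (\<lambda>_. s 0)) s' \<and> s' 0 = F (s 0) \<and> (\<forall>v\<ge>1. s' v = s v)"
    using exec_le_Assign[of e s "expr_cost e (\<lambda>_. s 0)" 0] assms(1)[of s] by auto
qed

lemma ptime_id: "ptime (\<lambda>x. x)"
  by (rule ptime_expr[of "EVar 0"]) (auto intro: polyb_intros)

primrec const_expr :: "tree \<Rightarrow> expr" where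
  "const_expr Leaf = ELeaf"
| "const_expr (Branch a b) = EBranch (const_expr a) (const_expr b)"

lemma ptime_const: "ptime (\<lambda>x. c)"
proof (rule ptime_expr[of "const_expr c"])
  have v: "vars_e (const_expr c) = {}" by (induction c) auto
  then show "vars_e (const_expr c) \<subseteq> {0}" by simp
  show "eval_expr (const_expr c) s = c" for s by (induction c) auto
  have "expr_cost (const_expr c) (\<lambda>_. x) = expr_cost (const_expr c) (\<lambda>_. Leaf)" for x
    using v by (intro expr_cost_cong) auto
  then show "polyb (\<lambda>x. expr_cost (const_expr c) (\<lambda>_. x))"
    unfolding polyb_def by (metis polyb_const[unfolded polyb_def])
qed

lemma tsize_tfst: "tsize (tfst x) \<le> tsize x" by (cases x) auto
lemma tsize_tsnd: "tsize (tsnd x) \<le> tsize x" by (cases x) auto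

lemma ptime_tfst0: "ptime tfst"
  by (rule ptime_expr[of "EFst (EVar 0)"])
    (auto intro!: polyb_add polyb_size polyb_le[OF polyb_size tsize_tfst])

lemma ptime_tsnd0: "ptime tsnd"
  by (rule ptime_expr[of "ESnd (EVar 0)"])
    (auto intro!: polyb_add polyb_size polyb_le[OF polyb_size tsize_tsnd])

lemma ptime_eq0: "ptime (\<lambda>x. enc_bool (tfst x = tsnd x))"
proof (rule ptime_expr[of "EEq (EFst (EVar 0)) (ESnd (EVar 0))"])
  have "tsize (enc_bool b) \<le> 3" for b by (simp add: enc_bool_def)
  then have "polyb (\<lambda>x. tsize (enc_bool (tfst x = tsnd x)))"
    by (intro polyb_le[OF polyb_const[of 3]])
  then show "polyb (\<lambda>x. expr_cost (EEq (EFst (EVar 0)) (ESnd (EVar 0))) (\<lambda>_. x))"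
    unfolding expr_cost.simps eval_expr.simps
    by (intro polyb_add polyb_size polyb_le[OF polyb_size tsize_tsnd] polyb_le[OF polyb_size tsize_tfst])
qed auto

lemma ptime_comp:
  assumes "ptime F" "ptime G"
  shows "ptime (\<lambda>x. F (G x))"
proof -
  obtain p N c where p: "computes p N F c"
    using ptimeE[OF assms(1)] by metis
  obtain q M d where q: "computes q M G d"
    using ptimeE[OF assms(2)] by metis
  show ?thesis
  proof (rule ptimeI[where p = "Seq q p" and N = "max M N" and T = "\<lambda>x. (tsize x + 2) ^ d + (tsize (G x) + 2) ^ c"])
    show "polyb (\<lambda>x. (tsize x + 2) ^ d + (tsize (G x) + 2) ^ c)"
      by (intro polyb_intros assms)
    fix s :: store
    obtain s1 where s1: "exec_le q s ((tsize (s 0) + 2) ^ d) s1" "s1 0 = G (s 0)" "\<forall>v\<ge>M. s1 v = s v"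
      using computesD[OF q] by blast
    obtain s2 where s2: "exec_le p s1 ((tsize (s1 0) + 2) ^ c) s2" "s2 0 = F (s1 0)" "\<forall>v\<ge>N. s2 v = s1 v"
      using computesD[OF p] by blast
    show "\<exists>s'. exec_le (Seq q p) s ((tsize (s 0) + 2) ^ d + (tsize (G (s 0)) + 2) ^ c) s' \<and>
              s' 0 = F (G (s 0)) \<and> (\<forall>v\<ge>max M N. s' v = s v)"
      using s1 s2 by (intro exI[of _ s2]) (auto intro!: exec_le_Seq)
  qed
qed

text \<open>The argument survives the first program in variable \<open>N\<close>, and the first
  result survives the second program in \<open>N+1\<close>; both lie beyond the variables that the
  two programs may change.\<close>

lemma ptime_Branch:
  assumes "ptime F" "ptime G"
  shows "ptime (\<lambda>x. Branch (F x) (G x))"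
proof -
  obtain p N0 c where p: "computes p N0 F c"
    using ptimeE[OF assms(1)] by metis
  obtain q M d where q: "computes q M G d"
    using ptimeE[OF assms(2)] by metis
  define N where "N = max N0 M + 1"
  define P where "P = Seq (Assign N (EVar 0)) (Seq p (Seq (Assign (N+1) (EVar 0)) (Seq (Assign 0 (EVar N)) (Seq q (Assign 0 (EBranch (EVar (N+1)) (EVar 0)))))))"
  define T where "T = (\<lambda>x. tsize x + ((tsize x + 2) ^ c + (tsize (F x) + (tsize x + ((tsize x + 2) ^ d + (tsize (F x) + tsize (G x) + (1 + tsize (F x) + tsize (G x))))))))"
  show ?thesis
  proof (rule ptimeI[where p = P and N = "N+2" and T = T])
    show "polyb T" unfolding T_def
      by (intro polyb_intros assms)
    fix s :: store
    define x where "x = s 0"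
    define s1 where "s1 = s(N := x)"
    obtain s2 where s2: "exec_le p s1 ((tsize (s1 0) + 2) ^ c) s2" "s2 0 = F (s1 0)" "\<forall>v\<ge>N0. s2 v = s1 v"
      using computesD[OF p] by blast
    define s3 where "s3 = s2(N+1 := F x)"
    define s4 where "s4 = s3(0 := x)"
    obtain s5 where s5: "exec_le q s4 ((tsize (s4 0) + 2) ^ d) s5" "s5 0 = G (s4 0)" "\<forall>v\<ge>M. s5 v = s4 v"
      using computesD[OF q] by blast
    define s6 where "s6 = s5(0 := Branch (F x) (G x))"
    have N: "N > 0" "N \<ge> N0" "N \<ge> M" by (auto simp: N_def)
    have a: "s1 0 = x" "s2 0 = F x" "s2 N = x" "s4 0 = x" "s3 N = x" "s5 0 = G x" "s5 (N+1) = F x"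
      using N s2 s5 by (auto simp: s1_def s3_def s4_def x_def)
    have e1: "exec_le (Assign N (EVar 0)) s (tsize x) s1"
      using exec_le_Assign[of "EVar 0" s "tsize x" N] by (simp add: s1_def x_def)
    have e3: "exec_le (Assign (N+1) (EVar 0)) s2 (tsize (F x)) s3"
      using exec_le_Assign[of "EVar 0" s2 "tsize (F x)" "N+1"] a by (simp add: s3_def)
    have e4: "exec_le (Assign 0 (EVar N)) s3 (tsize x) s4"
      using exec_le_Assign[of "EVar N" s3 "tsize x" 0] a by (simp add: s4_def)
    have e6: "exec_le (Assign 0 (EBranch (EVar (N+1)) (EVar 0))) s5 (tsize (F x) + tsize (G x) + (1 + tsize (F x) + tsize (G x))) s6"
      using exec_le_Assign[of "EBranch (EVar (N+1)) (EVar 0)" s5 "tsize (F x) + tsize (G x) + (1 + tsize (F x) + tsize (G x))" 0] a by (simp add: s6_def)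
    have "exec_le P s (T x) s6"
      unfolding P_def
      by (rule exec_le_Seq[OF e1 exec_le_Seq[OF s2(1) exec_le_Seq[OF e3 exec_le_Seq[OF e4
        exec_le_Seq[OF s5(1) e6 order_refl] order_refl] order_refl] order_refl]])
        (simp add: T_def a)
    moreover have "s6 0 = Branch (F x) (G x)" by (simp add: s6_def)
    moreover have "\<forall>v\<ge>N+2. s6 v = s v"
      using N s2(3) s5(3) by (auto simp: s6_def s4_def s3_def s1_def)
    ultimately show "\<exists>s'. exec_le P s (T (s 0)) s' \<and> s' 0 = Branch (F (s 0)) (G (s 0)) \<and> (\<forall>v\<ge>N+2. s' v = s v)"
      unfolding x_def by blast
  qed
qed

lemma ptime_if_Leaf:
  assumes "ptime C" "ptime F" "ptime G"
  shows "ptime (\<lambda>x. if C x \<noteq> Leaf then F x else G x)"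
proof -
  obtain h Nh ch where h: "computes h Nh C ch"
    using ptimeE[OF assms(1)] by metis
  obtain p N0 c where p: "computes p N0 F c"
    using ptimeE[OF assms(2)] by metis
  obtain q M d where q: "computes q M G d"
    using ptimeE[OF assms(3)] by metis
  define N where "N = max Nh (max N0 M) + 1"
  define P where "P = Seq (Assign N (EVar 0)) (Seq h (If (EVar 0) (Seq (Assign 0 (EVar N)) p) (Seq (Assign 0 (EVar N)) q)))"
  define T where "T = (\<lambda>x. tsize x + ((tsize x + 2) ^ ch + (tsize (C x) + (tsize x + ((tsize x + 2) ^ c + (tsize x + 2)^d)))))"
  show ?thesis
  proof (rule ptimeI[where p = P and N = "N+1" and T = T])
    show "polyb T" unfolding T_def
      by (intro polyb_intros assms)
    fix s :: store
    define x where "x = s 0"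
    define s1 where "s1 = s(N := x)"
    obtain s2 where s2: "exec_le h s1 ((tsize (s1 0) + 2) ^ ch) s2" "s2 0 = C (s1 0)" "\<forall>v\<ge>Nh. s2 v = s1 v"
      using computesD[OF h] by blast
    define s3 where "s3 = s2(0 := x)"
    have N: "N > 0" "N \<ge> N0" "N \<ge> M" "N \<ge> Nh" by (auto simp: N_def)
    have a: "s1 0 = x" "s2 0 = C x" "s2 N = x" "s3 0 = x"
      using N s2 by (auto simp: s1_def s3_def x_def)
    have e1: "exec_le (Assign N (EVar 0)) s (tsize x) s1"
      using exec_le_Assign[of "EVar 0" s "tsize x" N] by (simp add: s1_def x_def)
    have e3: "exec_le (Assign 0 (EVar N)) s2 (tsize x) s3"
      using exec_le_Assign[of "EVar N" s2 "tsize x" 0] a by (simp add: s3_def)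
    define T0 where "T0 = tsize x + ((tsize x + 2) ^ c + (tsize x + 2)^d)"
    have "\<exists>s4. (if C x \<noteq> Leaf then exec_le (Seq (Assign 0 (EVar N)) p) s2 T0 s4
        else exec_le (Seq (Assign 0 (EVar N)) q) s2 T0 s4) \<and> s4 0 = (if C x \<noteq> Leaf then F x else G x) \<and> (\<forall>v\<ge>N. s4 v = s3 v)"
    proof (cases "C x = Leaf")
      case True
      obtain s4 where s4: "exec_le q s3 ((tsize (s3 0) + 2) ^ d) s4" "s4 0 = G (s3 0)" "\<forall>v\<ge>M. s4 v = s3 v"
        using computesD[OF q] by blast
      have "exec_le (Seq (Assign 0 (EVar N)) q) s2 T0 s4"
        by (rule exec_le_Seq[OF e3 s4(1)]) (simp add: T0_def a)
      then show ?thesis using True s4 N a by auto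
    next
      case False
      obtain s4 where s4: "exec_le p s3 ((tsize (s3 0) + 2) ^ c) s4" "s4 0 = F (s3 0)" "\<forall>v\<ge>N0. s4 v = s3 v"
        using computesD[OF p] by blast
      have "exec_le (Seq (Assign 0 (EVar N)) p) s2 T0 s4"
        by (rule exec_le_Seq[OF e3 s4(1)]) (simp add: T0_def a)
      then show ?thesis using False s4 N a by auto
    qed
    then obtain s4 where s4: "if C x \<noteq> Leaf then exec_le (Seq (Assign 0 (EVar N)) p) s2 T0 s4
        else exec_le (Seq (Assign 0 (EVar N)) q) s2 T0 s4" "s4 0 = (if C x \<noteq> Leaf then F x else G x)" "\<forall>v\<ge>N. s4 v = s3 v"
      by blast
    have e4: "exec_le (If (EVar 0) (Seq (Assign 0 (EVar N)) p) (Seq (Assign 0 (EVar N)) q)) s2 (tsize (C x) + T0) s4"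
      by (rule exec_le_If[where T = T0]) (use s4 a in auto)
    have "exec_le P s (T x) s4"
      unfolding P_def
      by (rule exec_le_Seq[OF e1 exec_le_Seq[OF s2(1) e4 order_refl]]) (simp add: T_def T0_def a)
    moreover have "\<forall>v\<ge>N+1. s4 v = s v"
      using N s2(3) s4(3) by (auto simp: s3_def s1_def)
    ultimately show "\<exists>s'. exec_le P s (T (s 0)) s' \<and> s' 0 = (if C (s 0) \<noteq> Leaf then F (s 0) else G (s 0)) \<and> (\<forall>v\<ge>N+1. s' v = s v)"
      using s4(2) unfolding x_def by blast
  qed
qed

section \<open>Structural recursion over lists in polynomial time\<close>

text \<open>A paramorphism along the right spine, that is, over the encoded list: the step receives
  the whole remaining suffix and not only its head. \<open>tindex\<close>, \<open>tremdups\<close>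
  and \<open>tpairs\<close> look at that suffix.\<close>

primrec para :: "(tree \<Rightarrow> tree \<Rightarrow> tree) \<Rightarrow> tree \<Rightarrow> tree \<Rightarrow> tree" where
  "para g z Leaf = z"
| "para g z (Branch a b) = g (Branch a b) (para g z b)"

text \<open>A loop walks a list from the front, whereas \<open>para\<close> evaluates it from the
  back. The suffixes are therefore stacked first; the shortest nonempty one ends on top and is
  processed first.\<close>

primrec rev_suffixes :: "tree \<Rightarrow> tree \<Rightarrow> tree" where
  "rev_suffixes Leaf st = st"
| "rev_suffixes (Branch a b) st = rev_suffixes b (Branch (Branch a b) st)"

primrec spine :: "tree \<Rightarrow> tree set" where
  "spine Leaf = {Leaf}"
| "spine (Branch a b) = insert (Branch a b) (spine b)"

text \<open>Values are copied and never shared, so the stack of all suffixes has quadratic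
  size.\<close>

lemma tsize_rev_suffixes: "tsize (rev_suffixes t st) \<le> tsize st + tsize t * (tsize t + 1)"
proof (induction t arbitrary: st)
  case (Branch a b)
  have "tsize (rev_suffixes (Branch a b) st) \<le> tsize (Branch (Branch a b) st) + tsize b * (tsize b + 1)"
    using Branch.IH(2)[of "Branch (Branch a b) st"] by simp
  also have "tsize b * (tsize b + 1) \<le> tsize b * (tsize (Branch a b) + 1)"
    by (intro mult_le_mono) auto
  also have "tsize (Branch (Branch a b) st) + tsize b * (tsize (Branch a b) + 1)
      \<le> tsize st + tsize (Branch a b) * (tsize (Branch a b) + 1)"
  proof -
    have "tsize (Branch a b) * (tsize (Branch a b) + 1) = (1 + tsize a) * (tsize (Branch a b) + 1) + tsize b * (tsize (Branch a b) + 1)"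
      by (simp add: distrib_right)
    moreover have "1 * (tsize (Branch a b) + 1) \<le> (1 + tsize a) * (tsize (Branch a b) + 1)"
      by (intro mult_le_mono) auto
    ultimately show ?thesis by simp
  qed
  finally show ?case by simp
qed simp

lemma tsize_rev_suffixes_ge: "tsize st \<le> tsize (rev_suffixes t st)"
proof (induction t arbitrary: st)
  case (Branch a b)
  then show ?case using Branch.IH(2)[of "Branch (Branch a b) st"] by simp
qed simp

lemma spine_para_bound:
  assumes "\<And>a b r. Branch a b \<in> spine t \<Longrightarrow> tsize (g (Branch a b) r) \<le> tsize r + h"
  shows "tsize (para g z t) \<le> tsize z + tsize t * h"
  using assms
proof (induction t)
  case (Branch a b)
  have "tsize (para g z (Branch a b)) \<le> tsize (para g z b) + h"
    using Branch.prems[of a b] by simp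
  also have "tsize (para g z b) \<le> tsize z + tsize b * h"
    using Branch.IH(2) Branch.prems by simp
  finally show ?case by (simp add: algebra_simps)
qed simp

lemma spine_tsize: "u \<in> spine t \<Longrightarrow> tsize u \<le> tsize t"
  by (induction t) auto

definition push_loop :: "nat \<Rightarrow> prog" where
  "push_loop N = While (EVar (N+1)) (Seq (Assign (N+2) (EBranch (EVar (N+1)) (EVar (N+2)))) (Assign (N+1) (ESnd (EVar (N+1)))))"

lemma push_loop:
  assumes "tsize (s (N+1)) \<le> M" "tsize (rev_suffixes (s (N+1)) (s (N+2))) \<le> M"
  shows "exec_le (push_loop N) s (tsize (s (N+1)) * (9 * M))
    (s(N+1 := Leaf, N+2 := rev_suffixes (s (N+1)) (s (N+2))))"
  using assms
proof (induction "s (N+1)" arbitrary: s)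
  case Leaf
  have e: "s(N+1 := Leaf, N+2 := rev_suffixes (s (N+1)) (s (N+2))) = s"
    using Leaf by (simp add: fun_eq_iff flip: Leaf.hyps)
  have "M \<ge> 1" using Leaf.prems(1) tsize_pos[of "s (N+1)"] by linarith
  then show ?case unfolding e unfolding push_loop_def
    by (intro exec_le_WhileFalse) (simp_all add: Leaf.hyps[symmetric, simplified])
next
  case (Branch a b)
  define s1 where "s1 = s(N+2 := Branch (Branch a b) (s (N+2)))"
  define s2 where "s2 = s1(N+1 := b)"
  have s: "s (N+1) = Branch a b" using Branch.hyps by simp
  have rs: "rev_suffixes b (Branch (Branch a b) (s (N+2))) = rev_suffixes (s (N+1)) (s (N+2))" by (simp add: s[simplified])
  have M: "tsize (Branch (Branch a b) (s (N+2))) \<le> M" "1 + tsize a + tsize b \<le> M"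
    using Branch.prems tsize_rev_suffixes_ge[of "Branch (Branch a b) (s (N+2))" b] unfolding rs by (auto simp: s[simplified])
  have "exec_le (Assign (N+2) (EBranch (EVar (N+1)) (EVar (N+2)))) s (3*M) s1"
    unfolding s1_def using exec_le_Assign[of "EBranch (EVar (N+1)) (EVar (N+2))" s "3*M" "N+2"] M s by (simp add: s[simplified])
  moreover have "exec_le (Assign (N+1) (ESnd (EVar (N+1)))) s1 (2*M) s2"
    unfolding s2_def using exec_le_Assign[of "ESnd (EVar (N+1))" s1 "2*M" "N+1"] M s by (simp add: s1_def s[simplified])
  ultimately have body: "exec_le (Seq (Assign (N+2) (EBranch (EVar (N+1)) (EVar (N+2)))) (Assign (N+1) (ESnd (EVar (N+1))))) s (5*M) s2"
    by (rule exec_le_Seq) simp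
  have "exec_le (push_loop N) s2 (tsize (s2 (N+1)) * (9 * M))
    (s2(N+1 := Leaf, N+2 := rev_suffixes (s2 (N+1)) (s2 (N+2))))"
    by (rule Branch.hyps(2)) (use Branch.prems M rs in \<open>simp_all add: s2_def s1_def\<close>)
  moreover have "s2(N+1 := Leaf, N+2 := rev_suffixes (s2 (N+1)) (s2 (N+2))) = s(N+1 := Leaf, N+2 := rev_suffixes (s (N+1)) (s (N+2)))"
    by (auto simp: s2_def s1_def rs[simplified] fun_eq_iff)
  ultimately have rest: "exec_le (push_loop N) s2 (tsize b * (9 * M)) (s(N+1 := Leaf, N+2 := rev_suffixes (s (N+1)) (s (N+2))))"
    by (simp add: s2_def)
  show ?case unfolding push_loop_def
    by (rule exec_le_WhileTrue[OF _ body rest[unfolded push_loop_def]])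
      (use M in \<open>simp_all add: s[simplified] algebra_simps\<close>)
qed

definition pop_loop :: "nat \<Rightarrow> prog \<Rightarrow> prog" where
  "pop_loop N p = While (EVar (N+2))
     (Seq (Assign 0 (EBranch (EBranch (EVar N) (EFst (EVar (N+2)))) (EVar (N+3))))
     (Seq p (Seq (Assign (N+3) (EVar 0)) (Assign (N+2) (ESnd (EVar (N+2)))))))"

text \<open>In \<open>rev_suffixes t st\<close> the entry for \<open>t\<close> itself lies below
  those of its tail. The induction hypothesis consumes the tail's entries first, so what happens
  afterwards has to be passed to it: \<open>T\<close> and \<open>Q\<close> describe an arbitrary
  continuation of the run. The step program is called on a tree of size at most
  \<open>3 * M + 2\<close>, hence the power of \<open>3 * M + 4\<close> in \<open>D\<close>;
  \<open>22 * M\<close> generously covers the test and the assignments.\<close>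

lemma pop_loop:
  assumes p: "computes p N (\<lambda>y. G (tfst (tfst y)) (tsnd (tfst y)) (tsnd y)) c"
    and N: "N > 0"
    and D: "D = 22 * M + (3 * M + 4) ^ c"
    and M: "tsize x \<le> M" "\<And>u. u \<in> spine t \<Longrightarrow> tsize (para (G x) z u) \<le> M"
  shows "\<lbrakk>s N = x; s (N+2) = rev_suffixes t st; s (N+3) = z; tsize (s (N+2)) \<le> M;
      \<And>s'. \<lbrakk>s' N = x; s' (N+2) = st; s' (N+3) = para (G x) z t; \<forall>v\<ge>N+4. s' v = s v\<rbrakk> \<Longrightarrow>
        \<exists>s''. exec_le (pop_loop N p) s' T s'' \<and> Q s''\<rbrakk>
    \<Longrightarrow> \<exists>s''. exec_le (pop_loop N p) s (T + tsize t * D) s'' \<and> Q s''"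
  using M(2)
proof (induction t arbitrary: st s T)
  case Leaf
  obtain s'' where "exec_le (pop_loop N p) s T s'' \<and> Q s''" using Leaf.prems by force
  then show ?case using exec_le_mono[of _ s T s'' "T + tsize Leaf * D"] by auto
next
  case (Branch a b)
  define w where "w = Branch a b"
  define z' where "z' = para (G x) z b"
  have zz: "para (G x) z (Branch a b) = G x w z'" by (simp add: w_def z'_def)
  have "\<exists>s''. exec_le (pop_loop N p) s ((T + D) + tsize b * D) s'' \<and> Q s''"
  proof (rule Branch.IH(2)[where st = "Branch w st"])
    show "s N = x" "s (N+3) = z" "tsize (s (N+2)) \<le> M" by fact+
    show "s (N+2) = rev_suffixes b (Branch w st)" using Branch.prems(2) by (simp add: w_def)
    show "tsize (para (G x) z u) \<le> M" if "u \<in> spine b" for u using Branch.prems(6) that by simp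
    fix s1 assume s1: "s1 N = x" "s1 (N+2) = Branch w st" "s1 (N+3) = para (G x) z b" "\<forall>v\<ge>N+4. s1 v = s v"
    have st: "tsize (Branch w st) \<le> M"
      using Branch.prems(2,4) tsize_rev_suffixes_ge[of "Branch w st" b] by (simp add: w_def)
    have z': "tsize z' \<le> M" using Branch.prems(6)[of b] by (cases b) (auto simp: z'_def)
    define s2 where "s2 = s1(0 := Branch (Branch x w) z')"
    have e1: "exec_le (Assign 0 (EBranch (EBranch (EVar N) (EFst (EVar (N+2)))) (EVar (N+3)))) s1 (12 * M) s2"
      unfolding s2_def
      using exec_le_Assign[of "EBranch (EBranch (EVar N) (EFst (EVar (N+2)))) (EVar (N+3))" s1 "12*M" 0] s1 st z' M(1)
      by (simp add: z'_def)
    obtain s3 where s3: "exec_le p s2 ((tsize (s2 0) + 2) ^ c) s3" "s3 0 = G x w z'" "\<forall>v\<ge>N. s3 v = s2 v"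
      using computesD[OF p, of s2] by (auto simp: s2_def)
    have "(tsize (s2 0) + 2) ^ c \<le> (3 * M + 4) ^ c"
      using st z' M(1) by (intro power_mono) (auto simp: s2_def)
    then have e2: "exec_le p s2 ((3 * M + 4) ^ c) s3" using s3 exec_le_mono by blast
    define s4 where "s4 = s3(N+3 := G x w z')"
    have e3: "exec_le (Assign (N+3) (EVar 0)) s3 M s4"
      unfolding s4_def using exec_le_Assign[of "EVar 0" s3 M "N+3"] s3 Branch.prems(6)[of "Branch a b"] zz by simp
    define s5 where "s5 = s4(N+2 := st)"
    have s4: "s4 (N+2) = Branch w st" using s1 s3 N by (simp add: s4_def s2_def)
    have e4: "exec_le (Assign (N+2) (ESnd (EVar (N+2)))) s4 (2*M) s5"
      unfolding s5_def using exec_le_Assign[of "ESnd (EVar (N+2))" s4 "2*M" "N+2"] s4 st by simp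
    have "s5 N = x" "s5 (N+2) = st" "s5 (N+3) = para (G x) z (Branch a b)" "\<forall>v\<ge>N+4. s5 v = s v"
      using s1 s3 N unfolding zz by (auto simp: s5_def s4_def s2_def)
    then obtain s6 where s6: "exec_le (pop_loop N p) s5 T s6" "Q s6"
      using Branch.prems(5)[of s5] by blast
    have body: "exec_le (Seq (Assign 0 (EBranch (EBranch (EVar N) (EFst (EVar (N+2)))) (EVar (N+3))))
     (Seq p (Seq (Assign (N+3) (EVar 0)) (Assign (N+2) (ESnd (EVar (N+2))))))) s1 (15*M + (3 * M + 4) ^ c) s5"
      by (rule exec_le_Seq[OF e1 exec_le_Seq[OF e2 exec_le_Seq[OF e3 e4 order_refl] order_refl]]) simp
    have "exec_le (pop_loop N p) s1 (T + D) s6"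
      unfolding pop_loop_def
      by (rule exec_le_WhileTrue[OF _ body s6(1)[unfolded pop_loop_def]])
        (use s1 st in \<open>simp_all add: D\<close>)
    then show "\<exists>s''. exec_le (pop_loop N p) s1 (T + D) s'' \<and> Q s''" using s6(2) by blast
  qed
  then show ?case using exec_le_mono[of "pop_loop N p" s "(T + D) + tsize b * D" _ "T + tsize (Branch a b) * D"] by (auto simp: algebra_simps)
qed

lemma ptime_para0:
  assumes G: "ptime (\<lambda>p. G (tfst (tfst p)) (tsnd (tfst p)) (tsnd p))"
    and growth: "\<And>x a b r. tsize (G x (Branch a b) r) \<le> tsize r + (tsize x + tsize (Branch a b) + 2) ^ d"
  shows "ptime (\<lambda>y. para (G (tfst y)) (tsnd (tsnd y)) (tfst (tsnd y)))"
proof -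
  obtain p N c where p: "computes p N (\<lambda>y. G (tfst (tfst y)) (tsnd (tfst y)) (tsnd y)) c"
    and N: "N > 0"
    using ptimeE[OF G] by metis
  \<comment> \<open>A common bound for all values: the input, the accumulators (growth is additive,
    at most \<open>tsize y\<close> steps), and in the last summand the stack of suffixes.\<close>
  define m where "m = (\<lambda>y. tsize y + tsize y * (2 * tsize y + 2) ^ d + (1 + tsize y * (tsize y + 1)))"
  define D where "D = (\<lambda>y. 22 * m y + (3 * m y + 4) ^ c)"
  define T where "T = (\<lambda>y. 10 * tsize y + (tsize y * (9 * m y) + ((1 + tsize y * D y) + m y)))"
  define P where "P = Seq (Assign N (EFst (EVar 0))) (Seq (Assign (N+1) (EFst (ESnd (EVar 0)))) (Seq (Assign (N+2) ELeaf)
     (Seq (Assign (N+3) (ESnd (ESnd (EVar 0)))) (Seq (push_loop N) (Seq (pop_loop N p) (Assign 0 (EVar (N+3))))))))"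
  show ?thesis
  proof (rule ptimeI[where p = P and N = "N+4" and T = T])
    show "polyb T" unfolding T_def D_def m_def
      by (intro polyb_add polyb_mult polyb_const polyb_size polyb_pow)
    fix s :: store
    define y where "y = s 0"
    define x where "x = tfst y"
    define t where "t = tfst (tsnd y)"
    define z where "z = tsnd (tsnd y)"
    have sz: "tsize x \<le> tsize y" "tsize t \<le> tsize y" "tsize z \<le> tsize y" "tsize (tsnd y) \<le> tsize y"
      unfolding x_def t_def z_def using tsize_tfst tsize_tsnd order_trans by blast+
    have tree_size: "tsize z + tsize t * (2 * tsize y + 2) ^ d \<le> m y"
      unfolding m_def using sz by (intro trans_le_add1 add_mono mult_le_mono1)
    have acc: "tsize (para (G x) z u) \<le> m y" if u: "u \<in> spine t" for u
    proof -
      have "tsize (para (G x) z u) \<le> tsize z + tsize u * (2 * tsize y + 2) ^ d"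
      proof (rule spine_para_bound)
        fix a b r assume "Branch a b \<in> spine u"
        then have "tsize (Branch a b) \<le> tsize y" using spine_tsize[of "Branch a b" u] spine_tsize[OF u] sz by linarith
        then have "(tsize x + tsize (Branch a b) + 2) ^ d \<le> (2 * tsize y + 2) ^ d"
          using sz by (intro power_mono) auto
        then show "tsize (G x (Branch a b) r) \<le> tsize r + (2 * tsize y + 2) ^ d"
          using growth[of x a b r] by linarith
      qed
      also have "\<dots> \<le> tsize z + tsize t * (2 * tsize y + 2) ^ d"
        using spine_tsize[OF u] by (intro add_left_mono mult_le_mono1)
      finally show ?thesis using tree_size by linarith
    qed
    have self: "t \<in> spine t" by (cases t) auto
    have st: "tsize (rev_suffixes t Leaf) \<le> m y"
    proof -
      have "tsize (rev_suffixes t Leaf) \<le> 1 + tsize t * (tsize t + 1)" using tsize_rev_suffixes[of t Leaf] by simp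
      also have "\<dots> \<le> 1 + tsize y * (tsize y + 1)" using sz by (intro add_mono mult_le_mono) auto
      finally show ?thesis by (simp add: m_def)
    qed
    have ym: "tsize y \<le> m y" unfolding m_def by linarith
    define s1 where "s1 = s(N := x, N+1 := t, N+2 := Leaf, N+3 := z)"
    have e: "exec_le (Seq (Assign N (EFst (EVar 0))) (Seq (Assign (N+1) (EFst (ESnd (EVar 0)))) (Seq (Assign (N+2) ELeaf)
     (Seq (Assign (N+3) (ESnd (ESnd (EVar 0)))) q)))) s (10 * tsize y + T') s'" if "exec_le q s1 T' s'" for q T' s'
    proof -
      have y1: "tsize y \<ge> 1" using tsize_pos[of y] by linarith
      have "exec_le (Assign N (EFst (EVar 0))) s (2 * tsize y) (s(N := x))"
        using exec_le_Assign[of "EFst (EVar 0)" s "2 * tsize y" N] sz by (simp add: x_def y_def)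
      moreover have "exec_le (Assign (N+1) (EFst (ESnd (EVar 0)))) (s(N := x)) (3 * tsize y) (s(N := x, N+1 := t))"
        using exec_le_Assign[of "EFst (ESnd (EVar 0))" "s(N := x)" "3 * tsize y" "N+1"] sz N by (simp add: t_def y_def)
      moreover have "exec_le (Assign (N+2) ELeaf) (s(N := x, N+1 := t)) (tsize y) (s(N := x, N+1 := t, N+2 := Leaf))"
        using exec_le_Assign[of ELeaf "s(N := x, N+1 := t)" "tsize y" "N+2"] y1 by simp
      moreover have "exec_le (Assign (N+3) (ESnd (ESnd (EVar 0)))) (s(N := x, N+1 := t, N+2 := Leaf)) (3 * tsize y) s1"
        using exec_le_Assign[of "ESnd (ESnd (EVar 0))" "s(N := x, N+1 := t, N+2 := Leaf)" "3 * tsize y" "N+3"] sz N by (simp add: z_def y_def s1_def)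
      ultimately show ?thesis
        by (rule exec_le_Seq[OF _ exec_le_Seq[OF _ exec_le_Seq[OF _ exec_le_Seq[OF _ that order_refl] order_refl] order_refl]]) simp
    qed
    define s2 where "s2 = s1(N+1 := Leaf, N+2 := rev_suffixes t Leaf)"
    have "exec_le (push_loop N) s1 (tsize t * (9 * m y)) s2"
      using push_loop[of s1 N "m y"] sz ym st by (simp add: s1_def s2_def)
    then have e2: "exec_le (push_loop N) s1 (tsize y * (9 * m y)) s2"
      by (rule exec_le_mono) (simp add: sz)
    have "\<exists>s''. exec_le (pop_loop N p) s2 (1 + tsize t * D y) s'' \<and> (s'' (N+3) = para (G x) z t \<and> (\<forall>v\<ge>N+4. s'' v = s v))"
    proof (rule pop_loop[where st = Leaf and M = "m y" and G = G and c = c and x = x and z = z])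
      show "computes p N (\<lambda>y. G (tfst (tfst y)) (tsnd (tfst y)) (tsnd y)) c" by (rule p)
      show "N > 0" by fact
      show "D y = 22 * m y + (3 * m y + 4) ^ c" by (simp add: D_def)
      show "tsize x \<le> m y" using sz ym by linarith
      show "tsize (para (G x) z u) \<le> m y" if "u \<in> spine t" for u using acc that .
      show "s2 N = x" "s2 (N+2) = rev_suffixes t Leaf" "s2 (N+3) = z" "tsize (s2 (N+2)) \<le> m y"
        using st by (auto simp: s2_def s1_def)
      fix s' assume s': "s' N = x" "s' (N+2) = Leaf" "s' (N+3) = para (G x) z t" "\<forall>v\<ge>N+4. s' v = s2 v"
      then show "\<exists>s''. exec_le (pop_loop N p) s' 1 s'' \<and> s'' (N+3) = para (G x) z t \<and> (\<forall>v\<ge>N+4. s'' v = s v)"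
        unfolding pop_loop_def by (intro exI[of _ s'] conjI exec_le_WhileFalse) (auto simp: s2_def s1_def)
    qed
    then obtain s3 where s3: "exec_le (pop_loop N p) s2 (1 + tsize t * D y) s3" "s3 (N+3) = para (G x) z t" "\<forall>v\<ge>N+4. s3 v = s v"
      by blast
    have e3: "exec_le (pop_loop N p) s2 (1 + tsize y * D y) s3"
      using exec_le_mono[OF s3(1)] sz by simp
    have e4: "exec_le (Assign 0 (EVar (N+3))) s3 (m y) (s3(0 := para (G x) z t))"
      using exec_le_Assign[of "EVar (N+3)" s3 "m y" 0] s3 acc[OF self] by simp
    have "exec_le P s (T y) (s3(0 := para (G x) z t))"
      unfolding P_def T_def
      by (rule e[OF exec_le_Seq[OF e2 exec_le_Seq[OF e3 e4 order_refl] order_refl]])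
    then show "\<exists>s'. exec_le P s (T (s 0)) s' \<and> s' 0 = para (G (tfst (s 0))) (tsnd (tsnd (s 0))) (tfst (tsnd (s 0))) \<and> (\<forall>v\<ge>N+4. s' v = s v)"
      using s3(3) by (intro exI[of _ "s3(0 := para (G x) z t)"]) (auto simp: x_def y_def z_def t_def)
  qed
qed

text \<open>The growth condition is additive: a step that, say, doubles the size would make the result
  exponentially large.\<close>

lemma ptime_para:
  assumes "ptime L" "ptime Z" "ptime (\<lambda>p. G (tfst (tfst p)) (tsnd (tfst p)) (tsnd p))"
    and "\<And>x a b r. tsize (G x (Branch a b) r) \<le> tsize r + (tsize x + tsize (Branch a b) + 2) ^ d"
  shows "ptime (\<lambda>x. para (G x) (Z x) (L x))"
  using ptime_comp[OF ptime_para0[OF assms(3,4)] ptime_Branch[OF ptime_id ptime_Branch[OF assms(1,2)]]]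
  by simp

section \<open>Polynomial-time functions on trees\<close>

text \<open>A function of several arguments counts as polynomial-time through its action on nested
  pairs. The closure rules below state their hypotheses on parametrised functions in this
  form.\<close>

lemma ptime_app: "ptime (\<lambda>p. F (tfst p) (tsnd p)) \<Longrightarrow> ptime A \<Longrightarrow> ptime B \<Longrightarrow> ptime (\<lambda>x. F (A x) (B x))"
  using ptime_comp[of "\<lambda>p. F (tfst p) (tsnd p)" "\<lambda>x. Branch (A x) (B x)"] ptime_Branch by simp

text \<open>The growth allowed per step may be the output size of any polynomial-time
  \<open>H\<close> of the parameter and the suffix, so no exponent has to be found by hand.\<close>

lemma ptime_para_growth:
  assumes "ptime L" "ptime Z" "ptime (\<lambda>p. G (tfst (tfst p)) (tsnd (tfst p)) (tsnd p))" "ptime H"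
    and g: "\<And>x a b r. tsize (G x (Branch a b) r) \<le> tsize r + tsize (H (Branch x (Branch a b)))"
  shows "ptime (\<lambda>x. para (G x) (Z x) (L x))"
proof -
  obtain c where c: "\<And>x. tsize (H x) \<le> (tsize x + 2) ^ c" using ptime_tsize[OF \<open>ptime H\<close>] by blast
  have "tsize (G x (Branch a b) r) \<le> tsize r + (tsize x + tsize (Branch a b) + 2) ^ (2 * c)" for x a b r
  proof -
    define m where "m = tsize x + tsize (Branch a b)"
    have "tsize (Branch x (Branch a b)) + 2 \<le> (m + 2)^2" by (simp add: m_def power2_eq_square)
    then have "(tsize (Branch x (Branch a b)) + 2) ^ c \<le> (m + 2) ^ (2 * c)"
      unfolding power_mult by (rule power_mono) simp
    then show ?thesis using g[of x a b r] c[of "Branch x (Branch a b)"] unfolding m_def by linarith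
  qed
  then show ?thesis using assms(1-3) by (rule ptime_para[rotated 3])
qed

named_theorems ptime_intros

lemmas [ptime_intros] = ptime_const ptime_id ptime_Branch

lemma ptime_tfst[ptime_intros]: "ptime F \<Longrightarrow> ptime (\<lambda>x. tfst (F x))"
  by (rule ptime_comp[OF ptime_tfst0])

lemma ptime_tsnd[ptime_intros]: "ptime F \<Longrightarrow> ptime (\<lambda>x. tsnd (F x))"
  by (rule ptime_comp[OF ptime_tsnd0])

lemma ptime_eq[ptime_intros]: "ptime F \<Longrightarrow> ptime G \<Longrightarrow> ptime (\<lambda>x. enc_bool (F x = G x))"
  by (rule ptime_app[OF ptime_eq0])

lemma enc_bool_eq_Leaf[simp]: "enc_bool p = Leaf \<longleftrightarrow> \<not> p"
  by (simp add: enc_bool_def)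

lemma enc_bool_inject[simp]: "enc_bool p = enc_bool q \<longleftrightarrow> p = q"
  by (simp add: enc_bool_def)

lemma ptime_if[ptime_intros]:
  "ptime (\<lambda>x. enc_bool (P x)) \<Longrightarrow> ptime F \<Longrightarrow> ptime G \<Longrightarrow> ptime (\<lambda>x. if P x then F x else G x)"
  using ptime_if_Leaf[of "\<lambda>x. enc_bool (P x)" F G] by simp

lemma ptime_not[ptime_intros]: "ptime (\<lambda>x. enc_bool (P x)) \<Longrightarrow> ptime (\<lambda>x. enc_bool (\<not> P x))"
  using ptime_if[of P "\<lambda>_. enc_bool False" "\<lambda>_. enc_bool True", OF _ ptime_const ptime_const]
  by (rule back_subst[of ptime]) (auto simp: fun_eq_iff)

lemma ptime_conj[ptime_intros]:
  "ptime (\<lambda>x. enc_bool (P x)) \<Longrightarrow> ptime (\<lambda>x. enc_bool (Q x)) \<Longrightarrow> ptime (\<lambda>x. enc_bool (P x \<and> Q x))"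
  using ptime_if[of P "\<lambda>x. enc_bool (Q x)" "\<lambda>_. enc_bool False", OF _ _ ptime_const]
  by (rule back_subst[of ptime]) (auto simp: fun_eq_iff)

lemma ptime_disj[ptime_intros]:
  "ptime (\<lambda>x. enc_bool (P x)) \<Longrightarrow> ptime (\<lambda>x. enc_bool (Q x)) \<Longrightarrow> ptime (\<lambda>x. enc_bool (P x \<or> Q x))"
  using ptime_if[of P "\<lambda>_. enc_bool True" "\<lambda>x. enc_bool (Q x)", OF _ ptime_const]
  by (rule back_subst[of ptime]) (auto simp: fun_eq_iff)

lemma ptime_imp[ptime_intros]:
  "ptime (\<lambda>x. enc_bool (P x)) \<Longrightarrow> ptime (\<lambda>x. enc_bool (Q x)) \<Longrightarrow> ptime (\<lambda>x. enc_bool (P x \<longrightarrow> Q x))"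
  using ptime_if[of P "\<lambda>x. enc_bool (Q x)" "\<lambda>_. enc_bool True", OF _ _ ptime_const]
  by (rule back_subst[of ptime]) (auto simp: fun_eq_iff)

lemma ptime_iff[ptime_intros]:
  "ptime (\<lambda>x. enc_bool (P x)) \<Longrightarrow> ptime (\<lambda>x. enc_bool (Q x)) \<Longrightarrow> ptime (\<lambda>x. enc_bool (P x = Q x))"
  using ptime_eq[of "\<lambda>x. enc_bool (P x)" "\<lambda>x. enc_bool (Q x)"] by simp

text \<open>Every tree encodes exactly one list, so the list functions below are total on trees.\<close>

primrec dec :: "tree \<Rightarrow> tree list" where
  "dec Leaf = []"
| "dec (Branch a b) = a # dec b"

lemma dec_enc_list[simp]: "dec (enc_list xs) = xs" by (induction xs) auto
lemma enc_list_dec[simp]: "enc_list (dec t) = t" by (induction t) auto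
lemma enc_list_eq_iff[simp]: "enc_list xs = enc_list ys \<longleftrightarrow> xs = ys" by (metis dec_enc_list)
lemma dec_eq_iff: "dec s = dec t \<longleftrightarrow> s = t" by (metis enc_list_dec)

section \<open>List operations\<close>

definition tapp :: "tree \<Rightarrow> tree \<Rightarrow> tree" where
  "tapp s t = para (\<lambda>u r. Branch (tfst u) r) t s"

lemma dec_tapp[simp]: "dec (tapp s t) = dec s @ dec t"
  unfolding tapp_def by (induction s) auto

lemma tsize_tapp: "tsize (tapp s t) + 1 = tsize s + tsize t"
  unfolding tapp_def by (induction s) auto

lemma ptime_tapp[ptime_intros]: "ptime F \<Longrightarrow> ptime G \<Longrightarrow> ptime (\<lambda>x. tapp (F x) (G x))"
  unfolding tapp_def
  by (rule ptime_para_growth[where H = "\<lambda>x. x"]) (auto intro!: ptime_intros)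

text \<open>The bind of the list monad. Mapping, filtering and bounded quantifiers are instances of
  it and inherit its running time; the step appends one output of \<open>F\<close>, so its growth is
  additive.\<close>

definition tbind :: "(tree \<Rightarrow> tree) \<Rightarrow> tree \<Rightarrow> tree" where
  "tbind F t = para (\<lambda>u r. tapp (F (tfst u)) r) Leaf t"

lemma dec_tbind[simp]: "dec (tbind F t) = concat (map (\<lambda>e. dec (F e)) (dec t))"
  unfolding tbind_def by (induction t) auto

lemma ptime_tbind[ptime_intros]:
  assumes "ptime (\<lambda>p. F (tfst p) (tsnd p))" "ptime L"
  shows "ptime (\<lambda>x. tbind (F x) (L x))"
  unfolding tbind_def
proof (rule ptime_para_growth[OF assms(2) ptime_const])
  show "ptime (\<lambda>p. tapp (F (tfst (tfst p)) (tfst (tsnd (tfst p)))) (tsnd p))"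
    by (intro ptime_intros ptime_app[OF assms(1)])
  show "ptime (\<lambda>p. F (tfst p) (tfst (tsnd p)))"
    by (intro ptime_intros ptime_app[OF assms(1)])
  show "tsize (tapp (F x (tfst (Branch a b))) r) \<le> tsize r + tsize (F (tfst (Branch x (Branch a b))) (tfst (tsnd (Branch x (Branch a b)))))" for x a b r
    using tsize_tapp[of "F x a" r] by simp
qed

definition tmap :: "(tree \<Rightarrow> tree) \<Rightarrow> tree \<Rightarrow> tree" where
  "tmap F t = tbind (\<lambda>e. Branch (F e) Leaf) t"

lemma dec_tmap[simp]: "dec (tmap F t) = map F (dec t)"
  unfolding tmap_def by (simp add: concat_map_singleton)

lemma ptime_tmap[ptime_intros]:
  "ptime (\<lambda>p. F (tfst p) (tsnd p)) \<Longrightarrow> ptime L \<Longrightarrow> ptime (\<lambda>x. tmap (F x) (L x))"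
  unfolding tmap_def by (intro ptime_intros)

definition tfilter :: "(tree \<Rightarrow> bool) \<Rightarrow> tree \<Rightarrow> tree" where
  "tfilter P t = tbind (\<lambda>e. if P e then Branch e Leaf else Leaf) t"

lemma dec_tfilter[simp]: "dec (tfilter P t) = filter P (dec t)"
proof -
  have "concat (map (\<lambda>e. dec (if P e then Branch e Leaf else Leaf)) xs) = filter P xs" for xs
    by (induction xs) auto
  then show ?thesis by (simp add: tfilter_def)
qed

lemma ptime_tfilter[ptime_intros]:
  "ptime (\<lambda>p. enc_bool (P (tfst p) (tsnd p))) \<Longrightarrow> ptime L \<Longrightarrow> ptime (\<lambda>x. tfilter (P x) (L x))"
  unfolding tfilter_def by (intro ptime_intros)

lemma Bex_dl_iff: "(\<exists>e\<in>set (dec t). P e) \<longleftrightarrow> tfilter P t \<noteq> Leaf"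
  by (simp add: dec_eq_iff[symmetric] filter_empty_conv)

lemma ptime_Bex[ptime_intros]:
  "ptime (\<lambda>p. enc_bool (P (tfst p) (tsnd p))) \<Longrightarrow> ptime L \<Longrightarrow> ptime (\<lambda>x. enc_bool (\<exists>e\<in>set (dec (L x)). P x e))"
  unfolding Bex_dl_iff by (intro ptime_intros)

lemma ptime_Ball[ptime_intros]:
  assumes "ptime (\<lambda>p. enc_bool (P (tfst p) (tsnd p)))" "ptime L"
  shows "ptime (\<lambda>x. enc_bool (\<forall>e\<in>set (dec (L x)). P x e))"
proof -
  have "ptime (\<lambda>x. enc_bool (\<not> (\<exists>e\<in>set (dec (L x)). \<not> P x e)))"
    using assms by (intro ptime_intros)
  then show ?thesis by simp
qed

lemma ptime_mem[ptime_intros]: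
  assumes "ptime F" "ptime L"
  shows "ptime (\<lambda>x. enc_bool (F x \<in> set (dec (L x))))"
proof -
  have "ptime (\<lambda>x. enc_bool (\<exists>e\<in>set (dec (L x)). e = F x))"
    by (intro ptime_intros ptime_comp[OF assms(1) ptime_tfst0] assms)
  then show ?thesis by simp
qed

section \<open>Counting, positions and enumerations\<close>

abbreviation tt :: tree where "tt \<equiv> Branch Leaf Leaf"

text \<open>Binary increment with the carry as recursion: at a digit 0 the carry stops and the
  untouched suffix is kept in place of the recursive result. No other arithmetic is needed, since
  every number in the output is a constant or the length of a list.\<close>

definition tinc :: "tree \<Rightarrow> tree" where
  "tinc t = para (\<lambda>u r. if tfst u = Leaf then Branch tt (tsnd u) else Branch Leaf r) (Branch tt Leaf) t"

lemma tsize_tinc: "tsize (tinc t) \<le> tsize t + 4"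
  unfolding tinc_def
proof (induction t)
  case (Branch a b)
  then show ?case by (cases a) (auto simp: add_mono)
qed simp

lemma bits_0[simp]: "bits 0 = []" by (simp add: bits.simps)
lemma bits_pos: "n > 0 \<Longrightarrow> bits n = odd n # bits (n div 2)" by (subst bits.simps) simp

lemma tinc_enc_nat: "tinc (enc_nat n) = enc_nat (Suc n)"
proof (induction n rule: less_induct)
  case (less n)
  show ?case
  proof (cases "n = 0")
    case True
    then show ?thesis by (simp add: enc_nat_def tinc_def bits_pos enc_bool_def)
  next
    case False
    have IH: "tinc (enc_nat (n div 2)) = enc_nat (Suc (n div 2))" using less False by simp
    show ?thesis
    proof (cases "odd n")
      case True
      then have "Suc n div 2 = Suc (n div 2)" by (auto elim: oddE)
      then show ?thesis using IH True False
        by (simp add: enc_nat_def tinc_def bits_pos[of n] bits_pos[of "Suc n"] enc_bool_def)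
    next
      case e: False
      then have "Suc n div 2 = n div 2" by (auto elim: evenE)
      then show ?thesis using e False
        by (simp add: enc_nat_def tinc_def bits_pos[of n] bits_pos[of "Suc n"] enc_bool_def)
    qed
  qed
qed

lemma ptime_tinc[ptime_intros]: "ptime F \<Longrightarrow> ptime (\<lambda>x. tinc (F x))"
  unfolding tinc_def
  by (rule ptime_para_growth[where H = "\<lambda>x. Branch tt x"]) (auto intro!: ptime_intros)

definition tlen :: "tree \<Rightarrow> tree" where
  "tlen t = para (\<lambda>u r. tinc r) Leaf t"

lemma tlen: "tlen t = enc_nat (length (dec t))"
  unfolding tlen_def
  by (induction t) (auto simp: tinc_enc_nat enc_nat_def[of 0])

lemma ptime_tlen[ptime_intros]: "ptime F \<Longrightarrow> ptime (\<lambda>x. tlen (F x))"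
  unfolding tlen_def
proof (rule ptime_para_growth[where H = "\<lambda>x. Branch tt x"])
  show "tsize (tinc r) \<le> tsize r + tsize (Branch tt (Branch x (Branch a b)))" for x a b r
    using tsize_tinc[of r] by simp
qed (auto intro!: ptime_intros)

definition tindex :: "tree \<Rightarrow> tree" where
  "tindex t = para (\<lambda>u r. Branch (Branch (tlen (tsnd u)) (tfst u)) r) Leaf t"

text \<open>An element is numbered by how many elements follow it, so \<open>index_list (rev xs)\<close> numbers \<open>xs\<close>
  by position.\<close>

primrec index_list :: "'a list \<Rightarrow> (nat \<times> 'a) list" where
  "index_list [] = []"
| "index_list (x # xs) = (length xs, x) # index_list xs"

lemma dec_tindex[simp]: "dec (tindex t) = map (\<lambda>(j, x). Branch (enc_nat j) x) (index_list (dec t))"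
  unfolding tindex_def by (induction t) (auto simp: tlen)

lemma ptime_tindex[ptime_intros]: "ptime F \<Longrightarrow> ptime (\<lambda>x. tindex (F x))"
  unfolding tindex_def
  by (rule ptime_para_growth[where H = "\<lambda>x. Branch (Branch (tlen (tsnd (tsnd x))) (tfst (tsnd x))) Leaf"])
    (auto intro!: ptime_intros)

definition trev :: "tree \<Rightarrow> tree" where
  "trev t = para (\<lambda>u r. tapp r (Branch (tfst u) Leaf)) Leaf t"

lemma dec_trev[simp]: "dec (trev t) = rev (dec t)"
  unfolding trev_def by (induction t) auto

lemma ptime_trev[ptime_intros]: "ptime F \<Longrightarrow> ptime (\<lambda>x. trev (F x))"
  unfolding trev_def
proof (rule ptime_para_growth[where H = "\<lambda>x. x"])
  show "tsize (tapp r (Branch (tfst (Branch a b)) Leaf)) \<le> tsize r + tsize (Branch x (Branch a b))" for x a b r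
    using tsize_tapp[of r "Branch a Leaf"] by simp
qed (auto intro!: ptime_intros)

definition tremdups :: "tree \<Rightarrow> tree" where
  "tremdups t = para (\<lambda>u r. if tfst u \<in> set (dec (tsnd u)) then r else Branch (tfst u) r) Leaf t"

lemma dec_tremdups[simp]: "dec (tremdups t) = remdups (dec t)"
  unfolding tremdups_def by (induction t) auto

lemma ptime_tremdups[ptime_intros]: "ptime F \<Longrightarrow> ptime (\<lambda>x. tremdups (F x))"
  unfolding tremdups_def
  by (rule ptime_para_growth[where H = "\<lambda>x. x"]) (auto intro!: ptime_intros)

definition tpairs :: "tree \<Rightarrow> tree" where
  "tpairs t = para (\<lambda>u r. tapp (tmap (\<lambda>y. Branch (tfst u) y) (tsnd u)) r) Leaf t"

lemma set_tpairs: "set (dec (tpairs (enc_list xs))) = {Branch (xs ! i) (xs ! j) | i j. i < j \<and> j < length xs}"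
proof (induction xs)
  case (Cons x xs)
  have "set (dec (tpairs (enc_list (x # xs)))) = Branch x ` set xs \<union> set (dec (tpairs (enc_list xs)))"
    by (simp add: tpairs_def)
  also have "\<dots> = {Branch ((x # xs) ! i) ((x # xs) ! j) | i j. i < j \<and> j < length (x # xs)}" (is "_ = ?R")
  proof (intro set_eqI iffI)
    fix p assume "p \<in> Branch x ` set xs \<union> set (dec (tpairs (enc_list xs)))"
    then consider j where "j < length xs" "p = Branch x (xs ! j)"
      | i j where "i < j" "j < length xs" "p = Branch (xs ! i) (xs ! j)"
      unfolding Cons.IH by (auto simp: in_set_conv_nth)
    then show "p \<in> ?R"
    proof cases
      case 1
      then show ?thesis by (intro CollectI exI[of _ 0] exI[of _ "Suc j"]) auto
    next
      case 2
      then show ?thesis by (intro CollectI exI[of _ "Suc i"] exI[of _ "Suc j"]) auto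
    qed
  next
    fix p assume "p \<in> ?R"
    then obtain i j where ij: "i < j" "j < length (x # xs)" "p = Branch ((x # xs) ! i) ((x # xs) ! j)" by blast
    then obtain j' where "j = Suc j'" by (cases j) auto
    then show "p \<in> Branch x ` set xs \<union> set (dec (tpairs (enc_list xs)))"
      unfolding Cons.IH using ij by (cases i) auto
  qed
  finally show ?case .
qed (simp add: tpairs_def)

lemma ptime_tpairs[ptime_intros]: "ptime F \<Longrightarrow> ptime (\<lambda>x. tpairs (F x))"
  unfolding tpairs_def
proof (rule ptime_para_growth[where H = "\<lambda>x. tmap (\<lambda>y. Branch (tfst (tsnd x)) y) (tsnd (tsnd x))"])
  show "tsize (tapp (tmap (Branch (tfst (Branch a b))) (tsnd (Branch a b))) r) \<le>
    tsize r + tsize (tmap (Branch (tfst (tsnd (Branch x (Branch a b))))) (tsnd (tsnd (Branch x (Branch a b)))))" for x a b r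
    using tsize_tapp[of "tmap (Branch a) b" r] by simp
qed (auto intro!: ptime_intros)

definition tsuffixes :: "tree \<Rightarrow> tree" where
  "tsuffixes t = para (\<lambda>u r. Branch (tsnd u) r) Leaf t"

lemma dec_tsuffixes_unary: "dec (tsuffixes (enc_unary n)) = map enc_unary (rev [0..<n])"
  unfolding tsuffixes_def enc_unary_def by (induction n) auto

lemma ptime_tsuffixes[ptime_intros]: "ptime F \<Longrightarrow> ptime (\<lambda>x. tsuffixes (F x))"
  unfolding tsuffixes_def
  by (rule ptime_para_growth[where H = "\<lambda>x. x"]) (auto intro!: ptime_intros)

primrec tnlists :: "nat \<Rightarrow> tree \<Rightarrow> tree" where
  "tnlists 0 t = Branch Leaf Leaf"
| "tnlists (Suc n) t = tbind (\<lambda>ys. tmap (\<lambda>y. Branch y ys) t) (tnlists n t)"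

lemma dec_tnlists: "dec (tnlists n t) = map enc_list (List.n_lists n (dec t))"
  by (induction n) (auto simp: map_concat comp_def)

text \<open>The exponent \<open>n\<close> is fixed outside the program. Each \<open>n\<close> gets
  its own program, and its degree may depend on \<open>n\<close>; later \<open>n\<close> is
  \<open>q\<close>, a constant for fixed \<open>d\<close>.\<close>

lemma ptime_tnlists[ptime_intros]: "ptime F \<Longrightarrow> ptime (\<lambda>x. tnlists n (F x))"
proof (induction n)
  case (Suc n)
  then have "ptime (\<lambda>x. tnlists n (F x))" .
  then show ?case unfolding tnlists.simps
    by (intro ptime_intros ptime_comp[OF Suc.prems ptime_tfst0])
qed (simp add: ptime_const)

definition tlookup :: "tree \<Rightarrow> tree \<Rightarrow> tree" where
  "tlookup D d = tfst (tfst (tfilter (\<lambda>e. tsnd e = d) D))"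

lemma ptime_tlookup[ptime_intros]: "ptime D \<Longrightarrow> ptime F \<Longrightarrow> ptime (\<lambda>x. tlookup (D x) (F x))"
  unfolding tlookup_def by (intro ptime_intros ptime_comp[OF _ ptime_tfst0, of F])

section \<open>From cliques to flow interdiction\<close>

text \<open>Rado's argument: by submodularity, as long as some \<open>N a\<close> has two elements, one of them can be
  removed without violating the condition.\<close>

lemma deficiency_hall:
  fixes N :: "'e \<Rightarrow> 'v set"
  assumes "finite A" "\<And>a. a \<in> A \<Longrightarrow> finite (N a)"
    and "\<And>X. X \<subseteq> A \<Longrightarrow> m \<le> card (\<Union>(N ` X)) + card (A - X)"
  shows "\<exists>D f. D \<subseteq> A \<and> inj_on f D \<and> (\<forall>a\<in>D. f a \<in> N a) \<and> m \<le> card D"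
  using assms(2,3)
proof (induction "\<Sum>a\<in>A. card (N a)" arbitrary: N rule: less_induct)
  case less
  note fin = less.prems(1) and hall = less.prems(2)
  show ?case
  proof (cases "\<exists>a\<in>A. \<exists>x\<in>N a. \<exists>y\<in>N a. x \<noteq> y")
    \<comment> \<open>All the sets have at most one element, so one preimage for each element of the
      union gives a matching, and the condition for \<open>X = A\<close> says that the union has
      \<open>m\<close> elements.\<close>
    case False
    define U where "U = \<Union>(N ` A)"
    have "\<forall>v\<in>U. \<exists>a\<in>A. v \<in> N a" by (auto simp: U_def)
    then obtain g where g: "\<And>v. v \<in> U \<Longrightarrow> g v \<in> A \<and> v \<in> N (g v)" by metis
    define f where "f a = (SOME v. v \<in> N a)" for a
    have fg: "f (g v) = v" if "v \<in> U" for v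
    proof -
      have "v \<in> N (g v)" "g v \<in> A" using g that by auto
      then have "f (g v) \<in> N (g v)" unfolding f_def by (metis someI_ex)
      then show ?thesis using False \<open>v \<in> N (g v)\<close> \<open>g v \<in> A\<close> by blast
    qed
    have "inj_on g U" using fg by (metis inj_onI)
    then have "card (g ` U) = card U" by (rule card_image)
    moreover have "m \<le> card U" using hall[of A] by (simp add: U_def)
    moreover have "inj_on f (g ` U)" using fg by (auto intro!: inj_onI)
    ultimately show ?thesis using g fg by (intro exI[of _ "g ` U"] exI[of _ f]) auto
  next
    case True
    then obtain a x y where a: "a \<in> A" "x \<in> N a" "y \<in> N a" "x \<noteq> y" by blast
    define R where "R z = N(a := N a - {z})" for z
    have IH: ?thesis if z: "z \<in> N a" and h: "\<forall>X\<subseteq>A. m \<le> card (\<Union>(R z ` X)) + card (A - X)" for z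
    proof -
      have "(\<Sum>b\<in>A. card (R z b)) < (\<Sum>b\<in>A. card (N b))"
      proof (rule sum_strict_mono_ex1)
        show "finite A" by fact
        show "\<forall>b\<in>A. card (R z b) \<le> card (N b)" using fin by (auto simp: R_def intro!: card_mono)
        show "\<exists>b\<in>A. card (R z b) < card (N b)"
          using a(1) card_Diff1_less[OF fin[OF a(1)] z] by (intro bexI[of _ a]) (simp_all add: R_def)
      qed
      moreover have "\<And>b. b \<in> A \<Longrightarrow> finite (R z b)" using fin by (auto simp: R_def)
      ultimately obtain D f where "D \<subseteq> A" "inj_on f D" "\<forall>b\<in>D. f b \<in> R z b" "m \<le> card D"
        using less.hyps[of "R z"] h by blast
      moreover have "R z b \<subseteq> N b" for b by (auto simp: R_def)
      ultimately show ?thesis by blast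
    qed
    have viol: "\<exists>X. X \<subseteq> A \<and> a \<in> X \<and> card (\<Union>(R z ` X)) + card (A - X) < m"
      if neg: "\<not> ?thesis" and z: "z \<in> N a" for z
    proof -
      obtain X where X: "X \<subseteq> A" "card (\<Union>(R z ` X)) + card (A - X) < m"
        using IH[OF z] neg by (meson not_le)
      moreover have "a \<in> X"
      proof (rule ccontr)
        assume "a \<notin> X"
        then have "R z ` X = N ` X" by (intro image_cong) (auto simp: R_def)
        then show False using X hall[OF X(1)] by simp
      qed
      ultimately show ?thesis by blast
    qed
    show ?thesis
    proof (rule ccontr)
      assume neg: "\<not> ?thesis"
      obtain X where X: "X \<subseteq> A" "a \<in> X" "card (\<Union>(R x ` X)) + card (A - X) < m" using viol[OF neg a(2)] by blast
      obtain Y where Y: "Y \<subseteq> A" "a \<in> Y" "card (\<Union>(R y ` Y)) + card (A - Y) < m" using viol[OF neg a(3)] by blast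
      let ?P = "\<Union>(R x ` X)" and ?Q = "\<Union>(R y ` Y)"
      have finPQ: "finite ?P" "finite ?Q"
        using X(1) Y(1) fin finite_subset[OF _ \<open>finite A\<close>] by (auto simp: R_def split: if_splits)
      have "\<Union>(N ` (X \<union> Y)) \<subseteq> ?P \<union> ?Q"
        using a X(2) Y(2) unfolding R_def by (auto split: if_splits)
      then have 1: "card (\<Union>(N ` (X \<union> Y))) \<le> card (?P \<union> ?Q)" using finPQ by (intro card_mono) auto
      \<comment> \<open>The sets of \<open>a\<close> were shrunk in both families, so
        \<open>a\<close> is left out of the intersection. This costs 1 in the complement, while the
        two strict violations together are 2 short; a contradiction of 1 remains.\<close>
      have "\<Union>(N ` (X \<inter> Y - {a})) \<subseteq> ?P \<inter> ?Q"
        unfolding R_def by auto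
      then have 2: "card (\<Union>(N ` (X \<inter> Y - {a}))) \<le> card (?P \<inter> ?Q)" using finPQ by (intro card_mono) auto
      have 3: "card (?P \<union> ?Q) + card (?P \<inter> ?Q) = card ?P + card ?Q"
        using card_Un_Int[OF finPQ] by simp
      have 4: "card (A - (X \<union> Y)) + card (A - (X \<inter> Y)) = card (A - X) + card (A - Y)"
        using card_Un_Int[of "A - X" "A - Y"] \<open>finite A\<close> by (simp add: Diff_Int Diff_Un)
      have "A - (X \<inter> Y - {a}) = insert a (A - (X \<inter> Y))" using a(1) by auto
      then have 5: "card (A - (X \<inter> Y - {a})) = Suc (card (A - (X \<inter> Y)))"
        using \<open>finite A\<close> X(2) Y(2) by simp
      have 6: "m \<le> card (\<Union>(N ` (X \<union> Y))) + card (A - (X \<union> Y))"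
        using X(1) Y(1) by (intro hall) auto
      have 7: "m \<le> card (\<Union>(N ` (X \<inter> Y - {a}))) + card (A - (X \<inter> Y - {a}))"
        using X(1) by (intro hall) auto
      show False using 1 2 3 4 5 6 7 X(3) Y(3) by linarith
    qed
  qed
qed

section \<open>Weak duality of flows and cuts\<close>

lemma sum_fibres:
  assumes "finite A" "finite Y"
  shows "(\<Sum>v\<in>Y. sum f {a \<in> A. g a = v}) = sum f {a \<in> A. g a \<in> Y}"
proof -
  have "{a \<in> A. g a \<in> Y} = (\<Union>v\<in>Y. {a \<in> A. g a = v})" by auto
  then show ?thesis using assms by (simp add: sum.UNION_disjoint disjoint_iff)
qed

text \<open>Summing the conservation law over the source side cancels all inner arcs. Only this half
  of duality is used: upper bounds on the maximum come from cuts, lower bounds from explicit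
  flows.\<close>

lemma flow_value_le_cut:
  assumes fin: "finite (parcs G)" "finite (pverts G)" and f: "is_flow G u s t f"
    and X: "s \<in> X" "t \<notin> X" "X \<subseteq> pverts G"
  shows "flow_value G s f \<le> (\<Sum>a\<in>{a \<in> parcs G. fst a \<in> X \<and> snd a \<notin> X}. real (u a))"
proof -
  have arcs: "in_arcs G v = {a \<in> parcs G. snd a = v}" "out_arcs G v = {a \<in> parcs G. fst a = v}" for v
    by (auto simp: in_arcs_def out_arcs_def)
  have finX: "finite X" using X(3) fin(2) by (rule finite_subset)
  have "(\<Sum>v\<in>X. sum f (out_arcs G v) - sum f (in_arcs G v)) = (\<Sum>v\<in>{s}. sum f (out_arcs G v) - sum f (in_arcs G v))"
    using X f finX by (intro sum.mono_neutral_right) (force simp: is_flow_def)+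
  then have "flow_value G s f = (\<Sum>v\<in>X. sum f (out_arcs G v)) - (\<Sum>v\<in>X. sum f (in_arcs G v))"
    by (simp add: flow_value_def sum_subtractf)
  also have "(\<Sum>v\<in>X. sum f (out_arcs G v)) = sum f {a \<in> parcs G. fst a \<in> X}"
    unfolding arcs by (rule sum_fibres[OF fin(1) finX])
  also have "(\<Sum>v\<in>X. sum f (in_arcs G v)) = sum f {a \<in> parcs G. snd a \<in> X}"
    unfolding arcs by (rule sum_fibres[OF fin(1) finX])
  also have "sum f {a \<in> parcs G. fst a \<in> X} =
      sum f {a \<in> parcs G. fst a \<in> X \<and> snd a \<notin> X} + sum f {a \<in> parcs G. fst a \<in> X \<and> snd a \<in> X}"
    using fin by (subst sum.union_disjoint[symmetric]) (auto intro!: sum.cong)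
  also have "sum f {a \<in> parcs G. snd a \<in> X} =
      sum f {a \<in> parcs G. fst a \<notin> X \<and> snd a \<in> X} + sum f {a \<in> parcs G. fst a \<in> X \<and> snd a \<in> X}"
    using fin by (subst sum.union_disjoint[symmetric]) (auto intro!: sum.cong)
  finally have "flow_value G s f = sum f {a \<in> parcs G. fst a \<in> X \<and> snd a \<notin> X} - sum f {a \<in> parcs G. fst a \<notin> X \<and> snd a \<in> X}"
    by simp
  also have "\<dots> \<le> sum f {a \<in> parcs G. fst a \<in> X \<and> snd a \<notin> X}"
    using f by (auto simp: is_flow_def intro!: sum_nonneg)
  also have "\<dots> \<le> (\<Sum>a\<in>{a \<in> parcs G. fst a \<in> X \<and> snd a \<notin> X}. real (u a))"
    using f by (intro sum_mono) (auto simp: is_flow_def)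
  finally show ?thesis .
qed

lemma max_flow_value_le:
  assumes "finite (parcs G)" "finite (pverts G)" "s \<in> X" "t \<notin> X" "X \<subseteq> pverts G"
  shows "max_flow_value G u s t \<le> (\<Sum>a\<in>{a \<in> parcs G. fst a \<in> X \<and> snd a \<notin> X}. real (u a))"
  unfolding max_flow_value_def
proof (rule cSUP_least)
  have "is_flow G u s t (\<lambda>_. 0)" by (simp add: is_flow_def)
  then show "{f. is_flow G u s t f} \<noteq> {}" by blast
next
  fix f assume "f \<in> {f. is_flow G u s t f}"
  then show "flow_value G s f \<le> (\<Sum>a\<in>{a \<in> parcs G. fst a \<in> X \<and> snd a \<notin> X}. real (u a))"
    using flow_value_le_cut[OF assms(1,2) _ assms(3-)] by simp
qed

lemma flow_value_le_max:
  assumes "finite (parcs G)" "finite (pverts G)" "s \<in> pverts G" "s \<noteq> t" "is_flow G u s t f"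
  shows "flow_value G s f \<le> max_flow_value G u s t"
  unfolding max_flow_value_def
proof (rule cSUP_upper)
  \<comment> \<open>The trivial cut around the source bounds all flow values; without a bound the
    real supremum would carry no information.\<close>
  show "bdd_above (flow_value G s ` {f. is_flow G u s t f})"
    using flow_value_le_cut[OF assms(1,2), of u s t _ "{s}"] assms(3,4)
    by (intro bdd_aboveI2[where M = "\<Sum>a\<in>{a \<in> parcs G. fst a \<in> {s} \<and> snd a \<notin> {s}}. real (u a)"]) auto
  show "f \<in> {f. is_flow G u s t f}" using assms(5) by simp
qed

text \<open>The paths through the nodes \<open>Dum d\<close> carry one unit each whatever is deleted; they keep the
  threshold \<open>|E| + K\<close> positive.\<close>

datatype ('a, 'b) node = Src | Snk | Item "'a \<times> 'a" | Pt 'a | Pt' 'a | Dum 'b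

section \<open>The gadget for cliques\<close>

locale interdiction_gadget =
  fixes V :: "'a set" and E :: "('a \<times> 'a) set" and B :: "'b set" and K :: nat
    and \<nu> :: "('a, 'b) node \<Rightarrow> nat" and nodes :: "('a, 'b) node set" and arcs :: "(('a, 'b) node \<times> ('a, 'b) node) set"
    and G :: "nat pair_pre_digraph" and c :: "nat \<times> nat \<Rightarrow> nat" and u :: "nat \<times> nat \<Rightarrow> nat"
  assumes fin: "finite V" "finite B" and E: "E \<subseteq> V \<times> V" and B: "card B = K * K" and K: "K \<ge> 2"
    and nodes: "nodes = {Src, Snk} \<union> Item ` E \<union> Pt ` V \<union> Pt' ` V \<union> Dum ` B"
    and arcs: "arcs = (\<lambda>e. (Src, Item e)) ` E \<union> (\<lambda>e. (Item e, Snk)) ` E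
      \<union> (\<lambda>e. (Item e, Pt (fst e))) ` E \<union> (\<lambda>e. (Item e, Pt (snd e))) ` E
      \<union> (\<lambda>v. (Pt v, Pt' v)) ` V \<union> (\<lambda>v. (Pt' v, Snk)) ` V
      \<union> (\<lambda>d. (Src, Dum d)) ` B \<union> (\<lambda>d. (Dum d, Snk)) ` B"
    and inj: "inj_on \<nu> nodes"
    and G: "pverts G = \<nu> ` nodes" "parcs G = map_prod \<nu> \<nu> ` arcs"
    and u: "\<And>a. a \<in> parcs G \<Longrightarrow> u a = 1"
    and c: "\<And>x y. (x, y) \<in> arcs \<Longrightarrow> c (\<nu> x, \<nu> y) = (if y = Snk \<and> x \<in> range Item then 1 else K * K + 1)"
begin

lemma finE: "finite E" using E fin by (meson finite_SigmaI finite_subset)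

lemma fin_nodes: "finite nodes" unfolding nodes using fin finE by simp

lemma fin_arcs: "finite arcs" unfolding arcs using fin finE by simp

lemma arcs_nodes: "arcs \<subseteq> nodes \<times> nodes"
proof -
  have "fst e \<in> V" "snd e \<in> V" if "e \<in> E" for e using E that by auto
  then show ?thesis unfolding arcs nodes by (intro Un_least image_subsetI) simp_all
qed

lemma inj_iff: "x \<in> nodes \<Longrightarrow> y \<in> nodes \<Longrightarrow> \<nu> x = \<nu> y \<longleftrightarrow> x = y"
  using inj by (auto dest: inj_onD)

lemma inj_prod: "inj_on (map_prod \<nu> \<nu>) (nodes \<times> nodes)"
  using inj by (auto simp: inj_on_def)

lemma Src_Snk: "Src \<in> nodes" "Snk \<in> nodes" "\<nu> Src \<noteq> \<nu> Snk"
  using inj_iff[of Src Snk] by (auto simp: nodes)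

lemma valid: "pair_fin_digraph G"
proof
  show "finite (pverts G)" "finite (parcs G)" unfolding G using fin_nodes fin_arcs by auto
  show "\<And>e. e \<in> parcs G \<Longrightarrow> fst e \<in> pverts G" "\<And>e. e \<in> parcs G \<Longrightarrow> snd e \<in> pverts G"
    unfolding G using arcs_nodes by auto
qed

text \<open>The second node \<open>Pt' v\<close> on the path of a vertex is there for parity: items
  have arcs both to \<open>Snk\<close> and to \<open>Pt v\<close>, which puts these two on the same
  side, so \<open>Pt v\<close> cannot be adjacent to \<open>Snk\<close>.\<close>

lemma bipartite: "underlying_bipartite G"
proof -
  define X where "X = \<nu> ` (Item ` E \<union> Pt' ` V \<union> Dum ` B)"
  define Y where "Y = \<nu> ` ({Src, Snk} \<union> Pt ` V)"
  have "X \<union> Y = pverts G" unfolding X_def Y_def G nodes by auto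
  moreover have "X \<inter> Y = {}"
    unfolding X_def Y_def by (subst inj_on_image_Int[OF inj, symmetric]) (auto simp: nodes)
  moreover have "\<forall>(i, j)\<in>parcs G. i \<in> X \<and> j \<in> Y \<or> i \<in> Y \<and> j \<in> X"
    unfolding G arcs X_def Y_def using E by auto
  ultimately show ?thesis unfolding underlying_bipartite_def by blast
qed

definition deleted :: "('a \<times> 'a) set \<Rightarrow> (nat \<times> nat) set" where
  "deleted E1 = (\<lambda>e. (\<nu> (Item e), \<nu> Snk)) ` E1"

lemma deleted_subset: "E1 \<subseteq> E \<Longrightarrow> deleted E1 \<subseteq> parcs G"
proof
  fix a assume "E1 \<subseteq> E" "a \<in> deleted E1"
  then obtain e where "e \<in> E" "a = map_prod \<nu> \<nu> (Item e, Snk)" by (auto simp: deleted_def)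
  then show "a \<in> parcs G" unfolding G by (intro image_eqI[of _ _ "(Item e, Snk)"]) (auto simp: arcs)
qed

lemma deleted_inj: "E1 \<subseteq> E \<Longrightarrow> inj_on (\<lambda>e. (\<nu> (Item e), \<nu> Snk)) E1"
  by (intro inj_onI) (use inj_iff in \<open>auto simp: nodes subset_iff\<close>)

lemma deleted_cost: assumes "E1 \<subseteq> E" shows "sum c (deleted E1) = card E1"
proof -
  have "sum c (deleted E1) = (\<Sum>e\<in>E1. c (\<nu> (Item e), \<nu> Snk))"
    unfolding deleted_def by (subst sum.reindex[OF deleted_inj[OF assms]]) simp
  also have "\<dots> = (\<Sum>e\<in>E1. 1)" using assms c by (intro sum.cong) (auto simp: arcs)
  finally show ?thesis by simp
qed

lemma cheap_deletions:
  assumes "A' \<subseteq> parcs G" "sum c A' \<le> K * K"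
  obtains E1 where "E1 \<subseteq> E" "A' = deleted E1" "card E1 \<le> K * K"
proof -
  define E1 where "E1 = {e \<in> E. (\<nu> (Item e), \<nu> Snk) \<in> A'}"
  have "finite A'" using finite_subset[OF assms(1)] fin_arcs G by simp
  have "a \<in> deleted E1" if a: "a \<in> A'" for a
  proof -
    obtain x y where xy: "(x, y) \<in> arcs" "a = (\<nu> x, \<nu> y)" using a assms(1) G by auto
    have "c a \<le> K * K" using member_le_sum[OF a _ \<open>finite A'\<close>, of c] assms(2) by simp
    then have "y = Snk" "x \<in> range Item" using c[OF xy(1)] xy(2) by (auto split: if_splits)
    then obtain e where "x = Item e" "y = Snk" "e \<in> E" using xy(1) by (auto simp: arcs)
    then show ?thesis using a xy by (auto simp: E1_def deleted_def)
  qed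
  then have "A' = deleted E1" by (auto simp: E1_def deleted_def)
  moreover have "E1 \<subseteq> E" by (auto simp: E1_def)
  ultimately show ?thesis using that deleted_cost assms(2) by metis
qed

text \<open>Weak duality for the cut whose source side consists of the source, the items of the
  clique and their points. It is crossed by the \<open>card E - K^2\<close> other items, the
  \<open>K\<close> points and the \<open>K^2\<close> dummies.\<close>

lemma clique_imp_yes:
  assumes R: "R \<times> R \<subseteq> E" "card R = K"
  shows "max_flow_value (delete_arcs G (deleted (R \<times> R))) u (\<nu> Src) (\<nu> Snk) \<le> real (card E + K)"
proof -
  let ?H = "delete_arcs G (deleted (R \<times> R))"
  have RV: "R \<subseteq> V" using R(1) E by auto
  have finR: "finite R" using RV fin finite_subset by auto
  define X where "X = \<nu> ` ({Src} \<union> Item ` (R \<times> R) \<union> Pt ` R)"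
  have Xn: "{Src} \<union> Item ` (R \<times> R) \<union> Pt ` R \<subseteq> nodes" using R RV by (auto simp: nodes)
  have inX: "\<nu> x \<in> X \<longleftrightarrow> x \<in> {Src} \<union> Item ` (R \<times> R) \<union> Pt ` R" if "x \<in> nodes" for x
    unfolding X_def using inj_on_image_mem_iff[OF inj that Xn] .
  define C where "C = {a \<in> parcs ?H. fst a \<in> X \<and> snd a \<notin> X}"
  define C' where "C' = (\<lambda>e. (\<nu> Src, \<nu> (Item e))) ` (E - R \<times> R) \<union> (\<lambda>v. (\<nu> (Pt v), \<nu> (Pt' v))) ` R
    \<union> (\<lambda>d. (\<nu> Src, \<nu> (Dum d))) ` B"
  have "C \<subseteq> C'"
  proof
    fix a assume a: "a \<in> C"
    then obtain x y where xy: "(x, y) \<in> arcs" "a = (\<nu> x, \<nu> y)" by (auto simp: C_def delete_arcs_def G)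
    have n: "x \<in> nodes" "y \<in> nodes" using xy arcs_nodes by auto
    have nd: "(\<nu> x, \<nu> y) \<notin> deleted (R \<times> R)" and x: "x \<in> {Src} \<union> Item ` (R \<times> R) \<union> Pt ` R"
      and y: "y \<notin> {Src} \<union> Item ` (R \<times> R) \<union> Pt ` R"
      using a n inX xy by (auto simp: C_def delete_arcs_def)
    show "a \<in> C'" using xy x y nd unfolding arcs deleted_def C'_def by auto
  qed
  have finC: "finite C'" unfolding C'_def using finE finR fin by auto
  have "card C' \<le> card (E - R \<times> R) + card R + card B"
    unfolding C'_def using finE finR fin
    by (intro order_trans[OF card_Un_le] add_mono card_image_le) auto
  also have "card (E - R \<times> R) = card E - K * K"
    using R finR by (simp add: card_Diff_subset card_cartesian_product)
  also have "K * K \<le> card E"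
    using card_mono[OF finE R(1)] R(2) by (simp add: card_cartesian_product)
  then have "card E - K * K + card R + card B = card E + K" using R(2) B by simp
  finally have "card C' \<le> card E + K" .
  then have "card C \<le> card E + K" using card_mono[OF finC \<open>C \<subseteq> C'\<close>] by simp
  moreover have "(\<Sum>a\<in>C. real (u a)) = real (card C)"
    using u by (simp add: C_def delete_arcs_def)
  moreover have "max_flow_value ?H u (\<nu> Src) (\<nu> Snk) \<le> (\<Sum>a\<in>C. real (u a))"
    unfolding C_def
  proof (rule max_flow_value_le)
    show "finite (parcs ?H)" "finite (pverts ?H)" using fin_arcs fin_nodes by (auto simp: delete_arcs_def G)
    show "\<nu> Src \<in> X" "\<nu> Snk \<notin> X" using inX[OF Src_Snk(1)] inX[OF Src_Snk(2)] by auto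
    show "X \<subseteq> pverts ?H" using Xn by (auto simp: X_def delete_arcs_def G)
  qed
  ultimately show ?thesis by simp
qed

text \<open>With unit capacities the indicator function of an arc set is a flow as soon as in- and
  outdegrees agree at inner nodes. No arc enters the source, so its value is the number of arcs
  leaving it.\<close>

lemma unit_flow:
  fixes F :: "(('a, 'b) node \<times> ('a, 'b) node) set"
  assumes F: "map_prod \<nu> \<nu> ` F \<subseteq> parcs H" "F \<subseteq> arcs" and H: "parcs H \<subseteq> parcs G" "pverts H = pverts G"
    and cons: "\<And>x. x \<in> nodes - {Src, Snk} \<Longrightarrow> card {p \<in> F. snd p = x} = card {p \<in> F. fst p = x}"
  shows "real (card {p \<in> F. fst p = Src}) \<le> max_flow_value H u (\<nu> Src) (\<nu> Snk)"
proof -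
  define f where "f a = (of_bool (a \<in> map_prod \<nu> \<nu> ` F) :: real)" for a
  have FN: "F \<subseteq> nodes \<times> nodes" using F(2) arcs_nodes by auto
  have finH: "finite (parcs H)" "finite (pverts H)"
    using H fin_arcs fin_nodes finite_subset[of "parcs H" "parcs G"] by (auto simp: G)
  have sums: "sum f {a \<in> parcs H. g a = \<nu> x} = real (card {p \<in> F. g' p = x})"
    if "x \<in> nodes" "g = fst \<and> g' = fst \<or> g = snd \<and> g' = snd" for g g' x
  proof -
    have "sum f {a \<in> parcs H. g a = \<nu> x} = real (card ({a \<in> parcs H. g a = \<nu> x} \<inter> map_prod \<nu> \<nu> ` F))"
      unfolding f_def using finH by (simp add: Int_def)
    also have "{a \<in> parcs H. g a = \<nu> x} \<inter> map_prod \<nu> \<nu> ` F = map_prod \<nu> \<nu> ` {p \<in> F. g' p = x}"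
    proof (intro equalityI subsetI)
      fix a assume "a \<in> {a \<in> parcs H. g a = \<nu> x} \<inter> map_prod \<nu> \<nu> ` F"
      then obtain p where p: "p \<in> F" "a = map_prod \<nu> \<nu> p" "g a = \<nu> x" by auto
      then have "g' p \<in> nodes" "\<nu> (g' p) = \<nu> x" using that(2) FN by auto
      then show "a \<in> map_prod \<nu> \<nu> ` {p \<in> F. g' p = x}" using p inj_iff that(1) by auto
    next
      fix a assume "a \<in> map_prod \<nu> \<nu> ` {p \<in> F. g' p = x}"
      then show "a \<in> {a \<in> parcs H. g a = \<nu> x} \<inter> map_prod \<nu> \<nu> ` F" using F(1) that(2) by auto
    qed
    also have "card \<dots> = card {p \<in> F. g' p = x}"
      by (rule card_image) (use FN in \<open>auto intro: inj_on_subset[OF inj_prod]\<close>)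
    finally show ?thesis .
  qed
  have arcs_at: "in_arcs H v = {a \<in> parcs H. snd a = v}" "out_arcs H v = {a \<in> parcs H. fst a = v}" for v
    by (auto simp: in_arcs_def out_arcs_def)
  have "is_flow H u (\<nu> Src) (\<nu> Snk) f"
    unfolding is_flow_def
  proof (intro conjI ballI)
    fix a assume "a \<in> parcs H"
    then have "u a = 1" using H(1) by (intro u) auto
    then show "0 \<le> f a" "f a \<le> real (u a)" by (auto simp: f_def)
  next
    fix v assume v: "v \<in> pverts H - {\<nu> Src, \<nu> Snk}"
    then obtain x where "x \<in> nodes - {Src, Snk}" "v = \<nu> x" using H(2) by (auto simp: G)
    then show "sum f (in_arcs H v) = sum f (out_arcs H v)"
      unfolding arcs_at using cons by (simp add: sums[of x snd snd] sums[of x fst fst])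
  qed
  then have "flow_value H (\<nu> Src) f \<le> max_flow_value H u (\<nu> Src) (\<nu> Snk)"
    using Src_Snk H(2) by (intro flow_value_le_max finH) (auto simp: G)
  moreover have no_in: "{p \<in> F. snd p = Src} = {}" using F(2) by (auto simp: arcs)
  have "flow_value H (\<nu> Src) f = real (card {p \<in> F. fst p = Src})"
    unfolding flow_value_def arcs_at sums[OF Src_Snk(1), of snd snd, simplified]
      sums[OF Src_Snk(1), of fst fst, simplified] no_in by simp
  ultimately show ?thesis by simp
qed

text \<open>Items whose arc to the sink is intact use it; the matched ones pass through the endpoint
  chosen by \<open>h\<close>, and injectivity keeps each vertex path to one unit. The dummies
  contribute \<open>K * K\<close>.\<close>

lemma matching_flow:
  assumes E1: "E1 \<subseteq> E" and D: "D \<subseteq> E1" "inj_on h D" "\<forall>e\<in>D. h e \<in> {fst e, snd e}"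
  shows "real (card (E - E1) + card D + K * K)
    \<le> max_flow_value (delete_arcs G (deleted E1)) u (\<nu> Src) (\<nu> Snk)"
proof -
  define F where "F = (\<lambda>e. (Src, Item e)) ` (E - E1 \<union> D) \<union> (\<lambda>e. (Item e, Snk)) ` (E - E1)
    \<union> (\<lambda>e. (Item e, Pt (h e))) ` D \<union> (\<lambda>v. (Pt v, Pt' v)) ` h ` D \<union> (\<lambda>v. (Pt' v, Snk)) ` h ` D
    \<union> (\<lambda>d. (Src, Dum d)) ` B \<union> (\<lambda>d. (Dum d, Snk)) ` B"
  have hV: "h ` D \<subseteq> V" using D E E1 by fastforce
  have item_h: "(\<lambda>e. (Item e, Pt (h e))) ` D \<subseteq> arcs"
  proof
    fix a :: "('a, 'b) node \<times> ('a, 'b) node" assume "a \<in> (\<lambda>e. (Item e, Pt (h e))) ` D"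
    then obtain e where e: "e \<in> D" "a = (Item e, Pt (h e))" by blast
    then have "h e = fst e \<or> h e = snd e" "e \<in> E" using D E1 by auto
    then show "a \<in> arcs" using e unfolding arcs by auto
  qed
  moreover have "(\<lambda>v. (Pt v, Pt' v)) ` h ` D \<subseteq> arcs" "(\<lambda>v. (Pt' v, Snk)) ` h ` D \<subseteq> arcs"
    using hV unfolding arcs by blast+
  moreover have "(\<lambda>e. (Src, Item e)) ` (E - E1 \<union> D) \<subseteq> arcs" "(\<lambda>e. (Item e, Snk)) ` (E - E1) \<subseteq> arcs"
    using D(1) E1 unfolding arcs by blast+
  moreover have "(\<lambda>d. (Src, Dum d)) ` B \<subseteq> arcs" "(\<lambda>d. (Dum d, Snk)) ` B \<subseteq> arcs" unfolding arcs by blast+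
  ultimately have F_arcs: "F \<subseteq> arcs" unfolding F_def by (intro Un_least)
  have not_del: "p \<notin> (\<lambda>e. (Item e, Snk)) ` E1" if "p \<in> F" for p using that unfolding F_def by auto
  have "real (card {p \<in> F. fst p = Src}) \<le> max_flow_value (delete_arcs G (deleted E1)) u (\<nu> Src) (\<nu> Snk)"
  proof (rule unit_flow)
    show "map_prod \<nu> \<nu> ` F \<subseteq> parcs (delete_arcs G (deleted E1))"
    proof
      fix a assume "a \<in> map_prod \<nu> \<nu> ` F"
      then obtain x y where xy: "(x, y) \<in> F" "a = (\<nu> x, \<nu> y)" by auto
      then have n: "x \<in> nodes" "y \<in> nodes" using F_arcs arcs_nodes by auto
      have "a \<notin> deleted E1"
      proof
        assume "a \<in> deleted E1"
        then obtain e where e: "e \<in> E1" "\<nu> x = \<nu> (Item e)" "\<nu> y = \<nu> Snk" using xy by (auto simp: deleted_def)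
        moreover have "Item e \<in> nodes" using e E1 by (auto simp: nodes)
        ultimately have "x = Item e" "y = Snk" using inj_iff n Src_Snk by auto
        then show False using not_del[OF xy(1)] e(1) by auto
      qed
      then show "a \<in> parcs (delete_arcs G (deleted E1))" using xy F_arcs by (auto simp: delete_arcs_def G)
    qed
    show "F \<subseteq> arcs" by fact
    show "parcs (delete_arcs G (deleted E1)) \<subseteq> parcs G" "pverts (delete_arcs G (deleted E1)) = pverts G"
      by (auto simp: delete_arcs_def)
    fix x assume x: "x \<in> nodes - {Src, Snk}"
    then consider e where "e \<in> E" "x = Item e" | v where "v \<in> V" "x = Pt v"
      | v where "v \<in> V" "x = Pt' v" | d where "d \<in> B" "x = Dum d" by (auto simp: nodes)
    then show "card {p \<in> F. snd p = x} = card {p \<in> F. fst p = x}"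
    proof cases
      case (1 e)
      have "{p \<in> F. snd p = x} = (if e \<in> E - E1 \<union> D then {(Src, Item e)} else {})"
        unfolding F_def 1 by auto
      moreover have "{p \<in> F. fst p = x} = (if e \<in> E - E1 then {(Item e, Snk)} else if e \<in> D then {(Item e, Pt (h e))} else {})"
        unfolding F_def 1 using D(1) by auto
      ultimately show ?thesis by auto
    next
      case (2 v)
      have "card {p \<in> F. snd p = x} = (if v \<in> h ` D then 1 else 0)"
      proof (cases "v \<in> h ` D")
        case True
        then obtain e where e: "e \<in> D" "v = h e" by auto
        then have "{p \<in> F. snd p = x} = {(Item e, Pt v)}"
          unfolding F_def 2 using D(2) by (auto dest: inj_onD)
        then show ?thesis using True by simp
      next
        case False
        then have "{p \<in> F. snd p = x} = {}" unfolding F_def 2 by auto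
        then show ?thesis using False by (simp del: Collect_empty_eq)
      qed
      moreover have "{p \<in> F. fst p = x} = (if v \<in> h ` D then {(Pt v, Pt' v)} else {})"
        unfolding F_def 2 by auto
      ultimately show ?thesis by simp
    next
      case (3 v)
      have "{p \<in> F. snd p = x} = (if v \<in> h ` D then {(Pt v, Pt' v)} else {})"
        unfolding F_def 3 by auto
      moreover have "{p \<in> F. fst p = x} = (if v \<in> h ` D then {(Pt' v, Snk)} else {})"
        unfolding F_def 3 by auto
      ultimately show ?thesis by simp
    next
      case (4 d)
      have "{p \<in> F. snd p = x} = {(Src, Dum d)}" "{p \<in> F. fst p = x} = {(Dum d, Snk)}"
        unfolding F_def 4 using 4 by auto
      then show ?thesis by simp
    qed
  qed
  moreover have "card {p \<in> F. fst p = Src} = card (E - E1) + card D + K * K"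
  proof -
    have fD: "finite D" "finite (E - E1)" using D E1 finE by (auto intro: finite_subset)
    have "{p \<in> F. fst p = Src} = (\<lambda>x. (Src, x)) ` (Item ` (E - E1 \<union> D) \<union> Dum ` B)"
      unfolding F_def by auto
    also have "card \<dots> = card (Item ` (E - E1 \<union> D) \<union> Dum ` B :: ('a, 'b) node set)"
      by (rule card_image) (auto intro: inj_onI)
    also have "\<dots> = card (Item ` (E - E1 \<union> D) :: ('a, 'b) node set) + card (Dum ` B :: ('a, 'b) node set)"
      using fD fin by (intro card_Un_disjoint) auto
    also have "card (Item ` (E - E1 \<union> D) :: ('a, 'b) node set) = card (E - E1 \<union> D)"
      by (rule card_image) (auto intro: inj_onI)
    also have "\<dots> = card (E - E1) + card D" using fD D(1) by (intro card_Un_disjoint) auto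
    also have "card (Dum ` B :: ('a, 'b) node set) = K * K"
      unfolding B[symmetric] by (rule card_image) (auto intro: inj_onI)
    finally show ?thesis .
  qed
  ultimately show ?thesis by simp
qed

lemma yes_imp_clique:
  assumes E1: "E1 \<subseteq> E" "card E1 \<le> K * K"
    and le: "max_flow_value (delete_arcs G (deleted E1)) u (\<nu> Src) (\<nu> Snk) \<le> real (card E + K)"
  shows "\<exists>R. R \<times> R \<subseteq> E \<and> card R = K"
proof -
  define N where "N e = {fst e, snd e}" for e :: "'a \<times> 'a"
  \<comment> \<open>One more than the number of deleted items that can be matched without the flow
    exceeding the threshold \<open>card E + K\<close>.\<close>
  define m where "m = card E1 + K + 1 - K * K"
  have fE1: "finite E1" using E1 finE finite_subset by auto
  have cE: "card (E - E1) = card E - card E1" "card E1 \<le> card E"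
    using card_Diff_subset[OF fE1 E1(1)] card_mono[OF finE E1(1)] by auto
  \<comment> \<open>The empty matching already gives this bound; it makes the truncated subtraction
    in \<open>m\<close> exact.\<close>
  have big: "K * K \<le> card E1 + K"
  proof -
    have "real (card (E - E1) + K * K) \<le> real (card E + K)"
      using matching_flow[OF E1(1), of "{}"] le by simp
    then show ?thesis using cE by linarith
  qed
  have "\<exists>X\<subseteq>E1. card (\<Union>(N ` X)) + card (E1 - X) < m"
  proof (rule ccontr)
    assume "\<not> ?thesis"
    then have "\<And>X. X \<subseteq> E1 \<Longrightarrow> m \<le> card (\<Union>(N ` X)) + card (E1 - X)"
      by (auto simp: not_less)
    then obtain D h where D: "D \<subseteq> E1" "inj_on h D" "\<forall>e\<in>D. h e \<in> N e" "m \<le> card D"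
      using deficiency_hall[of E1 N m] fE1 by (auto simp: N_def)
    have "card (E - E1) + card D + K * K \<le> card E + K"
      using matching_flow[OF E1(1) D(1,2)] D(3) le unfolding N_def by linarith
    then show False using D(4) big cE unfolding m_def by linarith
  qed
  then obtain X where X: "X \<subseteq> E1" "card (\<Union>(N ` X)) + card (E1 - X) < m" by blast
  define R where "R = \<Union>(N ` X)"
  have fX: "finite X" using X fE1 finite_subset by auto
  have fR: "finite R" using fX by (auto simp: R_def N_def)
  have XR: "X \<subseteq> R \<times> R" by (auto simp: R_def N_def)
  have "card X \<le> card R * card R" using card_mono[OF _ XR] fR by (simp add: card_cartesian_product)
  moreover have "card (E1 - X) = card E1 - card X" "card X \<le> card E1"
    using card_Diff_subset[OF fX X(1)] card_mono[OF fE1 X(1)] by auto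
  ultimately have 1: "card R + K * K \<le> card X + K" and 2: "card X \<le> card R * card R" "card X \<le> K * K"
    using X(2) big E1(2) unfolding R_def m_def by auto
  have "card R = K"
  proof (rule ccontr)
    assume ne: "card R \<noteq> K"
    have "card R \<le> K" using 1 2(2) by linarith
    with ne obtain d where d: "K = card R + d" "d > 0" by (metis le_Suc_ex add_0_right gr0I)
    \<comment> \<open>Substituting \<open>K = card R + d\<close> into
      \<open>card R + K^2 \<le> card R^2 + K\<close>. The result forces \<open>card R = 0\<close>
      and \<open>d = 1\<close>, that is \<open>K = 1\<close>, where the empty set would do; this is
      what \<open>K \<ge> 2\<close> excludes.\<close>
    have "2 * card R * d + d * d \<le> d"
      using 1 2(1) unfolding d(1) by (simp add: algebra_simps)
    moreover have "d * 1 \<le> d * d" using d(2) by (intro mult_le_mono) auto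
    ultimately have dd: "2 * card R * d = 0" "d * d \<le> d * 1" by linarith+
    then have "card R = 0" "d \<le> 1" using d(2) by auto
    then show False using K d(1) \<open>card R = 0\<close> by linarith
  qed
  moreover have "X = R \<times> R"
    using 1 2 XR fR \<open>card R = K\<close> by (intro card_subset_eq) (auto simp: card_cartesian_product)
  ultimately show ?thesis using X(1) E1(1) by blast
qed

theorem interdiction_iff_clique:
  "(\<exists>A'\<subseteq>parcs G. sum c A' \<le> K * K \<and> max_flow_value (delete_arcs G A') u (\<nu> Src) (\<nu> Snk) \<le> real (card E + K))
   \<longleftrightarrow> (\<exists>R. R \<times> R \<subseteq> E \<and> card R = K)"
proof
  assume "\<exists>R. R \<times> R \<subseteq> E \<and> card R = K"
  then obtain R where R: "R \<times> R \<subseteq> E" "card R = K" by blast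
  then show "\<exists>A'\<subseteq>parcs G. sum c A' \<le> K * K \<and> max_flow_value (delete_arcs G A') u (\<nu> Src) (\<nu> Snk) \<le> real (card E + K)"
    using clique_imp_yes[OF R] deleted_subset deleted_cost
    by (intro exI[of _ "deleted (R \<times> R)"]) (auto simp: card_cartesian_product)
next
  assume "\<exists>A'\<subseteq>parcs G. sum c A' \<le> K * K \<and> max_flow_value (delete_arcs G A') u (\<nu> Src) (\<nu> Snk) \<le> real (card E + K)"
  then obtain A' where A': "A' \<subseteq> parcs G" "sum c A' \<le> K * K"
    "max_flow_value (delete_arcs G A') u (\<nu> Src) (\<nu> Snk) \<le> real (card E + K)" by blast
  obtain E1 where E1: "E1 \<subseteq> E" "A' = deleted E1" "card E1 \<le> K * K" by (rule cheap_deletions[OF A'(1,2)])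
  show "\<exists>R. R \<times> R \<subseteq> E \<and> card R = K"
    by (rule yes_imp_clique[OF E1(1,3)]) (use A'(3) E1(2) in simp)
qed

end

section \<open>Circuits of weft one\<close>

lemma gate_values_snoc: "gate_values S (gs @ [g]) = gate_values S gs @ [gate_value S (gate_values S gs) g]"
  by (simp add: gate_values_def)

lemma length_gate_values[simp]: "length (gate_values S gs) = length gs"
  by (induction gs rule: rev_induct) (simp_all add: gate_values_snoc gate_values_def[of S "[]"])

lemma gate_values_nth:
  "i < length gs \<Longrightarrow> gate_values S gs ! i = gate_value S (take i (gate_values S gs)) (gs ! i)"
proof (induction gs rule: rev_induct)
  case (snoc g gs)
  then show ?case by (cases "i = length gs") (auto simp: gate_values_snoc nth_append)
qed simp

lemma gate_values_rec:
  assumes "i < length gs" "\<And>j. j \<in> set (preds (gs ! i)) \<Longrightarrow> j < i"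
  shows "gate_values S gs ! i = (case gs ! i of InputG \<Rightarrow> i \<in> S | NotG j \<Rightarrow> \<not> gate_values S gs ! j
    | AndG js \<Rightarrow> \<forall>j\<in>set js. gate_values S gs ! j | OrG js \<Rightarrow> \<exists>j\<in>set js. gate_values S gs ! j)"
  unfolding gate_values_nth[OF assms(1)] using assms by (cases "gs ! i") auto

text \<open>\<open>u\<close> says that the value \<open>v\<close> demands \<open>v\<close> at all
  predecessors, as for a true AND or a false OR; otherwise one predecessor suffices. That second
  case is expanded for any fan-in, since it merely adds up numbers of terms, whereas a conjunction
  multiplies them.\<close>

definition expand ::
  "(nat \<Rightarrow> bool \<Rightarrow> (nat \<times> bool) list list) \<Rightarrow> bool \<Rightarrow> bool \<Rightarrow> nat list \<Rightarrow> (nat \<times> bool) list list" where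
  "expand f v u js = (if u then
     if length js = 2 then [c1 @ c2. c1 \<leftarrow> f (js ! 0) v, c2 \<leftarrow> f (js ! 1) v] else [map (\<lambda>j. (j, v)) js]
   else concat (map (\<lambda>j. f j v) js))"

text \<open>\<open>certs gs m i v\<close> is a disjunctive normal form for ``gate \<open>i\<close> has value \<open>v\<close>'', whose literals
  \<open>(j, w)\<close> state that gate \<open>j\<close> has value \<open>w\<close>. Conjunctions over more than two predecessors are not
  expanded, which keeps its size polynomial; \<open>m\<close> bounds the depth.\<close>

primrec certs :: "gate list \<Rightarrow> nat \<Rightarrow> nat \<Rightarrow> bool \<Rightarrow> (nat \<times> bool) list list" where
  "certs gs 0 i v = []"
| "certs gs (Suc m) i v = (case gs ! i of InputG \<Rightarrow> [[(i, v)]] | NotG j \<Rightarrow> certs gs m j (\<not> v)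
    | AndG js \<Rightarrow> expand (certs gs m) v v js | OrG js \<Rightarrow> expand (certs gs m) v (\<not> v) js)"

section \<open>Paths, depth and weft of single gates\<close>

locale circuit =
  fixes gs :: "gate list"
  assumes indeg: "i < length gs \<Longrightarrow> indegree_ok (gs ! i)"
    and preds_less: "i < length gs \<Longrightarrow> j \<in> set (preds (gs ! i)) \<Longrightarrow> j < i"
begin

abbreviation "path i vs \<equiv> io_path (gs, i) vs"

lemma path_snoc:
  assumes "path j vs" "i < length gs" "j \<in> set (preds (gs ! i))"
  shows "path i (vs @ [i])"
proof -
  have *: "vs \<noteq> []" "last vs = j" using assms(1) by auto
  have "(vs @ [i]) ! m \<in> set (preds (gs ! ((vs @ [i]) ! Suc m)))" if "Suc m < length (vs @ [i])" for m
  proof (cases "Suc m = length vs")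
    case True
    then have "vs ! m = j" using * by (metis diff_Suc_1 last_conv_nth)
    then show ?thesis using True assms(3) by (simp add: nth_append)
  next
    case False
    then have "Suc m < length vs" using that by simp
    then show ?thesis using assms(1) by (simp add: nth_append)
  qed
  then show ?thesis using assms by auto
qed

text \<open>A gate without predecessors is an input because AND and OR gates have at least two, so
  descending always ends in an input. Depth and weft speak of paths from inputs only and thereby
  constrain every gate.\<close>

lemma path_exists: "i < length gs \<Longrightarrow> \<exists>vs. path i vs"
proof (induction i rule: less_induct)
  case (less i)
  show ?case
  proof (cases "preds (gs ! i)")
    case Nil
    then have "gs ! i = InputG" using indeg[OF less.prems] by (cases "gs ! i") auto
    then have "path i [i]" using less.prems by simp
    then show ?thesis by blast
  next
    case (Cons j js)
    then have "j < i" using preds_less[OF less.prems] by simp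
    then obtain vs where "path j vs" using less by (meson order.strict_trans)
    then have "path i (vs @ [i])" by (rule path_snoc[OF _ less.prems]) (simp add: Cons)
    then show ?thesis by blast
  qed
qed

lemma path_input:
  assumes "path i vs" "gs ! i = InputG"
  shows "vs = [i]"
proof -
  have vs: "vs \<noteq> []" "last vs = i" using assms by auto
  have "length vs = 1"
  proof (rule ccontr)
    assume "length vs \<noteq> 1"
    moreover have "length vs \<noteq> 0" using vs by simp
    ultimately have l: "Suc (length vs - 2) < length vs" by linarith
    then have "vs ! (length vs - 2) \<in> set (preds (gs ! (vs ! Suc (length vs - 2))))" using assms(1) by simp
    moreover have "Suc (length vs - 2) = length vs - 1" using l by linarith
    then have "vs ! Suc (length vs - 2) = i" using vs by (simp add: last_conv_nth)
    ultimately show False using assms(2) by simp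
  qed
  then show ?thesis using vs by (cases vs) auto
qed

declare io_path.simps [simp del]

text \<open>Depth and weft are conditions on paths to the output. \<open>deep\<close> and
  \<open>larges\<close> state them for paths to any gate, so that an induction can descend. Nodes
  are counted here and not edges, hence the \<open>Suc d\<close> for depth \<open>d\<close>.\<close>

definition deep :: "nat \<Rightarrow> nat \<Rightarrow> bool" where
  "deep m i \<longleftrightarrow> (\<forall>vs. path i vs \<longrightarrow> length vs \<le> m)"

definition larges :: "nat \<Rightarrow> nat \<Rightarrow> bool" where
  "larges n i \<longleftrightarrow> (\<forall>vs. path i vs \<longrightarrow> length (filter (\<lambda>v. large (gs ! v)) vs) \<le> n)"

lemma depth_deep: "depth_le (gs, i) d \<Longrightarrow> deep (Suc d) i"
  unfolding deep_def
proof (intro allI impI)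
  fix vs assume "depth_le (gs, i) d" "path i vs"
  then have "length vs - 1 \<le> d" unfolding depth_le_def by blast
  then show "length vs \<le> Suc d" by linarith
qed

lemma deep_pred: "deep (Suc m) i \<Longrightarrow> i < length gs \<Longrightarrow> j \<in> set (preds (gs ! i)) \<Longrightarrow> deep m j"
  unfolding deep_def by (metis length_append_singleton not_less_eq_eq path_snoc)

lemma deep_mono: "deep m i \<Longrightarrow> m \<le> m' \<Longrightarrow> deep m' i"
  unfolding deep_def by (meson order_trans)

lemma not_deep_0: "i < length gs \<Longrightarrow> \<not> deep 0 i"
  unfolding deep_def using path_exists[of i] by (auto simp: io_path.simps)

lemma larges_pred: "larges n i \<Longrightarrow> i < length gs \<Longrightarrow> j \<in> set (preds (gs ! i)) \<Longrightarrow> larges n j"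
  unfolding larges_def
proof (intro allI impI)
  fix vs assume "\<forall>vs. path i vs \<longrightarrow> length (filter (\<lambda>v. large (gs ! v)) vs) \<le> n" "i < length gs" "j \<in> set (preds (gs ! i))" "path j vs"
  then have "length (filter (\<lambda>v. large (gs ! v)) (vs @ [i])) \<le> n" using path_snoc by blast
  then show "length (filter (\<lambda>v. large (gs ! v)) vs) \<le> n" by simp
qed

lemma larges_pred_large:
  "larges (Suc n) i \<Longrightarrow> large (gs ! i) \<Longrightarrow> i < length gs \<Longrightarrow> j \<in> set (preds (gs ! i)) \<Longrightarrow> larges n j"
  unfolding larges_def
proof (intro allI impI)
  fix vs assume "\<forall>vs. path i vs \<longrightarrow> length (filter (\<lambda>v. large (gs ! v)) vs) \<le> Suc n" "large (gs ! i)" "i < length gs" "j \<in> set (preds (gs ! i))" "path j vs"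
  then have "length (filter (\<lambda>v. large (gs ! v)) (vs @ [i])) \<le> Suc n" using path_snoc by blast
  then show "length (filter (\<lambda>v. large (gs ! v)) vs) \<le> n" using \<open>large (gs ! i)\<close> by simp
qed

lemma large_not_larges_0: "i < length gs \<Longrightarrow> large (gs ! i) \<Longrightarrow> \<not> larges 0 i"
proof -
  assume i: "i < length gs" "large (gs ! i)"
  obtain vs where vs: "path i vs" using path_exists[OF i(1)] by blast
  then have "vs \<noteq> []" "last vs = i" by (simp_all add: io_path.simps)
  then have "i \<in> set (filter (\<lambda>v. large (gs ! v)) vs)" using i(2) last_in_set by fastforce
  then have "filter (\<lambda>v. large (gs ! v)) vs \<noteq> []" by (metis list.set_cases list.discI)
  then show "\<not> larges 0 i" unfolding larges_def using vs by auto
qed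

lemma larges_input: "gs ! i = InputG \<Longrightarrow> larges 0 i"
  unfolding larges_def
proof (intro allI impI)
  fix vs assume "gs ! i = InputG" "path i vs"
  moreover from this have "vs = [i]" by (rule path_input[rotated])
  ultimately show "length (filter (\<lambda>v. large (gs ! v)) vs) \<le> 0" by (simp add: large_def)
qed

lemma pred_less_length: "i < length gs \<Longrightarrow> j \<in> set (preds (gs ! i)) \<Longrightarrow> j < length gs"
  using preds_less by (meson order.strict_trans)

section \<open>Correctness and size of the normal forms\<close>

lemma length_2_set: "length js = 2 \<Longrightarrow> set js = {js ! 0, js ! 1}"
  by (auto simp: numeral_2_eq_2 length_Suc_conv)

text \<open>At depth bound 0 \<open>certs\<close> is the empty disjunction; \<open>deep m i\<close>
  ensures that the recursion reaches the inputs before that.\<close>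

lemma certs_correct:
  assumes "deep m i" "i < length gs"
  shows "gate_values S gs ! i = v \<longleftrightarrow> (\<exists>c\<in>set (certs gs m i v). \<forall>(j, w)\<in>set c. gate_values S gs ! j = w)"
  using assms
proof (induction m arbitrary: i v)
  case 0
  then show ?case using not_deep_0 by simp
next
  case (Suc m)
  let ?val = "\<lambda>j. gate_values S gs ! j"
  let ?holds = "\<lambda>c. \<forall>(j, w)\<in>set c. ?val j = w"
  have IH: "?val j = w \<longleftrightarrow> (\<exists>c\<in>set (certs gs m j w). ?holds c)" if "j \<in> set (preds (gs ! i))" for j w
    using Suc.IH deep_pred[OF Suc.prems that] pred_less_length[OF Suc.prems(2) that] by blast
  have rec: "?val i = (case gs ! i of InputG \<Rightarrow> i \<in> S | NotG j \<Rightarrow> \<not> ?val j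
    | AndG js \<Rightarrow> \<forall>j\<in>set js. ?val j | OrG js \<Rightarrow> \<exists>j\<in>set js. ?val j)"
    by (rule gate_values_rec[OF Suc.prems(2) preds_less[OF Suc.prems(2)]])
  have pair: "(\<exists>c\<in>set [c1 @ c2. c1 \<leftarrow> certs gs m a v, c2 \<leftarrow> certs gs m b v]. ?holds c) \<longleftrightarrow> ?val a = v \<and> ?val b = v"
    if "a \<in> set (preds (gs ! i))" "b \<in> set (preds (gs ! i))" for a b
    unfolding IH[OF that(1)] IH[OF that(2)] by (simp add: ball_Un)
  have junction: "(\<exists>c\<in>set (expand (certs gs m) v u js). ?holds c) \<longleftrightarrow>
      (if u then \<forall>j\<in>set js. ?val j = v else \<exists>j\<in>set js. ?val j = v)" (is "?L \<longleftrightarrow> ?R")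
    if js: "js = preds (gs ! i)" for js u
  proof (cases u)
    case True
    show ?thesis
    proof (cases "length js = 2")
      case l: True
      have "js ! 0 \<in> set js" "js ! 1 \<in> set js" using l by auto
      then show ?thesis using True l pair[of "js ! 0" "js ! 1"] js length_2_set[OF l] by (simp add: expand_def)
    next
      case False
      then show ?thesis using True by (auto simp: expand_def)
    qed
  next
    case False
    have "?L \<longleftrightarrow> (\<exists>j\<in>set js. \<exists>c\<in>set (certs gs m j v). ?holds c)" using False by (auto simp: expand_def)
    also have "\<dots> \<longleftrightarrow> ?R" using False IH js by auto
    finally show ?thesis .
  qed
  show ?case
  proof (cases "gs ! i")
    case InputG
    then show ?thesis by simp
  next
    case (NotG j)
    then show ?thesis using IH[of j "\<not> v"] rec by auto
  next
    case (AndG js)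
    have "(\<exists>c\<in>set (certs gs (Suc m) i v). ?holds c) \<longleftrightarrow>
        (if v then \<forall>j\<in>set js. ?val j = v else \<exists>j\<in>set js. ?val j = v)"
      unfolding certs.simps AndG gate.case by (rule junction) (simp add: AndG)
    then show ?thesis using rec AndG by (cases v) (simp_all del: certs.simps)
  next
    case (OrG js)
    have "(\<exists>c\<in>set (certs gs (Suc m) i v). ?holds c) \<longleftrightarrow>
        (if \<not> v then \<forall>j\<in>set js. ?val j = v else \<exists>j\<in>set js. ?val j = v)"
      unfolding certs.simps OrG gate.case by (rule junction) (simp add: OrG)
    then show ?thesis using rec OrG by (cases v) (simp_all del: certs.simps)
  qed
qed

lemma certs_Suc_cases:
  assumes "c \<in> set (certs gs (Suc m) i v)"
  obtains "gs ! i = InputG" "c = [(i, v)]"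
  | j w where "j \<in> set (preds (gs ! i))" "c \<in> set (certs gs m j w)"
  | a b c1 c2 where "a \<in> set (preds (gs ! i))" "b \<in> set (preds (gs ! i))" "c1 \<in> set (certs gs m a v)"
      "c2 \<in> set (certs gs m b v)" "c = c1 @ c2"
  | "length (preds (gs ! i)) \<noteq> 2" "\<And>j. gs ! i \<noteq> NotG j" "c = map (\<lambda>j. (j, v)) (preds (gs ! i))" "gs ! i \<noteq> InputG"
proof -
  note cases = that
  have junction: thesis
    if c: "c \<in> set (expand (certs gs m) v u js)" and js: "preds (gs ! i) = js"
      and g: "\<And>j. gs ! i \<noteq> NotG j" "gs ! i \<noteq> InputG" for u js
  proof (cases "u \<and> length js = 2")
    case True
    then obtain c1 c2 where c12: "c1 \<in> set (certs gs m (js ! 0) v)" "c2 \<in> set (certs gs m (js ! 1) v)" "c = c1 @ c2"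
      using c by (auto simp: expand_def)
    have "js ! 0 \<in> set js" "js ! 1 \<in> set js" using True by auto
    then show ?thesis using cases(3) c12 js by blast
  next
    case False
    then show ?thesis using c js g cases(2,4) by (auto simp: expand_def split: if_splits)
  qed
  show ?thesis
  proof (cases "gs ! i")
    case InputG
    then show ?thesis using assms that(1) by simp
  next
    case (NotG j)
    then show ?thesis using assms that(2)[of j] by simp
  qed (use assms junction in auto)
qed

lemma unexpanded_large:
  assumes "length (preds (gs ! i)) \<noteq> 2" "\<And>j. gs ! i \<noteq> NotG j" "gs ! i \<noteq> InputG" "i < length gs"
  shows "large (gs ! i)"
  using assms indeg[OF assms(4)] by (cases "gs ! i") (auto simp: large_def)

text \<open>Without large gates every conjunction has exactly two predecessors, so all terms are
  expanded down to inputs, and each level at most doubles their length.\<close>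

lemma certs_small:
  assumes "larges 0 i" "i < length gs" "c \<in> set (certs gs m i v)"
  shows "length c \<le> 2 ^ m \<and> (\<forall>(j, w)\<in>set c. j < length gs \<and> gs ! j = InputG)"
  using assms
proof (induction m arbitrary: i v c)
  case (Suc m)
  note pr = larges_pred[OF Suc.prems(1,2)] pred_less_length[OF Suc.prems(2)]
  from Suc.prems(3) show ?case
  proof (cases rule: certs_Suc_cases)
    case 1
    then show ?thesis using Suc.prems(2) by simp
  next
    case (2 j w)
    then show ?thesis using Suc.IH[OF pr(1)[OF 2(1)] pr(2)[OF 2(1)] 2(2)] by simp
  next
    case (3 a b c1 c2)
    then show ?thesis using Suc.IH[OF pr(1)[OF 3(1)] pr(2)[OF 3(1)] 3(3)] Suc.IH[OF pr(1)[OF 3(2)] pr(2)[OF 3(2)] 3(4)]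
      by auto
  next
    case 4
    then show ?thesis using unexpanded_large[OF 4(1,2,4) Suc.prems(2)] large_not_larges_0 Suc.prems by blast
  qed
qed simp

text \<open>A literal stands for an input or for a predecessor of a large gate. In the latter case
  the single large gate of each path is already used up, so none remains below the literal.\<close>

lemma certs_weft_1:
  assumes "larges 1 i" "deep m i" "i < length gs" "c \<in> set (certs gs m i v)" "(j, w) \<in> set c"
  shows "j < length gs \<and> larges 0 j \<and> deep m j"
  using assms
proof (induction m arbitrary: i v c)
  case (Suc m)
  note pr = larges_pred[OF Suc.prems(1,3)] deep_pred[OF Suc.prems(2,3)] pred_less_length[OF Suc.prems(3)]
  from Suc.prems(4) show ?case
  proof (cases rule: certs_Suc_cases)
    case 1
    then show ?thesis using Suc.prems larges_input by auto
  next
    case (2 k w)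
    then show ?thesis using Suc.IH[OF pr(1)[OF 2(1)] pr(2)[OF 2(1)] pr(3)[OF 2(1)] 2(2) Suc.prems(5)] deep_mono by fastforce
  next
    case (3 a b c1 c2)
    then show ?thesis using Suc.IH[OF pr(1)[OF 3(1)] pr(2)[OF 3(1)] pr(3)[OF 3(1)] 3(3)]
        Suc.IH[OF pr(1)[OF 3(2)] pr(2)[OF 3(2)] pr(3)[OF 3(2)] 3(4)] deep_mono[of m j "Suc m"] Suc.prems(5)
      by auto
  next
    case 4
    then have "j \<in> set (preds (gs ! i))" using Suc.prems(5) by auto
    then show ?thesis using larges_pred_large[of 0 i j] unexpanded_large[OF 4(1,2,4) Suc.prems(3)] Suc.prems pr deep_mono[of m j "Suc m"] by auto
  qed
qed simp

end

text \<open>The output is true iff some term \<open>\<gamma>\<close> holds, and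
  \<open>\<gamma>\<close> holds iff none of its literals fails. The failures of its literals, put
  into disjunctive normal form again, make up one family. By weft 1 this second expansion reaches
  the inputs with short terms.\<close>

definition refutations :: "gate list \<Rightarrow> nat \<Rightarrow> nat \<Rightarrow> (nat \<times> bool) list list list" where
  "refutations gs D out = map (\<lambda>\<gamma>. concat (map (\<lambda>(i, v). certs gs D i (\<not> v)) \<gamma>)) (certs gs D out True)"

definition matches :: "nat set \<Rightarrow> (nat \<times> bool) list \<Rightarrow> bool" where
  "matches S c \<longleftrightarrow> (\<forall>(j, w)\<in>set c. (j \<in> S) = w)"

lemma
  assumes wf: "wf_circuit (gs, out)" and weft: "weft_le (gs, out) 1" and depth: "depth_le (gs, out) d"
  shows satisfies_iff_refutations:
      "satisfies S (gs, out) \<longleftrightarrow> (\<exists>\<Phi>\<in>set (refutations gs (Suc d) out). \<forall>c\<in>set \<Phi>. \<not> matches S c)"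
    and refutations_bounded:
      "\<Phi> \<in> set (refutations gs (Suc d) out) \<Longrightarrow> c \<in> set \<Phi> \<Longrightarrow>
        length c \<le> 2 ^ Suc d \<and> (\<forall>(j, w)\<in>set c. j < length gs \<and> gs ! j = InputG)"
proof -
  interpret circuit gs
    by unfold_locales (use wf in auto)
  have out: "out < length gs" using wf by simp
  have w1: "larges 1 out" using weft by (auto simp: weft_le_def larges_def)
  have dp: "deep (Suc d) out" by (rule depth_deep[OF depth])
  let ?val = "\<lambda>i. gate_values S gs ! i"
  have lit: "i < length gs \<and> larges 0 i \<and> deep (Suc d) i" if "\<gamma> \<in> set (certs gs (Suc d) out True)" "(i, v) \<in> set \<gamma>" for \<gamma> i v
    by (rule certs_weft_1[OF w1 dp out that])
  show bounded: "length c \<le> 2 ^ Suc d \<and> (\<forall>(j, w)\<in>set c. j < length gs \<and> gs ! j = InputG)"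
    if \<Phi>: "\<Phi> \<in> set (refutations gs (Suc d) out)" and c: "c \<in> set \<Phi>" for \<Phi> c
  proof -
    obtain \<gamma> i v where g: "\<gamma> \<in> set (certs gs (Suc d) out True)" "(i, v) \<in> set \<gamma>" "c \<in> set (certs gs (Suc d) i (\<not> v))"
      using \<Phi> c unfolding refutations_def by (auto simp del: certs.simps)
    show ?thesis using certs_small[OF _ _ g(3)] lit[OF g(1,2)] by blast
  qed
  have m: "matches S c \<longleftrightarrow> (\<forall>(j, w)\<in>set c. ?val j = w)"
    if "\<forall>(j, w)\<in>set c. j < length gs \<and> gs ! j = InputG" for c
  proof -
    have "?val j = (j \<in> S)" if "j < length gs" "gs ! j = InputG" for j
      using gate_values_rec[OF that(1) preds_less[OF that(1)]] that(2) by simp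
    then show ?thesis using that unfolding matches_def by blast
  qed
  have "satisfies S (gs, out) \<longleftrightarrow> (\<exists>\<gamma>\<in>set (certs gs (Suc d) out True). \<forall>(i, v)\<in>set \<gamma>. ?val i = v)"
    using certs_correct[OF dp out, of S True] by (simp add: satisfies_def)
  also have "\<dots> \<longleftrightarrow> (\<exists>\<gamma>\<in>set (certs gs (Suc d) out True). \<forall>(i, v)\<in>set \<gamma>. \<forall>c\<in>set (certs gs (Suc d) i (\<not> v)). \<not> matches S c)"
  proof (intro bex_cong refl ball_cong)
    fix \<gamma> x assume g: "\<gamma> \<in> set (certs gs (Suc d) out True)" "x \<in> set \<gamma>"
    obtain i v where x: "x = (i, v)" by fastforce
    have l: "i < length gs" "larges 0 i" "deep (Suc d) i" using lit[OF g(1) g(2)[unfolded x]] by auto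
    have "?val i = v \<longleftrightarrow> \<not> ?val i = (\<not> v)" by auto
    also have "\<dots> \<longleftrightarrow> (\<forall>c\<in>set (certs gs (Suc d) i (\<not> v)). \<not> (\<forall>(j, w)\<in>set c. ?val j = w))"
      using certs_correct[OF l(3,1), of S "\<not> v"] by blast
    also have "\<dots> \<longleftrightarrow> (\<forall>c\<in>set (certs gs (Suc d) i (\<not> v)). \<not> matches S c)"
      by (intro ball_cong refl) (use m certs_small[OF l(2,1)] in blast)
    finally show "(case x of (i, v) \<Rightarrow> ?val i = v) \<longleftrightarrow> (case x of (i, v) \<Rightarrow> \<forall>c\<in>set (certs gs (Suc d) i (\<not> v)). \<not> matches S c)"
      by (simp only: x split_conv)
  qed
  also have "\<dots> \<longleftrightarrow> (\<exists>\<Phi>\<in>set (refutations gs (Suc d) out). \<forall>c\<in>set \<Phi>. \<not> matches S c)"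
    unfolding refutations_def by (simp del: certs.simps) blast
  finally show "satisfies S (gs, out) \<longleftrightarrow> (\<exists>\<Phi>\<in>set (refutations gs (Suc d) out). \<forall>c\<in>set \<Phi>. \<not> matches S c)" .
qed

section \<open>From weighted assignments to cliques\<close>

text \<open>Slot \<open>i\<close> of a view holds the gap between the \<open>i\<close>-th and the next element of the selected set,
  where \<open>a\<close> and \<open>z\<close> are sentinels. The vertex \<open>None\<close> is related to everything; it only serves to
  make the clique size at least 2.\<close>

locale gap_views =
  fixes a z :: 'x and xs :: "'x list" and k q :: nat and Fam :: "('x \<times> bool) list list set"
  assumes dist: "distinct (a # xs @ [z])" and q: "q \<ge> 1" and fin_Fam: "finite Fam"
    and lits: "\<And>\<Phi> c. \<Phi> \<in> Fam \<Longrightarrow> c \<in> set \<Phi> \<Longrightarrow> length c \<le> q \<and> fst ` set c \<subseteq> set xs"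
begin

definition U where "U = a # xs @ [z]"

definition LT where "LT = {(U ! i, U ! j) | i j. i < j \<and> j < length U}"

text \<open>Only slot \<open>0\<close> starts at \<open>a\<close> and only slot \<open>k\<close>
  ends at \<open>z\<close>, so a chain of gaps through all slots runs from \<open>a\<close> to
  \<open>z\<close> past exactly \<open>k\<close> elements.\<close>

definition entries :: "(nat \<times> 'x \<times> 'x) set" where
  "entries = {(i, lo, hi). i \<le> k \<and> (lo, hi) \<in> LT \<and> (i = 0 \<longleftrightarrow> lo = a) \<and> (i = k \<longleftrightarrow> hi = z)}"

definition known :: "(nat \<times> 'x \<times> 'x) list \<Rightarrow> 'x \<times> bool \<Rightarrow> bool" where
  "known es l \<longleftrightarrow> (if snd l then \<exists>e\<in>set es. fst l = fst (snd e) \<or> fst l = snd (snd e)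
     else \<exists>e\<in>set es. (fst (snd e), fst l) \<in> LT \<and> (fst l, snd (snd e)) \<in> LT)"

definition cons :: "nat \<times> 'x \<times> 'x \<Rightarrow> nat \<times> 'x \<times> 'x \<Rightarrow> bool" where
  "cons e e' \<longleftrightarrow> (fst e = fst e' \<longrightarrow> e = e') \<and> (fst e' = Suc (fst e) \<longrightarrow> fst (snd e') = snd (snd e))"

text \<open>Not symmetric, but a clique is tested on all of \<open>R \<times> R\<close>. Both orders
  thus occur, and so do loops: they reject a vertex whose own gaps clash or reveal a violation,
  which \<open>verts\<close> itself does not filter out.\<close>

fun Rel :: "(('x \<times> bool) list list \<times> (nat \<times> 'x \<times> 'x) list) option \<Rightarrow> (('x \<times> bool) list list \<times> (nat \<times> 'x \<times> 'x) list) option \<Rightarrow> bool" where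
  "Rel (Some (\<Phi>, es)) (Some (\<Phi>', es')) \<longleftrightarrow> \<Phi> = \<Phi>' \<and> (\<forall>e\<in>set es. \<forall>e'\<in>set es'. cons e e') \<and>
     (\<forall>c\<in>set \<Phi>. \<not> (\<forall>l\<in>set c. known es l))"
| "Rel _ _ \<longleftrightarrow> True"

definition verts where
  "verts = insert None (Some ` (Fam \<times> {es. set es \<subseteq> entries \<and> length es = q}))"

definition agrees :: "'x set \<Rightarrow> ('x \<times> bool) list \<Rightarrow> bool" where
  "agrees S c \<longleftrightarrow> (\<forall>(x, w)\<in>set c. (x \<in> S) = w)"

section \<open>The linear order of inputs and sentinels\<close>

lemma U_inj: "i < length U \<Longrightarrow> j < length U \<Longrightarrow> U ! i = U ! j \<longleftrightarrow> i = j"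
  using dist unfolding U_def[symmetric] by (simp add: nth_eq_iff_index_eq)

lemma LT_nth: "i < length U \<Longrightarrow> j < length U \<Longrightarrow> (U ! i, U ! j) \<in> LT \<longleftrightarrow> i < j"
  unfolding LT_def using U_inj by (auto dest: order.strict_trans)

lemma LT_in: "(x, y) \<in> LT \<Longrightarrow> x \<in> set U \<and> y \<in> set U"
  unfolding LT_def by (auto intro!: nth_mem)

lemma LT_irrefl: "(x, x) \<notin> LT"
proof
  assume *: "(x, x) \<in> LT"
  then obtain i where "i < length U" "x = U ! i" using LT_in by (metis in_set_conv_nth)
  then show False using * LT_nth by blast
qed

lemma LT_trans: "(x, y) \<in> LT \<Longrightarrow> (y, w) \<in> LT \<Longrightarrow> (x, w) \<in> LT"
proof -
  assume *: "(x, y) \<in> LT" "(y, w) \<in> LT"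
  then obtain i j l where "i < length U" "x = U ! i" "j < length U" "y = U ! j" "l < length U" "w = U ! l"
    using LT_in by (metis in_set_conv_nth)
  then show ?thesis using * LT_nth by (metis order.strict_trans)
qed

lemma LT_total: "x \<in> set U \<Longrightarrow> y \<in> set U \<Longrightarrow> x \<noteq> y \<Longrightarrow> (x, y) \<in> LT \<or> (y, x) \<in> LT"
  by (metis LT_nth in_set_conv_nth linorder_neqE_nat)

lemma LT_a: "x \<in> set U \<Longrightarrow> x \<noteq> a \<Longrightarrow> (a, x) \<in> LT"
proof -
  assume *: "x \<in> set U" "x \<noteq> a"
  then obtain i where "i < length U" "x = U ! i" by (metis in_set_conv_nth)
  moreover have "U ! 0 = a" "length U > 0" by (auto simp: U_def)
  ultimately show ?thesis using LT_nth[of 0 i] * by (cases i) auto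
qed

lemma LT_z: "x \<in> set U \<Longrightarrow> x \<noteq> z \<Longrightarrow> (x, z) \<in> LT"
proof -
  assume *: "x \<in> set U" "x \<noteq> z"
  then obtain i where i: "i < length U" "x = U ! i" by (metis in_set_conv_nth)
  have z: "U ! (length U - 1) = z" "length U - 1 < length U" by (auto simp: U_def nth_append)
  have "i \<noteq> length U - 1" using i z * by auto
  then have "i < length U - 1" using i by linarith
  then show ?thesis using LT_nth[OF i(1) z(2)] i z by simp
qed

lemma finite_entries: "finite entries"
proof -
  have "entries \<subseteq> {..k} \<times> set U \<times> set U" using LT_in by (auto simp: entries_def)
  then show ?thesis by (rule finite_subset) simp
qed

lemma finite_verts: "finite verts"
  unfolding verts_def using fin_Fam finite_lists_length_eq[OF finite_entries] by simp

lemma selection_imp_clique: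
  assumes S: "S \<subseteq> set xs" "card S = k" and \<Phi>: "\<Phi> \<in> Fam" "\<forall>c\<in>set \<Phi>. \<not> agrees S c"
  shows "\<exists>R\<subseteq>verts. card R = Suc ((k + 1) ^ q) \<and> (\<forall>u\<in>R. \<forall>v\<in>R. Rel u v)"
proof -
  \<comment> \<open>The two sentinels turn \<open>k\<close> elements into \<open>k + 2\<close>
    marks, hence \<open>k + 1\<close> gaps.\<close>
  define l where "l = a # filter (\<lambda>x. x \<in> S) xs @ [z]"
  have lU: "l = filter (\<lambda>x. x \<in> insert a (insert z S)) U"
  proof -
    have "filter (\<lambda>x. x \<in> insert a (insert z S)) xs = filter (\<lambda>x. x \<in> S) xs"
      using dist by (intro filter_cong) auto
    then show ?thesis by (simp add: l_def U_def)
  qed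
  have dist_l: "distinct l" unfolding lU using dist by (simp add: U_def)
  have "length (filter (\<lambda>x. x \<in> S) xs) = k"
  proof -
    have "set (filter (\<lambda>x. x \<in> S) xs) = S" using S(1) by auto
    then show ?thesis using S(2) dist distinct_card[of "filter (\<lambda>x. x \<in> S) xs"] by simp
  qed
  then have len: "length l = k + 2" by (simp add: l_def)
  have sl: "set l = insert a (insert z S)" using S(1) by (auto simp: l_def)
  have "sorted_wrt (\<lambda>x y. (x, y) \<in> LT) U"
    unfolding sorted_wrt_iff_nth_less using LT_nth by auto
  then have "sorted_wrt (\<lambda>x y. (x, y) \<in> LT) l" unfolding lU by (rule sorted_wrt_filter)
  then have ord: "(l ! i, l ! j) \<in> LT" if "i < j" "j < k + 2" for i j
    using that len by (simp add: sorted_wrt_iff_nth_less)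
  have ord_iff: "(l ! i, l ! j) \<in> LT \<longleftrightarrow> i < j" if "i < k + 2" "j < k + 2" for i j
    using ord that LT_irrefl LT_trans by (metis linorder_neqE_nat)
  have l_inj: "l ! i = l ! j \<longleftrightarrow> i = j" if "i < k + 2" "j < k + 2" for i j
    using dist_l len that by (simp add: nth_eq_iff_index_eq)
  have l0: "l ! 0 = a" by (simp add: l_def)
  have lk: "l ! (k + 1) = z" using len last_conv_nth[of l] by (simp add: l_def)
  define ent where "ent i = (i, l ! i, l ! Suc i)" for i
  have ent: "ent i \<in> entries" if "i \<le> k" for i
    using that ord[of i "Suc i"] l_inj[of i 0] l_inj[of "Suc i" "k + 1"] by (auto simp: entries_def ent_def l0 lk[simplified])
  \<comment> \<open>Whatever the gaps of \<open>S\<close> reveal is true of \<open>S\<close>; a view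
    revealing all of a member of \<open>\<Phi>\<close> would make \<open>S\<close> agree with
    it.\<close>
  have kn: "(x \<in> S) = w" if kw: "known (map ent Q) (x, w)" and Qk: "set Q \<subseteq> {..k}" and xx: "x \<in> set xs" for Q x w
  proof (cases w)
    case True
    then obtain i where "i \<in> set Q" "x = l ! i \<or> x = l ! Suc i" using kw by (auto simp: known_def ent_def)
    then have "x \<in> set l" using Qk len by (auto intro!: nth_mem)
    then show ?thesis using True sl xx dist by auto
  next
    case False
    then obtain i where i: "i \<in> set Q" "(l ! i, x) \<in> LT" "(x, l ! Suc i) \<in> LT" using kw by (auto simp: known_def ent_def)
    have "x \<notin> S"
    proof
      assume "x \<in> S"
      then obtain j where j: "j < k + 2" "x = l ! j" using sl len by (metis in_set_conv_nth insertCI)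
      have "i \<le> k" using i Qk by auto
      then show False using i j ord_iff[of i j] ord_iff[of j "Suc i"] by simp
    qed
    then show ?thesis using False by simp
  qed
  define Qs where "Qs = {Q. set Q \<subseteq> {..k} \<and> length Q = q}"
  \<comment> \<open>One view for each list of \<open>q\<close> slots, all cut out of the same
    \<open>S\<close> and hence consistent. Distinct lists give distinct views because an entry
    carries its slot.\<close>
  define R where "R = insert None ((\<lambda>Q. Some (\<Phi>, map ent Q)) ` Qs)"
  have finQ: "finite Qs" unfolding Qs_def by (rule finite_lists_length_eq) simp
  have "inj_on (\<lambda>Q. Some (\<Phi>, map ent Q)) Qs"
  proof (rule inj_onI)
    fix Q Q' assume "Some (\<Phi>, map ent Q) = Some (\<Phi>, map ent Q')"
    then have "map fst (map ent Q) = map fst (map ent Q')" by simp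
    then show "Q = Q'" by (simp add: ent_def comp_def)
  qed
  then have "card R = Suc (card Qs)" unfolding R_def using finQ by (subst card_insert_disjoint) (auto simp: card_image)
  also have "card Qs = (k + 1) ^ q" unfolding Qs_def by (subst card_lists_length_eq) auto
  finally have "card R = Suc ((k + 1) ^ q)" .
  moreover have "R \<subseteq> verts"
  proof -
    have "set (map ent Q) \<subseteq> entries \<and> length (map ent Q) = q" if "Q \<in> Qs" for Q
      using that ent by (auto simp: Qs_def)
    then show ?thesis unfolding R_def verts_def using \<Phi>(1) by blast
  qed
  moreover have "Rel u v" if uv: "u \<in> R" "v \<in> R" for u v
  proof (cases "u = None \<or> v = None")
    case True
    then show ?thesis by (cases u; cases v) auto
  next
    case False
    then obtain Q Q' where Q: "Q \<in> Qs" "Q' \<in> Qs" "u = Some (\<Phi>, map ent Q)" "v = Some (\<Phi>, map ent Q')"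
      using uv by (auto simp: R_def)
    have "\<not> (\<forall>x\<in>set c. known (map ent Q) x)" if c: "c \<in> set \<Phi>" for c
    proof
      assume *: "\<forall>x\<in>set c. known (map ent Q) x"
      have "agrees S c"
        unfolding agrees_def
      proof (clarify)
        fix x w assume xw: "(x, w) \<in> set c"
        then have "x \<in> set xs" using lits[OF \<Phi>(1) c] by auto
        then show "(x \<in> S) = w" using kn[of Q x w] * xw Q(1) by (auto simp: Qs_def)
      qed
      then show False using \<Phi>(2) c by simp
    qed
    moreover have "cons (ent i) (ent j)" for i j by (auto simp: cons_def ent_def)
    ultimately show ?thesis unfolding Q by simp
  qed
  ultimately show ?thesis by blast
qed

text \<open>Pigeonhole: colour a vertex by its list of slots. Related vertices of equal colour
  coincide, and there are only \<open>(k+1)^q\<close> colours, so every colour occurs in the clique.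
  Consistency makes the gap of each slot unique, and the gaps chain up to a set
  \<open>S\<close>.\<close>

lemma clique_imp_selection:
  assumes R: "R \<subseteq> verts" "card R = Suc ((k + 1) ^ q)" and rel: "\<And>u v. u \<in> R \<Longrightarrow> v \<in> R \<Longrightarrow> Rel u v"
  shows "\<exists>S\<subseteq>set xs. card S = k \<and> (\<exists>\<Phi>\<in>Fam. \<forall>c\<in>set \<Phi>. \<not> agrees S c)"
proof -
  define R' where "R' = {p. Some p \<in> R}"
  define Qs where "Qs = {Q :: nat list. set Q \<subseteq> {..k} \<and> length Q = q}"
  have finR: "finite R" using R(1) finite_verts by (rule finite_subset)
  have Rsub: "R \<subseteq> insert None (Some ` R')"
  proof
    fix u assume "u \<in> R"
    then show "u \<in> insert None (Some ` R')" by (cases u) (auto simp: R'_def)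
  qed
  have sR: "Some ` R' \<subseteq> R" by (auto simp: R'_def)
  have finR': "finite R'" by (rule finite_imageD[OF finite_subset[OF sR finR]]) simp
  have "card R \<le> card (insert None (Some ` R'))" by (rule card_mono) (use finR' Rsub in auto)
  also have "\<dots> = Suc (card R')" using finR' by (subst card_insert_disjoint) (auto simp: card_image)
  finally have cR': "(k + 1) ^ q \<le> card R'" using R(2) by simp
  have mem: "p \<in> R' \<Longrightarrow> fst p \<in> Fam \<and> set (snd p) \<subseteq> entries \<and> length (snd p) = q" for p
  proof -
    assume "p \<in> R'"
    then have "Some p \<in> verts" using R(1) unfolding R'_def by blast
    then show ?thesis unfolding verts_def by auto
  qed
  have r: "fst p = fst p' \<and> (\<forall>e\<in>set (snd p). \<forall>e'\<in>set (snd p'). cons e e') \<and> (\<forall>c\<in>set (fst p). \<not> (\<forall>l\<in>set c. known (snd p) l))"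
    if "p \<in> R'" "p' \<in> R'" for p p'
    using rel[of "Some p" "Some p'"] that unfolding R'_def by (cases p; cases p') simp
  have eq: "e = e'" if "p \<in> R'" "p' \<in> R'" "e \<in> set (snd p)" "e' \<in> set (snd p')" "fst e = fst e'" for p p' e e'
    using r[OF that(1,2)] that(3-) unfolding cons_def by blast
  define col where "col p = map fst (snd p)" for p :: "('x \<times> bool) list list \<times> (nat \<times> 'x \<times> 'x) list"
  have colQ: "col ` R' \<subseteq> Qs"
    using mem unfolding col_def Qs_def entries_def by fastforce
  have "inj_on col R'"
  proof (rule inj_onI)
    fix p p' assume p: "p \<in> R'" "p' \<in> R'" "col p = col p'"
    have len: "length (snd p) = length (snd p')" using mem p by metis
    have "snd p = snd p'"
    proof (rule nth_equalityI[OF len])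
      fix i assume i: "i < length (snd p)"
      have "fst (snd p ! i) = col p ! i" "fst (snd p' ! i) = col p' ! i" using i len by (auto simp: col_def)
      then show "snd p ! i = snd p' ! i" using eq[OF p(1,2)] i len p(3) by simp
    qed
    then show "p = p'" using r[OF p(1,2)] by (simp add: prod_eq_iff)
  qed
  then have "card (col ` R') \<ge> (k + 1) ^ q" using cR' by (simp add: card_image)
  moreover have finQ: "finite Qs" unfolding Qs_def by (rule finite_lists_length_eq) simp
  moreover have "card Qs = (k + 1) ^ q" unfolding Qs_def by (subst card_lists_length_eq) auto
  ultimately have "col ` R' = Qs" using card_seteq[OF finQ colQ] by simp
  then have surj: "\<exists>p\<in>R'. col p = Q" if "Q \<in> Qs" for Q using that by (metis imageE)
  \<comment> \<open>The constant colours show that each slot occurs in some view;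
    \<open>q \<ge> 1\<close> is essential here.\<close>
  have rq: "replicate q i \<in> Qs" if "i \<le> k" for i using that by (auto simp: Qs_def)
  have "\<exists>p\<in>R'. \<exists>e\<in>set (snd p). fst e = i" if i: "i \<le> k" for i
  proof -
    obtain p where p: "p \<in> R'" "col p = replicate q i" using surj[OF rq[OF i]] by blast
    then have "i \<in> fst ` set (snd p)" using q unfolding col_def by (metis list.set_map in_set_replicate not_one_le_zero)
    then show ?thesis using p by auto
  qed
  then obtain ent where ent0: "\<And>i. i \<le> k \<Longrightarrow> \<exists>p\<in>R'. ent i \<in> set (snd p) \<and> fst (ent i) = i" by metis
  define lo hi where "lo i = fst (snd (ent i))" and "hi i = snd (snd (ent i))" for i
  have ent: "ent i = (i, lo i, hi i)" if "i \<le> k" for i using ent0[OF that] unfolding lo_def hi_def by (metis prod.collapse)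
  have ent_in: "ent i \<in> entries" if "i \<le> k" for i using ent0[OF that] mem by blast
  have uniq: "e = ent (fst e)" if "p \<in> R'" "e \<in> set (snd p)" for p e
  proof -
    have "fst e \<le> k" using mem[OF that(1)] that(2) unfolding entries_def by auto
    then obtain p' where "p' \<in> R'" "ent (fst e) \<in> set (snd p')" "fst (ent (fst e)) = fst e" using ent0 by blast
    then show ?thesis using eq[OF that(1) _ that(2)] by metis
  qed
  have step: "lo (Suc i) = hi i" if i: "Suc i \<le> k" for i
  proof -
    obtain p p' where "p \<in> R'" "ent i \<in> set (snd p)" "p' \<in> R'" "ent (Suc i) \<in> set (snd p')"
      using ent0[of i] ent0[of "Suc i"] i by (meson Suc_leD)
    then have "cons (ent i) (ent (Suc i))" using r by blast
    then show ?thesis using ent[of i] ent[of "Suc i"] i by (simp add: cons_def)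
  qed
  have e: "(lo i, hi i) \<in> LT" "i = 0 \<longleftrightarrow> lo i = a" "i = k \<longleftrightarrow> hi i = z" if "i \<le> k" for i
    using ent_in[OF that] unfolding ent[OF that] entries_def by auto
  have mono: "(lo i, lo j) \<in> LT" if "i < j" "j \<le> k" for i j
    using that
  proof (induction j)
    case (Suc j)
    have j: "(lo j, lo (Suc j)) \<in> LT" using e(1)[of j] step[of j] Suc.prems by simp
    show ?case
    proof (cases "i = j")
      case True
      then show ?thesis using j by simp
    next
      case False
      then show ?thesis using Suc j LT_trans by (metis Suc_leD less_Suc_eq)
    qed
  qed simp
  \<comment> \<open>Slot \<open>0\<close> is left out because its lower end is the sentinel
    \<open>a\<close>.\<close>
  define S where "S = lo ` {1..k}"
  have "inj_on lo {1..k}"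
    using mono LT_irrefl by (intro inj_onI) (metis atLeastAtMost_iff linorder_neqE_nat)
  then have cS: "card S = k" by (simp add: S_def card_image)
  have SU: "S \<subseteq> set xs"
  proof
    fix x assume "x \<in> S"
    then obtain i where i: "1 \<le> i" "i \<le> k" "x = lo i" by (auto simp: S_def)
    have "x \<in> set U" "x \<noteq> a" using e[OF i(2)] i LT_in by auto
    moreover have "x \<noteq> z"
    proof
      assume "x = z"
      then have "(z, hi i) \<in> LT" using e(1)[OF i(2)] i(3) by simp
      then show False using LT_z[of "hi i"] LT_in[of z "hi i"] LT_trans LT_irrefl by metis
    qed
    ultimately show "x \<in> set xs" by (auto simp: U_def)
  qed
  have cover: "\<exists>i\<le>k. known [ent i] (x, x \<in> S)" if x: "x \<in> set xs" for x
  proof (cases "x \<in> S")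
    case True
    then obtain i where "i \<le> k" "x = lo i" by (auto simp: S_def)
    then show ?thesis using True by (intro exI[of _ i]) (auto simp: known_def lo_def)
  next
    case False
    have xU: "x \<in> set U" "x \<noteq> a" "x \<noteq> z" using x dist by (auto simp: U_def)
    \<comment> \<open>The gap around an unselected \<open>x\<close> belongs to the last slot whose
      lower end precedes \<open>x\<close>.\<close>
    define P where "P i \<longleftrightarrow> i \<le> k \<and> (lo i, x) \<in> LT" for i
    have "P 0" using e(2)[of 0] LT_a xU by (simp add: P_def)
    then have P: "P (Greatest P)" and Pmax: "\<And>j. P j \<Longrightarrow> j \<le> Greatest P"
      using GreatestI_nat[of P 0 k] Greatest_le_nat[of P _ k] by (auto simp: P_def)
    define i where "i = Greatest P"
    have i: "i \<le> k" "(lo i, x) \<in> LT" using P by (auto simp: P_def i_def)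
    have "(x, hi i) \<in> LT"
    proof (cases "i = k")
      case True
      then show ?thesis using e(3)[of i] LT_z xU by simp
    next
      case neq: False
      then have Si: "Suc i \<le> k" using i by simp
      have "\<not> P (Suc i)" using Pmax[of "Suc i"] unfolding i_def by auto
      then have "(lo (Suc i), x) \<notin> LT" using Si by (simp add: P_def)
      moreover have "lo (Suc i) \<noteq> x" using False Si by (auto simp: S_def)
      moreover have "lo (Suc i) \<in> set U" using e(1)[OF Si] LT_in by blast
      ultimately show ?thesis using LT_total xU step[OF Si] by metis
    qed
    then show ?thesis using False i ent[OF i(1)] by (intro exI[of _ i]) (auto simp: known_def)
  qed
  obtain p0 where p0: "p0 \<in> R'" using surj[OF rq[of 0]] by auto
  have "\<not> agrees S c" if c: "c \<in> set (fst p0)" for c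
  proof
    assume ag: "agrees S c"
    have lc: "length c \<le> q" "fst ` set c \<subseteq> set xs" using lits[of "fst p0" c] mem[OF p0] c by auto
    obtain \<sigma> where \<sigma>: "\<And>x. x \<in> set xs \<Longrightarrow> \<sigma> x \<le> k \<and> known [ent (\<sigma> x)] (x, x \<in> S)" using cover by metis
    \<comment> \<open>The slots that decide the literals of \<open>c\<close>, padded with slot
      \<open>0\<close> to length \<open>q\<close>. The vertex of this colour would know all of
      \<open>c\<close>, which its loop forbids.\<close>
    define Q where "Q = map (\<lambda>l. \<sigma> (fst l)) c @ replicate (q - length c) 0"
    have "Q \<in> Qs" using lc \<sigma> by (auto simp: Q_def Qs_def)
    then obtain p where p: "p \<in> R'" "col p = Q" using surj by blast
    have "known (snd p) l" if l: "l \<in> set c" for l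
    proof -
      obtain x w where xw: "l = (x, w)" by fastforce
      then have w: "w = (x \<in> S)" using ag l unfolding agrees_def by blast
      have x: "x \<in> set xs" using lc l xw by force
      have "\<sigma> x \<in> set (col p)" unfolding p Q_def using l xw by force
      then obtain e where "e \<in> set (snd p)" "fst e = \<sigma> x" by (auto simp: col_def)
      then have "ent (\<sigma> x) \<in> set (snd p)" using uniq[OF p(1)] by metis
      then show ?thesis using \<sigma>[OF x] unfolding xw w known_def by auto
    qed
    then show False using r[OF p(1) p(1)] r[OF p(1) p0] c by metis
  qed
  then show ?thesis using cS SU mem[OF p0] by blast
qed

theorem selection_iff_clique:
  "(\<exists>S\<subseteq>set xs. card S = k \<and> (\<exists>\<Phi>\<in>Fam. \<forall>c\<in>set \<Phi>. \<not> agrees S c)) \<longleftrightarrow>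
   (\<exists>R\<subseteq>verts. card R = Suc ((k + 1) ^ q) \<and> (\<forall>u\<in>R. \<forall>v\<in>R. Rel u v))"
proof
  assume "\<exists>S\<subseteq>set xs. card S = k \<and> (\<exists>\<Phi>\<in>Fam. \<forall>c\<in>set \<Phi>. \<not> agrees S c)"
  then obtain S \<Phi> where "S \<subseteq> set xs" "card S = k" "\<Phi> \<in> Fam" "\<forall>c\<in>set \<Phi>. \<not> agrees S c" by blast
  then show "\<exists>R\<subseteq>verts. card R = Suc ((k + 1) ^ q) \<and> (\<forall>u\<in>R. \<forall>v\<in>R. Rel u v)"
    by (rule selection_imp_clique)
next
  assume "\<exists>R\<subseteq>verts. card R = Suc ((k + 1) ^ q) \<and> (\<forall>u\<in>R. \<forall>v\<in>R. Rel u v)"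
  then obtain R where "R \<subseteq> verts" "card R = Suc ((k + 1) ^ q)" "\<forall>u\<in>R. \<forall>v\<in>R. Rel u v" by blast
  then show "\<exists>S\<subseteq>set xs. card S = k \<and> (\<exists>\<Phi>\<in>Fam. \<forall>c\<in>set \<Phi>. \<not> agrees S c)"
    by (intro clique_imp_selection) auto
qed

end

section \<open>Computing the reduction\<close>

lemma ptime_app3:
  assumes "ptime (\<lambda>p. F (tfst p) (tfst (tsnd p)) (tsnd (tsnd p)))" "ptime A" "ptime B" "ptime C"
  shows "ptime (\<lambda>x. F (A x) (B x) (C x))"
  using ptime_comp[OF assms(1) ptime_Branch[OF assms(2) ptime_Branch[OF assms(3,4)]]] by simp

text \<open>\<open>certs\<close> on trees, where gate \<open>i\<close> is found by scanning the
  numbered list \<open>G\<close>. The test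
  \<open>(tfst (tsnd e) = enc_nat 2) = (v \<noteq> Leaf)\<close> picks out the conjunctive cases,
  true AND and false OR; the fourfold \<open>tsnd\<close> asks whether there are more than two
  predecessors. The depth \<open>m\<close> is fixed, so each \<open>m\<close> has its own
  program.\<close>

primrec tcerts :: "nat \<Rightarrow> tree \<Rightarrow> tree \<Rightarrow> tree \<Rightarrow> tree" where
  "tcerts 0 G i v = Leaf"
| "tcerts (Suc m) G i v = tbind (\<lambda>e. if tfst e = i then
      if tfst (tsnd e) = enc_nat 0 then Branch (Branch (Branch i v) Leaf) Leaf
      else if tfst (tsnd e) = enc_nat 1 then tcerts m G (tsnd (tsnd e)) (enc_bool (v = Leaf))
      else if (tfst (tsnd e) = enc_nat 2) = (v \<noteq> Leaf) then
        if tsnd (tsnd (tsnd (tsnd e))) = Leaf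
        then tbind (\<lambda>c1. tmap (\<lambda>c2. tapp c1 c2) (tcerts m G (tfst (tsnd (tsnd (tsnd e)))) v)) (tcerts m G (tfst (tsnd (tsnd e))) v)
        else Branch (tmap (\<lambda>j. Branch j v) (tsnd (tsnd e))) Leaf
      else tbind (\<lambda>j. tcerts m G j v) (tsnd (tsnd e))
    else Leaf) G"

lemma ptime_tcerts[ptime_intros]:
  "ptime A \<Longrightarrow> ptime B \<Longrightarrow> ptime C \<Longrightarrow> ptime (\<lambda>x. tcerts m (A x) (B x) (C x))"
proof (induction m arbitrary: A B C)
  case (Suc m)
  have "ptime (\<lambda>p. tcerts (Suc m) (tfst p) (tfst (tsnd p)) (tsnd (tsnd p)))"
    unfolding tcerts.simps by (intro ptime_intros Suc.IH)
  then show ?case by (rule ptime_app3) fact+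
qed (simp add: ptime_const)

section \<open>Injectivity of numerals and correctness of the expansion\<close>

lemma enc_nat_0[simp]: "enc_nat 0 = Leaf" by (simp add: enc_nat_def)

lemma enc_nat_inject[simp]: "enc_nat m = enc_nat n \<longleftrightarrow> m = n"
proof
  have "bits m = bits n \<Longrightarrow> m = n"
  proof (induction m arbitrary: n rule: less_induct)
    case (less m)
    show ?case
    proof (cases "m = 0 \<or> n = 0")
      case True
      then show ?thesis using less.prems by (auto simp: bits.simps[of m] bits.simps[of n] split: if_splits)
    next
      case False
      then have "odd m = odd n" "bits (m div 2) = bits (n div 2)" using less.prems by (auto simp: bits_pos)
      then have "m div 2 = n div 2" "m mod 2 = n mod 2" using less.IH[of "m div 2"] False by (auto simp: odd_iff_mod_2_eq_one parity_cases)
      then show ?thesis by (metis div_mult_mod_eq)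
    qed
  qed
  moreover assume "enc_nat m = enc_nat n"
  then have "bits m = bits n"
    by (simp add: enc_nat_def inj_map_eq_map inj_def)
  ultimately show "m = n" by blast
qed simp

lemma enc_nat_num_neq[simp]: "enc_nat (numeral n) \<noteq> Leaf" "enc_nat 1 \<noteq> Leaf" "enc_nat (Suc 0) \<noteq> Leaf"
  using enc_nat_inject[of _ 0] by (simp_all del: enc_nat_inject)

definition enc_cert :: "(nat \<times> bool) list \<Rightarrow> tree" where
  "enc_cert c = enc_list (map (\<lambda>(j, w). Branch (enc_nat j) (enc_bool w)) c)"

lemma dec_enc_cert[simp]: "dec (enc_cert c) = map (\<lambda>(j, w). Branch (enc_nat j) (enc_bool w)) c"
  by (simp add: enc_cert_def)

definition tgates :: "tree \<Rightarrow> tree" where "tgates t = tindex (trev t)"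

lemma ptime_tgates[ptime_intros]: "ptime F \<Longrightarrow> ptime (\<lambda>x. tgates (F x))"
  unfolding tgates_def by (intro ptime_intros)

lemma index_list_select:
  assumes "i < length xs"
  shows "concat (map (\<lambda>(j, x). if j = i then F x else []) (index_list (rev xs))) = F (xs ! i)"
proof -
  have lt: "\<forall>(j, x)\<in>set (index_list ys). j < length ys" for ys :: "'a list" by (induction ys) auto
  show ?thesis using assms
  proof (induction xs rule: rev_induct)
    case (snoc x xs)
    show ?case
    proof (cases "i = length xs")
      case True
      have "concat (map (\<lambda>(j, x). if j = i then F x else []) (index_list (rev xs))) = []"
        using lt[of "rev xs"] True by (fastforce simp: concat_eq_Nil_conv)
      then show ?thesis using True by simp
    next
      case False
      then show ?thesis using snoc by (auto simp: nth_append)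
    qed
  qed simp
qed

lemma tbind_index:
  assumes "i < length gs"
  shows "dec (tbind (\<lambda>e. if tfst e = enc_nat i then F (tsnd e) else Leaf) (tgates (enc_list (map h gs)))) = dec (F (h (gs ! i)))"
proof -
  have "dec (tbind (\<lambda>e. if tfst e = enc_nat i then F (tsnd e) else Leaf) (tgates (enc_list (map h gs)))) =
     concat (map (\<lambda>(j, x). if j = i then dec (F x) else []) (index_list (rev (map h gs))))"
    by (simp add: tgates_def comp_def case_prod_unfold if_distrib cong: if_cong)
  also have "\<dots> = dec (F (h (gs ! i)))" using index_list_select[of i "map h gs" "\<lambda>x. dec (F x)"] assms by simp
  finally show ?thesis .
qed

context circuit
begin

lemma tcerts:
  "i < length gs \<Longrightarrow> tcerts m (tgates (enc_list (map enc_gate gs))) (enc_nat i) (enc_bool v) = enc_list (map enc_cert (certs gs m i v))"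
proof (induction m arbitrary: i v)
  case (Suc m)
  let ?G = "tgates (enc_list (map enc_gate gs))"
  define F where "F = (\<lambda>g. if tfst g = enc_nat 0 then Branch (Branch (Branch (enc_nat i) (enc_bool v)) Leaf) Leaf
      else if tfst g = enc_nat 1 then tcerts m ?G (tsnd g) (enc_bool (enc_bool v = Leaf))
      else if (tfst g = enc_nat 2) = (enc_bool v \<noteq> Leaf) then
        if tsnd (tsnd (tsnd g)) = Leaf
        then tbind (\<lambda>c1. tmap (\<lambda>c2. tapp c1 c2) (tcerts m ?G (tfst (tsnd (tsnd g))) (enc_bool v))) (tcerts m ?G (tfst (tsnd g)) (enc_bool v))
        else Branch (tmap (\<lambda>j. Branch j (enc_bool v)) (tsnd g)) Leaf
      else tbind (\<lambda>j. tcerts m ?G j (enc_bool v)) (tsnd g))"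
  have "dec (tcerts (Suc m) ?G (enc_nat i) (enc_bool v)) = dec (F (enc_gate (gs ! i)))"
    unfolding tcerts.simps F_def by (rule tbind_index[OF Suc.prems])
  also have "\<dots> = map enc_cert (certs gs (Suc m) i v)"
  proof -
    have IH: "tcerts m ?G (enc_nat j) (enc_bool w) = enc_list (map enc_cert (certs gs m j w))"
      if "j \<in> set (preds (gs ! i))" for j w
      using Suc.IH pred_less_length[OF Suc.prems that] by blast
    have junction: "dec (if u then
        if tsnd (tsnd (enc_list (map enc_nat js))) = Leaf
        then tbind (\<lambda>c1. tmap (\<lambda>c2. tapp c1 c2) (tcerts m ?G (tfst (tsnd (enc_list (map enc_nat js)))) (enc_bool v))) (tcerts m ?G (tfst (enc_list (map enc_nat js))) (enc_bool v))
        else Branch (tmap (\<lambda>j. Branch j (enc_bool v)) (enc_list (map enc_nat js))) Leaf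
      else tbind (\<lambda>j. tcerts m ?G j (enc_bool v)) (enc_list (map enc_nat js))) =
      map enc_cert (expand (certs gs m) v u js)" (is "dec (if u then ?X else ?Y) = _")
      if js: "js = preds (gs ! i)" "length js \<ge> 2" for js u
    proof (cases u)
      case True
      obtain a b r where ab: "js = a # b # r" using js(2) by (cases js rule: remdups_adj.cases) auto
      show ?thesis
      proof (cases "r = []")
        case r: True
        have cat: "tapp (enc_cert c1) (enc_cert c2) = enc_cert (c1 @ c2)" for c1 c2
          by (simp flip: dec_eq_iff)
        have "a \<in> set (preds (gs ! i))" "b \<in> set (preds (gs ! i))" using js(1) ab by (metis list.set_intros)+
        then show ?thesis using True unfolding ab r
          by (simp add: expand_def IH map_concat comp_def cat)
      next
        case False
        have "tmap (\<lambda>j. Branch j (enc_bool v)) (enc_list (map enc_nat js)) = enc_cert (map (\<lambda>j. (j, v)) js)"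
          by (simp flip: dec_eq_iff)
        then show ?thesis using True False unfolding ab by (cases r) (auto simp: expand_def)
      qed
    next
      case False
      have "dec (tbind (\<lambda>j. tcerts m ?G j (enc_bool v)) (enc_list (map enc_nat js))) = concat (map (\<lambda>j. map enc_cert (certs gs m j v)) js)"
        using IH js(1) by (auto simp: comp_def intro!: arg_cong[of _ _ concat])
      then show ?thesis using False by (simp add: expand_def map_concat comp_def)
    qed
    show ?thesis
    proof (cases "gs ! i")
      case InputG
      then show ?thesis by (simp add: F_def enc_cert_def)
    next
      case (NotG j)
      then show ?thesis using IH[of j "\<not> v"] by (simp add: F_def)
    next
      case (AndG js)
      have l: "length js \<ge> 2" using indeg[OF Suc.prems] AndG by simp
      have "dec (F (enc_gate (gs ! i))) = map enc_cert (expand (certs gs m) v v js)"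
        by (subst junction[symmetric]) (simp_all add: AndG l F_def)
      then show ?thesis by (simp add: AndG)
    next
      case (OrG js)
      have l: "length js \<ge> 2" using indeg[OF Suc.prems] OrG by simp
      have "dec (F (enc_gate (gs ! i))) = map enc_cert (expand (certs gs m) v (\<not> v) js)"
        by (subst junction[symmetric]) (simp_all add: OrG l F_def)
      then show ?thesis by (simp add: OrG)
    qed
  qed
  finally show ?case by (metis enc_list_dec)
qed simp

end

definition trefutations :: "nat \<Rightarrow> tree \<Rightarrow> tree \<Rightarrow> tree" where
  "trefutations D G out = tmap (\<lambda>\<gamma>. tbind (\<lambda>l. tcerts D G (tfst l) (enc_bool (tsnd l = Leaf))) \<gamma>) (tcerts D G out tt)"

lemma ptime_trefutations[ptime_intros]:
  assumes "ptime F" "ptime H" shows "ptime (\<lambda>x. trefutations D (F x) (H x))"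
proof -
  have "ptime (\<lambda>p. trefutations D (tfst p) (tsnd p))" unfolding trefutations_def by (intro ptime_intros)
  then show ?thesis by (rule ptime_app) fact+
qed

lemma trefutations:
  assumes wf: "wf_circuit (gs, out)" and weft: "weft_le (gs, out) 1" and depth: "depth_le (gs, out) d"
  shows "trefutations (Suc d) (tgates (enc_list (map enc_gate gs))) (enc_nat out) =
    enc_list (map (\<lambda>\<Phi>. enc_list (map enc_cert \<Phi>)) (refutations gs (Suc d) out))"
proof -
  interpret circuit gs by unfold_locales (use wf in auto)
  have out: "out < length gs" using wf by simp
  have w1: "larges 1 out" and dp: "deep (Suc d) out"
    using depth_deep[OF depth] weft by (auto simp: weft_le_def larges_def)
  have tt: "tt = enc_bool True" by (simp add: enc_bool_def)
  have "tbind (\<lambda>l. tcerts (Suc d) (tgates (enc_list (map enc_gate gs))) (tfst l) (enc_bool (tsnd l = Leaf))) (enc_cert \<gamma>) =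
      enc_list (map enc_cert (concat (map (\<lambda>(i, v). certs gs (Suc d) i (\<not> v)) \<gamma>)))"
    if g: "\<gamma> \<in> set (certs gs (Suc d) out True)" for \<gamma>
  proof -
    have "i < length gs" if "(i, v) \<in> set \<gamma>" for i v using certs_weft_1[OF w1 dp out g that] by simp
    then show ?thesis
      by (intro iffD1[OF dec_eq_iff]) (auto simp: map_concat comp_def tcerts simp del: tcerts.simps certs.simps intro!: arg_cong[of _ _ concat])
  qed
  then show ?thesis
    unfolding trefutations_def refutations_def tt tcerts[OF out]
    by (intro iffD1[OF dec_eq_iff]) (simp del: tcerts.simps certs.simps)
qed

text \<open>The heads of these two lists are not bits, so neither list is the encoding of a number.\<close>

definition tstart :: tree where "tstart = Branch (Branch tt tt) Leaf"
definition tend :: tree where "tend = Branch (Branch tt Leaf) Leaf"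

lemma enc_nat_sentinel: "enc_nat n \<noteq> tstart" "enc_nat n \<noteq> tend" "tstart \<noteq> tend"
  by (cases "n = 0"; simp add: enc_nat_def bits_pos tstart_def tend_def enc_bool_def)+

text \<open>The order of the inputs and sentinels is stored as an explicit list of pairs, so that a
  comparison is a membership test.\<close>

definition torder :: "tree \<Rightarrow> tree" where
  "torder G = tpairs (Branch tstart (tapp (tmap tfst (tfilter (\<lambda>e. tfst (tsnd e) = enc_nat 0) G)) (Branch tend Leaf)))"

lemma ptime_torder[ptime_intros]: "ptime F \<Longrightarrow> ptime (\<lambda>x. torder (F x))"
  unfolding torder_def by (intro ptime_intros)

text \<open>\<open>Branch Leaf k\<close> is the unary successor of \<open>k\<close>; its proper
  suffixes are the slots from \<open>k\<close> down to \<open>0\<close>.\<close>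

definition tslots :: "tree \<Rightarrow> tree" where
  "tslots k = tsuffixes (Branch Leaf k)"

lemma ptime_tslots[ptime_intros]: "ptime F \<Longrightarrow> ptime (\<lambda>x. tslots (F x))"
  unfolding tslots_def by (intro ptime_intros)

definition tentries :: "tree \<Rightarrow> tree \<Rightarrow> tree" where
  "tentries LT k = tbind (\<lambda>i. tmap (\<lambda>p. Branch i p) (tfilter (\<lambda>p.
     ((i = Leaf) = (tfst p = tstart)) \<and> ((i = k) = (tsnd p = tend))) LT)) (tslots k)"

lemma ptime_tentries[ptime_intros]:
  assumes "ptime F" "ptime H" shows "ptime (\<lambda>x. tentries (F x) (H x))"
proof -
  have "ptime (\<lambda>p. tentries (tfst p) (tsnd p))" unfolding tentries_def by (intro ptime_intros)
  then show ?thesis by (rule ptime_app) fact+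
qed

section \<open>Vertices and adjacency as trees\<close>

definition tverts :: "nat \<Rightarrow> tree \<Rightarrow> tree \<Rightarrow> tree \<Rightarrow> tree" where
  "tverts q LT Fam k = tremdups (Branch Leaf (tbind (\<lambda>\<Phi>. tmap (\<lambda>es. Branch \<Phi> es) (tnlists q (tentries LT k))) Fam))"

lemma ptime_tverts[ptime_intros]:
  assumes "ptime A" "ptime B" "ptime C" shows "ptime (\<lambda>x. tverts q (A x) (B x) (C x))"
proof -
  have "ptime (\<lambda>p. tverts q (tfst p) (tfst (tsnd p)) (tsnd (tsnd p)))" unfolding tverts_def by (intro ptime_intros)
  then show ?thesis by (rule ptime_app3) fact+
qed

definition tknown :: "tree \<Rightarrow> tree \<Rightarrow> tree \<Rightarrow> bool" where
  "tknown LT es l \<longleftrightarrow> tsnd l \<noteq> Leaf \<and> (\<exists>e\<in>set (dec es). tfst l = tfst (tsnd e) \<or> tfst l = tsnd (tsnd e)) \<or>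
     tsnd l = Leaf \<and> (\<exists>e\<in>set (dec es). Branch (tfst (tsnd e)) (tfst l) \<in> set (dec LT) \<and> Branch (tfst l) (tsnd (tsnd e)) \<in> set (dec LT))"

definition trel :: "tree \<Rightarrow> tree \<Rightarrow> tree \<Rightarrow> bool" where
  "trel LT u v \<longleftrightarrow> u = Leaf \<or> v = Leaf \<or> tfst u = tfst v \<and>
     (\<forall>e\<in>set (dec (tsnd u)). \<forall>e'\<in>set (dec (tsnd v)).
        (tfst e = tfst e' \<longrightarrow> e = e') \<and> (tfst e' = Branch Leaf (tfst e) \<longrightarrow> tfst (tsnd e') = tsnd (tsnd e))) \<and>
     (\<forall>c\<in>set (dec (tfst u)). \<not> (\<forall>l\<in>set (dec c). tknown LT (tsnd u) l))"

lemma ptime_trel[ptime_intros]: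
  assumes "ptime A" "ptime B" "ptime C" shows "ptime (\<lambda>x. enc_bool (trel (A x) (B x) (C x)))"
proof -
  have "ptime (\<lambda>p. enc_bool (trel (tfst p) (tfst (tsnd p)) (tsnd (tsnd p))))"
    unfolding trel_def tknown_def by (intro ptime_intros)
  then show ?thesis using ptime_app3[of "\<lambda>a b c. enc_bool (trel a b c)"] assms by blast
qed

definition titems :: "tree \<Rightarrow> tree \<Rightarrow> tree" where
  "titems LT V = tremdups (tbind (\<lambda>u. tmap (\<lambda>v. Branch u v) (tfilter (\<lambda>v. trel LT u v) V)) V)"

lemma ptime_titems[ptime_intros]:
  assumes "ptime F" "ptime H" shows "ptime (\<lambda>x. titems (F x) (H x))"
proof -
  have "ptime (\<lambda>p. titems (tfst p) (tsnd p))" unfolding titems_def by (intro ptime_intros)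
  then show ?thesis by (rule ptime_app) fact+
qed

text \<open>A list whose purpose is its length: the \<open>(k+1)^q\<close> colours and one more
  element for the universal vertex, thus exactly \<open>K\<close> distinct elements.\<close>

definition tcolours :: "nat \<Rightarrow> tree \<Rightarrow> tree" where
  "tcolours q k = Branch Leaf (tnlists q (tslots k))"

lemma ptime_tcolours[ptime_intros]: "ptime F \<Longrightarrow> ptime (\<lambda>x. tcolours q (F x))"
  unfolding tcolours_def by (intro ptime_intros)

lemma enc_unary_inject[simp]: "enc_unary m = enc_unary n \<longleftrightarrow> m = n"
  unfolding enc_unary_def by (auto dest: arg_cong[of _ _ length])

lemma enc_unary_Suc: "enc_unary (Suc n) = Branch Leaf (enc_unary n)"
  by (simp add: enc_unary_def)

lemma enc_unary_0: "enc_unary 0 = Leaf"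
  by (simp add: enc_unary_def)

lemma dec_tslots: "dec (tslots (enc_unary k)) = map enc_unary (rev [0..<Suc k])"
  unfolding tslots_def using dec_tsuffixes_unary[of "Suc k"] by (simp only: enc_unary_Suc)

lemma tcolours:
  assumes "q \<ge> 1"
  shows "length (dec (tcolours q (enc_unary k))) = Suc ((k + 1) ^ q)" "distinct (dec (tcolours q (enc_unary k)))"
proof -
  show "length (dec (tcolours q (enc_unary k))) = Suc ((k + 1) ^ q)"
    by (simp add: tcolours_def dec_tnlists dec_tslots length_n_lists del: upt_Suc)
  have "distinct (map enc_unary (rev [0..<Suc k]))" by (simp add: distinct_map inj_on_def del: upt_Suc)
  then have "distinct (List.n_lists q (map enc_unary (rev [0..<Suc k])))" by (rule distinct_n_lists)
  \<comment> \<open>The extra \<open>Leaf\<close> also encodes the empty list, which is not a colour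
    because \<open>q \<ge> 1\<close>.\<close>
  moreover have "Leaf \<notin> enc_list ` set (List.n_lists q (map enc_unary (rev [0..<Suc k])))"
  proof
    assume "Leaf \<in> enc_list ` set (List.n_lists q (map enc_unary (rev [0..<Suc k])))"
    then obtain ys where ys: "ys \<in> set (List.n_lists q (map enc_unary (rev [0..<Suc k])))" "enc_list ys = Leaf" by force
    then have "ys = []" by (metis dec.simps(1) dec_enc_list)
    then show False using length_n_lists_elem[OF ys(1)] assms by simp
  qed
  ultimately show "distinct (dec (tcolours q (enc_unary k)))"
    by (simp add: tcolours_def dec_tnlists dec_tslots distinct_map inj_on_def del: upt_Suc)
qed

section \<open>Trees versus abstract vertices\<close>

fun enc_entry :: "nat \<times> tree \<times> tree \<Rightarrow> tree" where
  "enc_entry (i, lo, hi) = Branch (enc_unary i) (Branch lo hi)"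

fun enc_lit :: "tree \<times> bool \<Rightarrow> tree" where
  "enc_lit (x, w) = Branch x (enc_bool w)"

definition enc_fam :: "(tree \<times> bool) list list \<Rightarrow> tree" where
  "enc_fam \<Phi> = enc_list (map (\<lambda>c. enc_list (map enc_lit c)) \<Phi>)"

fun enc_vert :: "((tree \<times> bool) list list \<times> (nat \<times> tree \<times> tree) list) option \<Rightarrow> tree" where
  "enc_vert None = Leaf"
| "enc_vert (Some (\<Phi>, es)) = Branch (enc_fam \<Phi>) (enc_list (map enc_entry es))"

lemma enc_entry_inject[simp]: "enc_entry e = enc_entry e' \<longleftrightarrow> e = e'"
  by (cases e; cases e') auto

lemma enc_lit_inject[simp]: "enc_lit e = enc_lit e' \<longleftrightarrow> e = e'"
  by (cases e; cases e') auto

lemma enc_fam_inject[simp]: "enc_fam e = enc_fam e' \<longleftrightarrow> e = e'"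
  unfolding enc_fam_def by (simp add: inj_map_eq_map inj_def)

lemma enc_vert_inject[simp]: "enc_vert e = enc_vert e' \<longleftrightarrow> e = e'"
  by (cases e rule: enc_vert.cases; cases e' rule: enc_vert.cases) (auto simp: inj_map_eq_map inj_def)

locale tree_views = gap_views tstart tend xs k q Fam for xs k q Fam
begin

definition "order = tpairs (enc_list U)"

lemma order_iff: "Branch x y \<in> set (dec order) \<longleftrightarrow> (x, y) \<in> LT"
  unfolding order_def set_tpairs LT_def by auto

lemma set_tentries: "set (dec (tentries order (enc_unary k))) = enc_entry ` entries"
proof -
  have "set (dec order) = (\<lambda>(x, y). Branch x y) ` LT"
    unfolding order_def set_tpairs LT_def by force
  moreover have "enc_unary i = Leaf \<longleftrightarrow> i = 0" for i using enc_unary_inject[of i 0] by (simp add: enc_unary_0)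
  ultimately show ?thesis
    unfolding tentries_def entries_def by (fastforce simp: dec_tslots image_iff simp del: upt_Suc)
qed

lemma tverts:
  assumes F: "set (dec FT) = enc_fam ` Fam"
  shows "set (dec (tverts q order FT (enc_unary k))) = enc_vert ` verts"
proof -
  have "set (dec (tnlists q (tentries order (enc_unary k)))) = enc_list ` {es. length es = q \<and> set es \<subseteq> enc_entry ` entries}"
    by (simp add: dec_tnlists set_n_lists set_tentries)
  also have "{es. length es = q \<and> set es \<subseteq> enc_entry ` entries} = map enc_entry ` {es. set es \<subseteq> entries \<and> length es = q}"
  proof (intro equalityI subsetI)
    fix es assume "es \<in> {es. length es = q \<and> set es \<subseteq> enc_entry ` entries}"
    then have "length es = q" "es \<in> lists (enc_entry ` entries)" by auto
    then show "es \<in> map enc_entry ` {es. set es \<subseteq> entries \<and> length es = q}"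
      unfolding lists_image by auto
  next
    fix es assume "es \<in> map enc_entry ` {es. set es \<subseteq> entries \<and> length es = q}"
    then obtain es' where "es = map enc_entry es'" "set es' \<subseteq> entries" "length es' = q" by blast
    then show "es \<in> {es. length es = q \<and> set es \<subseteq> enc_entry ` entries}" by (simp add: image_mono)
  qed
  finally have views: "set (dec (tnlists q (tentries order (enc_unary k)))) = enc_list ` map enc_entry ` {es. set es \<subseteq> entries \<and> length es = q}" .
  have "set (dec (tverts q order FT (enc_unary k))) = insert Leaf (\<Union>\<Phi>\<in>enc_fam ` Fam. Branch \<Phi> ` enc_list ` map enc_entry ` {es. set es \<subseteq> entries \<and> length es = q})"
    by (simp add: tverts_def F views del: remdups.simps)
  also have "\<dots> = enc_vert ` verts"
  proof -
    have "enc_vert ` Some ` (Fam \<times> Es) = (\<Union>\<Phi>\<in>enc_fam ` Fam. Branch \<Phi> ` enc_list ` map enc_entry ` Es)" for Es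
    proof (intro equalityI subsetI)
      fix x assume "x \<in> enc_vert ` Some ` (Fam \<times> Es)"
      then obtain \<Phi> es where "\<Phi> \<in> Fam" "es \<in> Es" "x = enc_vert (Some (\<Phi>, es))" by blast
      then show "x \<in> (\<Union>\<Phi>\<in>enc_fam ` Fam. Branch \<Phi> ` enc_list ` map enc_entry ` Es)" by auto
    next
      fix x assume "x \<in> (\<Union>\<Phi>\<in>enc_fam ` Fam. Branch \<Phi> ` enc_list ` map enc_entry ` Es)"
      then obtain \<Phi> es where "\<Phi> \<in> Fam" "es \<in> Es" "x = enc_vert (Some (\<Phi>, es))" by auto
      then show "x \<in> enc_vert ` Some ` (Fam \<times> Es)" by blast
    qed
    then show ?thesis unfolding verts_def image_insert by simp
  qed
  finally show ?thesis .
qed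

lemma trel: "trel order (enc_vert u) (enc_vert v) \<longleftrightarrow> Rel u v"
proof (cases "u = None \<or> v = None")
  case True
  then show ?thesis by (cases u; cases v) (auto simp: trel_def)
next
  case False
  then obtain \<Phi> es \<Phi>' es' where uv: "u = Some (\<Phi>, es)" "v = Some (\<Phi>', es')" by (metis not_None_eq surj_pair)
  have kn: "tknown order (enc_list (map enc_entry es)) (enc_lit l) \<longleftrightarrow> known es l" for l
    by (cases l) (force simp: tknown_def known_def order_iff)
  have suc: "enc_unary j = Branch Leaf (enc_unary i) \<longleftrightarrow> j = Suc i" for i j
    by (simp flip: enc_unary_Suc)
  have cn: "(tfst (enc_entry e) = tfst (enc_entry e') \<longrightarrow> enc_entry e = enc_entry e') \<and>
     (tfst (enc_entry e') = Branch Leaf (tfst (enc_entry e)) \<longrightarrow> tfst (tsnd (enc_entry e')) = tsnd (tsnd (enc_entry e))) \<longleftrightarrow> cons e e'" for e e'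
    by (cases e; cases e') (auto simp: cons_def suc)
  have "trel order (enc_vert u) (enc_vert v) \<longleftrightarrow> enc_fam \<Phi> = enc_fam \<Phi>' \<and> (\<forall>e\<in>set es. \<forall>e'\<in>set es'.
      (tfst (enc_entry e) = tfst (enc_entry e') \<longrightarrow> enc_entry e = enc_entry e') \<and>
     (tfst (enc_entry e') = Branch Leaf (tfst (enc_entry e)) \<longrightarrow> tfst (tsnd (enc_entry e')) = tsnd (tsnd (enc_entry e)))) \<and>
     (\<forall>c\<in>set \<Phi>. \<not> (\<forall>l\<in>set c. tknown order (enc_list (map enc_entry es)) (enc_lit l)))"
    unfolding trel_def uv by (simp del: enc_entry_inject enc_fam_inject add: enc_fam_def[of \<Phi>])
  also have "\<dots> \<longleftrightarrow> Rel u v" unfolding cn kn uv by simp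
  finally show ?thesis .
qed

lemma selection_iff_titems:
  assumes F: "set (dec FT) = enc_fam ` Fam"
  defines "V \<equiv> tverts q order FT (enc_unary k)"
  shows "(\<exists>S\<subseteq>set xs. card S = k \<and> (\<exists>\<Phi>\<in>Fam. \<forall>c\<in>set \<Phi>. \<not> agrees S c)) \<longleftrightarrow>
    (\<exists>R. R \<times> R \<subseteq> {(u, v). Branch u v \<in> set (dec (titems order V))} \<and> card R = Suc ((k + 1) ^ q))"
proof -
  have V: "set (dec V) = enc_vert ` verts" unfolding V_def by (rule tverts[OF F])
  have E: "Branch u v \<in> set (dec (titems order V)) \<longleftrightarrow> u \<in> set (dec V) \<and> v \<in> set (dec V) \<and> trel order u v" for u v
    by (auto simp: titems_def)
  have inj: "inj_on enc_vert A" for A by (simp add: inj_on_def)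
  show ?thesis unfolding selection_iff_clique
  proof
    assume "\<exists>R\<subseteq>verts. card R = Suc ((k + 1) ^ q) \<and> (\<forall>u\<in>R. \<forall>v\<in>R. Rel u v)"
    then obtain R where R: "R \<subseteq> verts" "card R = Suc ((k + 1) ^ q)" "\<forall>u\<in>R. \<forall>v\<in>R. Rel u v" by blast
    then show "\<exists>R. R \<times> R \<subseteq> {(u, v). Branch u v \<in> set (dec (titems order V))} \<and> card R = Suc ((k + 1) ^ q)"
      by (intro exI[of _ "enc_vert ` R"]) (auto simp: E V trel card_image[OF inj])
  next
    assume "\<exists>R. R \<times> R \<subseteq> {(u, v). Branch u v \<in> set (dec (titems order V))} \<and> card R = Suc ((k + 1) ^ q)"
    then obtain R where R: "R \<times> R \<subseteq> {(u, v). Branch u v \<in> set (dec (titems order V))}" "card R = Suc ((k + 1) ^ q)" by blast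
    have "R \<subseteq> enc_vert ` verts" using R(1) by (auto simp: E V)
    then obtain R' where R': "R' \<subseteq> verts" "R = enc_vert ` R'" by (meson subset_imageE)
    moreover have "Rel u v" if "u \<in> R'" "v \<in> R'" for u v
    proof -
      have "(enc_vert u, enc_vert v) \<in> R \<times> R" using that R'(2) by blast
      then show ?thesis using R(1) unfolding E trel[symmetric] by blast
    qed
    ultimately show "\<exists>R\<subseteq>verts. card R = Suc ((k + 1) ^ q) \<and> (\<forall>u\<in>R. \<forall>v\<in>R. Rel u v)"
      using R(2) by (intro exI[of _ R']) (auto simp: card_image[OF inj])
  qed
qed

end

section \<open>Node numbers as positions in a list\<close>

primrec pos :: "'a list \<Rightarrow> 'a \<Rightarrow> nat" where
  "pos [] x = 0"
| "pos (y # ys) x = (if x = y then length ys else pos ys x)"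

lemma pos_less: "x \<in> set xs \<Longrightarrow> pos xs x < length xs"
  by (induction xs) auto

lemma inj_on_pos: "inj_on (pos xs) (set xs)"
proof (induction xs)
  case (Cons y ys)
  then show ?case using pos_less[of _ ys] by (fastforce simp: inj_on_def)
qed simp

lemma index_list_pos: "distinct xs \<Longrightarrow> index_list xs = map (\<lambda>x. (pos xs x, x)) xs"
  by (induction xs) auto

lemma tlookup_tindex:
  assumes "x \<in> set (dec t)"
  shows "tlookup (tindex t) x = enc_nat (pos (dec t) x)"
proof -
  have hd: "tfst s = hd (dec s)" if "dec s \<noteq> []" for s using that by (cases s) auto
  have "x \<in> set xs \<Longrightarrow> filter (\<lambda>e. tsnd e = x) (map (\<lambda>(j, y). Branch (enc_nat j) y) (index_list xs)) \<noteq> [] \<and>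
     hd (filter (\<lambda>e. tsnd e = x) (map (\<lambda>(j, y). Branch (enc_nat j) y) (index_list xs))) = Branch (enc_nat (pos xs x)) x" for xs
    by (induction xs) auto
  from this[OF assms] have "tfst (tfilter (\<lambda>e. tsnd e = x) (tindex t)) = Branch (enc_nat (pos (dec t) x)) x"
    by (subst hd) auto
  then show ?thesis by (simp add: tlookup_def)
qed

section \<open>The flow instance as a tree\<close>

abbreviation "tsrc \<equiv> Branch (enc_nat 0) Leaf"
abbreviation "tsnk \<equiv> Branch (enc_nat 1) Leaf"
abbreviation "titem \<equiv> Branch (enc_nat 2)"
abbreviation "tpt \<equiv> Branch (enc_nat 3)"
abbreviation "tpt' \<equiv> Branch (enc_nat 4)"
abbreviation "tdum \<equiv> Branch (enc_nat 5)"

fun enc_node :: "(tree, tree) node \<Rightarrow> tree" where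
  "enc_node Src = tsrc"
| "enc_node Snk = tsnk"
| "enc_node (Item (u, v)) = titem (Branch u v)"
| "enc_node (Pt v) = tpt v"
| "enc_node (Pt' v) = tpt' v"
| "enc_node (Dum d) = tdum d"

lemma enc_node_inject: "enc_node x = enc_node y \<longleftrightarrow> x = y"
  by (cases x rule: enc_node.cases; cases y rule: enc_node.cases) (auto simp del: enc_nat_0)

definition tdummies :: "tree \<Rightarrow> tree" where
  "tdummies C = tremdups (tbind (\<lambda>c. tmap (\<lambda>c'. Branch c c') C) C)"

definition tnodes :: "tree \<Rightarrow> tree \<Rightarrow> tree \<Rightarrow> tree" where
  "tnodes E V B = tremdups (Branch tsrc (Branch tsnk (tapp (tmap titem E) (tapp (tmap tpt V) (tapp (tmap tpt' V) (tmap tdum B))))))"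

definition tarcs :: "tree \<Rightarrow> tree \<Rightarrow> tree \<Rightarrow> tree" where
  "tarcs E V B = tremdups (tapp (tmap (\<lambda>e. Branch tsrc (titem e)) E) (tapp (tmap (\<lambda>e. Branch (titem e) tsnk) E)
     (tapp (tmap (\<lambda>e. Branch (titem e) (tpt (tfst e))) E) (tapp (tmap (\<lambda>e. Branch (titem e) (tpt (tsnd e))) E)
     (tapp (tmap (\<lambda>v. Branch (tpt v) (tpt' v)) V) (tapp (tmap (\<lambda>v. Branch (tpt' v) tsnk) V)
     (tapp (tmap (\<lambda>d. Branch tsrc (tdum d)) B) (tmap (\<lambda>d. Branch (tdum d) tsnk) B))))))))"

definition tarc :: "tree \<Rightarrow> tree \<Rightarrow> tree \<Rightarrow> tree" where
  "tarc D b a = Branch (tlookup D (tfst a)) (Branch (tlookup D (tsnd a)) (Branch (enc_nat 1)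
     (Branch (if tsnd a = tsnk \<and> tfst (tfst a) = enc_nat 2 then enc_nat 1 else b) Leaf)))"

text \<open>All numbers are lengths: \<open>B\<close> has the \<open>K^2\<close> pairs of colours
  and gives the budget, one more is the prohibitive cost, and \<open>E\<close> appended to
  \<open>C\<close> gives the threshold.\<close>

definition tinstance :: "tree \<Rightarrow> tree \<Rightarrow> tree \<Rightarrow> tree \<Rightarrow> tree \<Rightarrow> tree" where
  "tinstance E V C B D = Branch (tmap tfst D) (Branch (tmap (\<lambda>a. tarc D (tlen (Branch Leaf B)) a) (tarcs E V B))
     (Branch (tlookup D tsrc) (Branch (tlookup D tsnk) (Branch (tlen B) (Branch (tlen (tapp E C)) Leaf)))))"

definition tfei :: "tree \<Rightarrow> tree \<Rightarrow> tree \<Rightarrow> tree" where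
  "tfei E V C = Branch (tinstance E V C (tdummies C) (tindex (tnodes E V (tdummies C)))) (tmap (\<lambda>_. Leaf) (tdummies C))"

lemma ptime_tfei[ptime_intros]:
  assumes "ptime A" "ptime B" "ptime C" shows "ptime (\<lambda>x. tfei (A x) (B x) (C x))"
proof -
  have [ptime_intros]: "ptime (\<lambda>x. tdummies (F x))" if "ptime F" for F
  proof -
    have "ptime tdummies" unfolding tdummies_def by (intro ptime_intros)
    then show ?thesis using that by (rule ptime_comp)
  qed
  have "ptime (\<lambda>p. tnodes (tfst p) (tfst (tsnd p)) (tsnd (tsnd p)))" unfolding tnodes_def by (intro ptime_intros)
  note [ptime_intros] = ptime_app3[OF this]
  have "ptime (\<lambda>p. tarcs (tfst p) (tfst (tsnd p)) (tsnd (tsnd p)))" unfolding tarcs_def by (intro ptime_intros)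
  note [ptime_intros] = ptime_app3[OF this]
  have "ptime (\<lambda>p. tarc (tfst p) (tfst (tsnd p)) (tsnd (tsnd p)))" unfolding tarc_def by (intro ptime_intros)
  note [ptime_intros] = ptime_app3[OF this]
  have "ptime (\<lambda>p. tfei (tfst p) (tfst (tsnd p)) (tsnd (tsnd p)))" unfolding tfei_def tinstance_def by (intro ptime_intros)
  then show ?thesis by (rule ptime_app3) fact+
qed

lemma tfei_correct:
  assumes C: "distinct (dec C)" "length (dec C) = K" "K \<ge> 2" and E: "distinct (dec E)"
    and EV: "\<And>e. e \<in> set (dec E) \<Longrightarrow> \<exists>u v. e = Branch u v \<and> u \<in> set (dec V) \<and> v \<in> set (dec V)"
  shows "\<exists>y I. tfei E V C = Branch y (enc_unary (K * K)) \<and> budget I = K * K \<and> fei_encodes y I \<and> fei_valid I \<and>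
    underlying_bipartite (graph I) \<and> (\<forall>a\<in>parcs (graph I). capacity I a = 1) \<and>
    (fei_yes I \<longleftrightarrow> (\<exists>R. R \<times> R \<subseteq> {(u, v). Branch u v \<in> set (dec E)} \<and> card R = K))"
proof -
  define Es where "Es = {(u, v). Branch u v \<in> set (dec E)}"
  define Vs where "Vs = set (dec V)"
  define B where "B = tdummies C"
  define Bs where "Bs = set (dec B)"
  define nodes where "nodes = {Src, Snk} \<union> Item ` Es \<union> Pt ` Vs \<union> Pt' ` Vs \<union> Dum ` Bs"
  define arcs where "arcs = (\<lambda>e. (Src, Item e)) ` Es \<union> (\<lambda>e. (Item e, Snk)) ` Es
      \<union> (\<lambda>e. (Item e, Pt (fst e))) ` Es \<union> (\<lambda>e. (Item e, Pt (snd e))) ` Es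
      \<union> (\<lambda>v. (Pt v, Pt' v)) ` Vs \<union> (\<lambda>v. (Pt' v, Snk)) ` Vs
      \<union> (\<lambda>d. (Src, Dum d)) ` Bs \<union> (\<lambda>d. (Dum d, Snk)) ` Bs"
  define N where "N = tnodes E V B"
  define \<nu> where "\<nu> x = pos (dec N) (enc_node x)" for x
  define G where "G = \<lparr>pverts = \<nu> ` nodes, parcs = map_prod \<nu> \<nu> ` arcs\<rparr>"
  \<comment> \<open>The cost has to be a function of node numbers; injectivity of
    \<open>\<nu>\<close> on the nodes makes this membership test recognise exactly the arcs from
    items to the sink.\<close>
  define c where "c a = (if a \<in> (\<lambda>e. (\<nu> (Item e), \<nu> Snk)) ` Es then 1 else K * K + 1)" for a
  define I where "I = \<lparr>graph = G, source = \<nu> Src, sink = \<nu> Snk, capacity = (\<lambda>_. 1), cost = c,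
    budget = K * K, threshold = card Es + K\<rparr>"
  have E_img: "set (dec E) = (\<lambda>(u, v). Branch u v) ` Es"
    using EV by (force simp: Es_def)
  have cE: "length (dec E) = card Es"
  proof -
    have "length (dec E) = card (set (dec E))" using E by (simp add: distinct_card)
    also have "\<dots> = card Es" unfolding E_img by (rule card_image) (auto simp: inj_on_def)
    finally show ?thesis .
  qed
  have Bs: "Bs = (\<lambda>(c, c'). Branch c c') ` (set (dec C) \<times> set (dec C))"
    by (auto simp: Bs_def B_def tdummies_def)
  have "card Bs = card (set (dec C) \<times> set (dec C))" unfolding Bs by (rule card_image) (auto simp: inj_on_def)
  then have cB: "card Bs = K * K" using C distinct_card[OF C(1)] by (simp add: card_cartesian_product)
  have lB: "length (dec B) = K * K"
  proof -
    have "distinct (dec B)" by (simp add: B_def tdummies_def)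
    then show ?thesis using cB distinct_card by (force simp: Bs_def)
  qed
  have N_set: "set (dec N) = enc_node ` nodes"
  proof -
    have "set (dec N) = {tsrc, tsnk} \<union> titem ` set (dec E) \<union> tpt ` Vs \<union> tpt' ` Vs \<union> tdum ` Bs"
      by (simp add: N_def tnodes_def Vs_def Bs_def Un_ac del: remdups.simps)
    also have "titem ` set (dec E) = enc_node ` Item ` Es" unfolding E_img by force
    finally show ?thesis by (simp add: nodes_def image_Un image_image insert_commute Un_ac)
  qed
  have A_set: "set (dec (tarcs E V B)) = (\<lambda>(x, y). Branch (enc_node x) (enc_node y)) ` arcs"
  proof -
    have Efst: "f ` set (dec E) = (\<lambda>(u, v). f (Branch u v)) ` Es" for f :: "tree \<Rightarrow> tree" unfolding E_img by force
    have "set (dec (tarcs E V B)) = (\<lambda>e. Branch tsrc (titem e)) ` set (dec E) \<union> (\<lambda>e. Branch (titem e) tsnk) ` set (dec E)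
      \<union> (\<lambda>e. Branch (titem e) (tpt (tfst e))) ` set (dec E) \<union> (\<lambda>e. Branch (titem e) (tpt (tsnd e))) ` set (dec E)
      \<union> (\<lambda>v. Branch (tpt v) (tpt' v)) ` Vs \<union> (\<lambda>v. Branch (tpt' v) tsnk) ` Vs
      \<union> (\<lambda>d. Branch tsrc (tdum d)) ` Bs \<union> (\<lambda>d. Branch (tdum d) tsnk) ` Bs"
      by (simp add: tarcs_def Vs_def Bs_def Un_assoc)
    also have "\<dots> = (\<lambda>(x, y). Branch (enc_node x) (enc_node y)) ` arcs"
      unfolding Efst arcs_def image_Un image_image by (simp add: case_prod_unfold flip: enc_node.simps(3))
    finally show ?thesis .
  qed
  have dN: "distinct (dec N)" by (simp add: N_def tnodes_def)
  have inj: "inj_on \<nu> nodes"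
  proof (rule inj_onI)
    fix x y assume xy: "x \<in> nodes" "y \<in> nodes" "\<nu> x = \<nu> y"
    then have "enc_node x = enc_node y" using inj_on_pos[of "dec N"] N_set by (auto simp: \<nu>_def dest: inj_onD)
    then show "x = y" by (simp add: enc_node_inject)
  qed
  have EsVs: "Es \<subseteq> Vs \<times> Vs" using EV by (force simp: Es_def Vs_def)
  have arcs_in_nodes: "x \<in> nodes \<and> y \<in> nodes" if "(x, y) \<in> arcs" for x y
    using that EsVs unfolding arcs_def nodes_def by auto
  interpret interdiction_gadget Vs Es Bs K \<nu> nodes arcs G c "\<lambda>_. 1"
  proof
    show "finite Vs" "finite Bs" by (simp_all add: Vs_def Bs_def)
    show "Es \<subseteq> Vs \<times> Vs" "card Bs = K * K" "2 \<le> K" "inj_on \<nu> nodes" by fact+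
    show "c (\<nu> x, \<nu> y) = (if y = Snk \<and> x \<in> range Item then 1 else K * K + 1)" if xy: "(x, y) \<in> arcs" for x y
    proof -
      have n: "x \<in> nodes" "y \<in> nodes" using arcs_in_nodes[OF xy] by auto
      have "(\<nu> x, \<nu> y) \<in> (\<lambda>e. (\<nu> (Item e), \<nu> Snk)) ` Es \<longleftrightarrow> (\<exists>e\<in>Es. x = Item e \<and> y = Snk)"
      proof
        assume "(\<nu> x, \<nu> y) \<in> (\<lambda>e. (\<nu> (Item e), \<nu> Snk)) ` Es"
        then obtain e where e: "e \<in> Es" "\<nu> x = \<nu> (Item e)" "\<nu> y = \<nu> Snk" by blast
        moreover have "Item e \<in> nodes" "Snk \<in> nodes" using e(1) unfolding nodes_def by blast+
        ultimately show "\<exists>e\<in>Es. x = Item e \<and> y = Snk" using inj_onD[OF inj] n by blast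
      qed blast
      moreover have "x = Item e \<Longrightarrow> e \<in> Es" for e using n by (auto simp: nodes_def)
      ultimately show ?thesis by (auto simp: c_def)
    qed
  qed (simp_all add: nodes_def arcs_def G_def)
  have "fei_yes I \<longleftrightarrow> (\<exists>R. R \<times> R \<subseteq> Es \<and> card R = K)"
    unfolding fei_yes_def I_def using interdiction_iff_clique by simp
  moreover have "fei_valid I"
    unfolding fei_valid_def using valid Src_Snk C(3) by (simp add: I_def G_def)
  moreover have "underlying_bipartite (graph I)" using bipartite by (simp add: I_def)
  moreover have "tfei E V C = Branch (tinstance E V C B (tindex N)) (enc_unary (K * K))"
  proof -
    have "tmap (\<lambda>_. Leaf) B = enc_unary (K * K)"
      unfolding enc_unary_def by (intro iffD1[OF dec_eq_iff]) (simp add: lB map_replicate_const)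
    then show ?thesis by (simp add: tfei_def N_def B_def)
  qed
  moreover have "fei_encodes (tinstance E V C B (tindex N)) I"
  proof -
    define ns where "ns = map (pos (dec N)) (dec N)"
    define as where "as = map (\<lambda>a. (pos (dec N) (tfst a), pos (dec N) (tsnd a))) (dec (tarcs E V B))"
    have ns: "distinct ns" "set ns = pverts (graph I)"
      using dN inj_on_pos[of "dec N"] N_set by (auto simp: ns_def distinct_map I_def G_def \<nu>_def)
    have as_arc: "\<exists>x y. a = Branch (enc_node x) (enc_node y) \<and> (x, y) \<in> arcs" if "a \<in> set (dec (tarcs E V B))" for a
      using that unfolding A_set by auto
    have "inj_on (\<lambda>a. (pos (dec N) (tfst a), pos (dec N) (tsnd a))) (set (dec (tarcs E V B)))"
    proof (rule inj_onI)
      fix a b assume ab: "a \<in> set (dec (tarcs E V B))" "b \<in> set (dec (tarcs E V B))"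
        "(pos (dec N) (tfst a), pos (dec N) (tsnd a)) = (pos (dec N) (tfst b), pos (dec N) (tsnd b))"
      obtain x y where a: "a = Branch (enc_node x) (enc_node y)" "(x, y) \<in> arcs" using as_arc[OF ab(1)] by blast
      obtain x' y' where b: "b = Branch (enc_node x') (enc_node y')" "(x', y') \<in> arcs" using as_arc[OF ab(2)] by blast
      have "\<nu> x = \<nu> x'" "\<nu> y = \<nu> y'" using ab(3) a b by (auto simp: \<nu>_def)
      then have "x = x'" "y = y'" using arcs_in_nodes[OF a(2)] arcs_in_nodes[OF b(2)] by (auto dest: inj_onD[OF inj])
      then show "a = b" using a b by simp
    qed
    moreover have "distinct (dec (tarcs E V B))" by (simp add: tarcs_def)
    ultimately have as: "distinct as" by (simp add: as_def distinct_map)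
    have "set as = parcs (graph I)"
      unfolding as_def by (simp add: A_set I_def G_def image_image case_prod_unfold \<nu>_def map_prod_def)
    moreover have "tinstance E V C B (tindex N) = enc_list
          [enc_list (map enc_nat ns),
           enc_list (map (\<lambda>a. enc_list
             [enc_nat (fst a), enc_nat (snd a), enc_nat (capacity I a), enc_nat (cost I a)]) as),
           enc_nat (source I), enc_nat (sink I), enc_nat (budget I), enc_nat (threshold I)]"
    proof -
      have look: "tlookup (tindex N) (enc_node x) = enc_nat (\<nu> x)" if "x \<in> nodes" for x
        using tlookup_tindex[of "enc_node x" N] N_set that by (simp add: \<nu>_def)
      have "tmap tfst (tindex N) = enc_list (map enc_nat ns)"
        by (intro iffD1[OF dec_eq_iff]) (simp add: index_list_pos[OF dN] ns_def)
      moreover have "tmap (\<lambda>a. tarc (tindex N) (tlen (Branch Leaf B)) a) (tarcs E V B) = enc_list (map (\<lambda>a. enc_list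
             [enc_nat (fst a), enc_nat (snd a), enc_nat (capacity I a), enc_nat (cost I a)]) as)"
      proof -
        have "tarc (tindex N) (tlen (Branch Leaf B)) a = enc_list [enc_nat (pos (dec N) (tfst a)), enc_nat (pos (dec N) (tsnd a)), enc_nat 1,
            enc_nat (c (pos (dec N) (tfst a), pos (dec N) (tsnd a)))]" if a: "a \<in> set (dec (tarcs E V B))" for a
        proof -
          obtain x y where xy: "a = Branch (enc_node x) (enc_node y)" "(x, y) \<in> arcs" using as_arc[OF a] by blast
          have n: "x \<in> nodes" "y \<in> nodes" using arcs_in_nodes[OF xy(2)] by auto
          have "tsnd a = tsnk \<longleftrightarrow> y = Snk" using enc_node_inject[of y Snk] xy by simp
          moreover have "tfst (tfst a) = enc_nat 2 \<longleftrightarrow> x \<in> range Item"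
            using xy by (cases x rule: enc_node.cases) (auto simp del: enc_nat_0)
          ultimately show ?thesis
            using c[OF xy(2)] look[OF n(1)] look[OF n(2)] unfolding tarc_def
            by (simp add: xy(1) tlen lB \<nu>_def)
        qed
        then show ?thesis
          by (intro iffD1[OF dec_eq_iff]) (simp add: as_def I_def)
      qed
      moreover have "tlookup (tindex N) tsrc = enc_nat (\<nu> Src)" "tlookup (tindex N) tsnk = enc_nat (\<nu> Snk)"
        using look[of Src] look[of Snk] Src_Snk by auto
      ultimately show ?thesis
        using cE C(2) lB by (simp add: tinstance_def I_def tlen)
    qed
    ultimately show ?thesis unfolding fei_encodes_def using ns as by blast
  qed
  ultimately show ?thesis unfolding Es_def by (intro exI[of _ "tinstance E V C B (tindex N)"] exI[of _ I]) (auto simp: I_def)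
qed

section \<open>Independence of the answer from the encoded record\<close>

lemma max_flow_value_cong:
  assumes "\<And>a. a \<in> parcs G \<Longrightarrow> u a = u' a"
  shows "max_flow_value G u s t = max_flow_value G u' s t"
  unfolding max_flow_value_def is_flow_def using assms by (intro arg_cong2[of _ _ _ _ "\<lambda>A f. Sup (f ` A)"] refl Collect_cong) auto

text \<open>\<open>FEI\<close> asks for some instance encoded by \<open>y\<close>. The encoding
  leaves capacities and costs outside the arcs open, but the answer depends on their values on arcs
  only.\<close>

lemma fei_yes_unique:
  assumes "fei_encodes y I" "fei_encodes y J"
  shows "fei_yes I \<longleftrightarrow> fei_yes J"
proof -
  obtain ns as where I: "set ns = pverts (graph I)" "set as = parcs (graph I)" "y = enc_list
          [enc_list (map enc_nat ns),
           enc_list (map (\<lambda>a. enc_list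
             [enc_nat (fst a), enc_nat (snd a), enc_nat (capacity I a), enc_nat (cost I a)]) as),
           enc_nat (source I), enc_nat (sink I), enc_nat (budget I), enc_nat (threshold I)]"
    using assms(1) unfolding fei_encodes_def by blast
  obtain ns' as' where J: "set ns' = pverts (graph J)" "set as' = parcs (graph J)" "y = enc_list
          [enc_list (map enc_nat ns'),
           enc_list (map (\<lambda>a. enc_list
             [enc_nat (fst a), enc_nat (snd a), enc_nat (capacity J a), enc_nat (cost J a)]) as'),
           enc_nat (source J), enc_nat (sink J), enc_nat (budget J), enc_nat (threshold J)]"
    using assms(2) unfolding fei_encodes_def by blast
  have eqs: "map enc_nat ns = map enc_nat ns'" "map (\<lambda>a. enc_list
             [enc_nat (fst a), enc_nat (snd a), enc_nat (capacity I a), enc_nat (cost I a)]) as = map (\<lambda>a. enc_list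
             [enc_nat (fst a), enc_nat (snd a), enc_nat (capacity J a), enc_nat (cost J a)]) as'"
    "source I = source J" "sink I = sink J" "budget I = budget J" "threshold I = threshold J"
    using I(3) J(3) by (auto simp del: enc_list.simps simp: list.inject)
  have "ns = ns'" using eqs(1) by (simp add: inj_map_eq_map inj_def)
  have as: "length as = length as'" using arg_cong[OF eqs(2), of length] by simp
  have nth: "as ! i = as' ! i \<and> capacity I (as ! i) = capacity J (as' ! i) \<and> cost I (as ! i) = cost J (as' ! i)" if "i < length as" for i
    using arg_cong[OF eqs(2), of "\<lambda>xs. xs ! i"] that as by (simp add: prod_eq_iff)
  have "as = as'" using as nth by (simp add: list_eq_iff_nth_eq)
  then have caps: "capacity I a = capacity J a" "cost I a = cost J a" if "a \<in> parcs (graph I)" for a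
    using nth that I(2) by (metis in_set_conv_nth)+
  have gr: "graph I = graph J" using I(1,2) J(1,2) \<open>ns = ns'\<close> \<open>as = as'\<close> by (intro pair_pre_digraph.equality) auto
  have "sum (cost I) A' = sum (cost J) A'" if "A' \<subseteq> parcs (graph I)" for A'
    using that caps by (intro sum.cong) auto
  moreover have "max_flow_value (delete_arcs (graph I) A') (capacity I) s t = max_flow_value (delete_arcs (graph I) A') (capacity J) s t" for A' s t
    by (rule max_flow_value_cong) (use caps in \<open>simp add: delete_arcs_def\<close>)
  ultimately show ?thesis unfolding fei_yes_def gr[symmetric] eqs(3-6)[symmetric] by (intro ex_cong conj_cong) auto
qed

section \<open>The reduction\<close>

lemma index_list_map: "index_list (map h xs) = map (\<lambda>(j, x). (j, h x)) (index_list xs)"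
  by (induction xs) auto

lemma set_index_list_rev: "set (index_list (rev xs)) = {(j, xs ! j) | j. j < length xs}"
  by (induction xs rule: rev_induct) (auto simp: nth_append less_Suc_eq)

lemma distinct_index_list: "distinct (map fst (index_list xs))"
proof -
  have "\<forall>j\<in>set (map fst (index_list ys)). j < length ys" for ys :: "'a list" by (induction ys) auto
  then show ?thesis by (induction xs) fastforce+
qed

definition input_list :: "gate list \<Rightarrow> nat list" where
  "input_list gs = map fst (filter (\<lambda>(j, g). g = InputG) (index_list (rev gs)))"

lemma set_input_list: "set (input_list gs) = input_nodes (gs, out)"
  unfolding input_list_def input_nodes_def by (force simp: set_index_list_rev)

lemma distinct_input_list: "distinct (input_list gs)"
  unfolding input_list_def using distinct_index_list by (rule distinct_map_filter)

lemma torder_tgates: "torder (tgates (enc_list (map enc_gate gs))) =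
  tpairs (enc_list (tstart # map enc_nat (input_list gs) @ [tend]))"
proof -
  have tag: "tfst (enc_gate g) = Leaf \<longleftrightarrow> g = InputG" for g by (cases g) auto
  have "map tfst (filter (\<lambda>e. tfst (tsnd e) = Leaf) (map (\<lambda>(j, x). Branch (enc_nat j) x) (map (\<lambda>(j, x). (j, enc_gate x)) L)))
     = map enc_nat (map fst (filter (\<lambda>(j, g). g = InputG) L))" for L
    by (induction L) (auto simp: tag)
  from this[of "index_list (rev gs)"] have "tmap tfst (tfilter (\<lambda>e. tfst (tsnd e) = Leaf) (tgates (enc_list (map enc_gate gs)))) = enc_list (map enc_nat (input_list gs))"
    by (intro iffD1[OF dec_eq_iff]) (simp add: tgates_def index_list_map input_list_def rev_map)
  then have "tapp (tmap tfst (tfilter (\<lambda>e. tfst (tsnd e) = Leaf) (tgates (enc_list (map enc_gate gs))))) (Branch tend Leaf)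
      = enc_list (map enc_nat (input_list gs) @ [tend])"
    by (intro iffD1[OF dec_eq_iff]) simp
  then show ?thesis by (simp add: torder_def)
qed

lemma enc_gate_inject: "enc_gate g = enc_gate h \<longleftrightarrow> g = h"
  by (cases g; cases h) (auto simp: inj_map_eq_map inj_def simp del: enc_nat_0)

lemma enc_circuit_inject: "enc_circuit C = enc_circuit D \<longleftrightarrow> C = D"
  by (cases C; cases D) (auto simp: enc_circuit_def inj_map_eq_map inj_def enc_gate_inject)

definition treduce :: "nat \<Rightarrow> tree \<Rightarrow> tree" where
  "treduce d x = (let G = tgates (tfst (tfst x)); LT = torder G; k = tsnd x; q = 2 ^ Suc d;
     V = tverts q LT (trefutations (Suc d) G (tsnd (tfst x))) k
   in tfei (titems LT V) V (tcolours q k))"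

lemma ptime_treduce: "ptime (treduce d)"
  unfolding treduce_def Let_def by (intro ptime_intros)

text \<open>Inputs are renamed to their numerals, so that they and the two sentinels are elements of
  one type, the trees.\<close>

definition keyed :: "(nat \<times> bool) list list \<Rightarrow> (tree \<times> bool) list list" where
  "keyed \<Phi> = map (map (\<lambda>(j, w). (enc_nat j, w))) \<Phi>"

lemma enc_fam_keyed: "enc_fam (keyed \<Phi>) = enc_list (map enc_cert \<Phi>)"
  by (simp add: enc_fam_def keyed_def enc_cert_def comp_def case_prod_unfold)

definition new_budget :: "nat \<Rightarrow> nat \<Rightarrow> nat" where
  "new_budget d k = Suc ((k + 1) ^ 2 ^ Suc d) * Suc ((k + 1) ^ 2 ^ Suc d)"

text \<open>Correctness on well-formed weft-1 circuits suffices, because a reduction witnessing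
  membership in \<open>W 1\<close> outputs nothing else.\<close>

lemma treduce_correct:
  assumes "(x, k) \<in> WCS_instances 1 d"
  shows "\<exists>y. treduce d (Branch x (enc_unary k)) = Branch y (enc_unary (new_budget d k)) \<and>
    (y, new_budget d k) \<in> FEI_bipartite_unit_instances \<and> ((x, k) \<in> WCS 1 d \<longleftrightarrow> (y, new_budget d k) \<in> FEI)"
proof -
  obtain gs out where x: "x = enc_circuit (gs, out)" and wf: "wf_circuit (gs, out)" and weft: "weft_le (gs, out) 1"
    and depth: "depth_le (gs, out) d"
    using assms unfolding WCS_instances_def by auto
  define q where "q = (2 :: nat) ^ Suc d"
  define K where "K = Suc ((k + 1) ^ q)"
  define Fam where "Fam = keyed ` set (refutations gs (Suc d) out)"
  define xs where "xs = map enc_nat (input_list gs)"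
  have lit: "length c \<le> q \<and> fst ` set c \<subseteq> set xs" if \<Phi>c: "\<Phi> \<in> Fam" "c \<in> set \<Phi>" for \<Phi> c
  proof -
    obtain \<Psi> c' where \<Psi>: "\<Psi> \<in> set (refutations gs (Suc d) out)" "c' \<in> set \<Psi>" "c = map (\<lambda>(j, w). (enc_nat j, w)) c'"
      using \<Phi>c unfolding Fam_def keyed_def by auto
    have b: "length c' \<le> q" "\<And>j w. (j, w) \<in> set c' \<Longrightarrow> j \<in> set (input_list gs)"
      using refutations_bounded[OF wf weft depth \<Psi>(1,2)] unfolding q_def set_input_list[of gs out] by (auto simp: input_nodes_def)
    then show ?thesis unfolding \<Psi>(3) xs_def by auto
  qed
  interpret tree_views xs k q Fam
  proof
    show "distinct (tstart # xs @ [tend])"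
      using distinct_input_list[of gs] enc_nat_sentinel enc_nat_sentinel(1,2)[symmetric] enc_nat_sentinel(3)
      by (auto simp: xs_def distinct_map inj_on_def)
    show "1 \<le> q" by (simp add: q_def)
    show "finite Fam" by (simp add: Fam_def)
  qed (rule lit)
  define FT where "FT = trefutations (Suc d) (tgates (enc_list (map enc_gate gs))) (enc_nat out)"
  have FT: "set (dec FT) = enc_fam ` Fam"
    unfolding FT_def trefutations[OF wf weft depth] by (simp add: Fam_def image_image enc_fam_keyed)
  define V where "V = tverts q order FT (enc_unary k)"
  have order: "torder (tgates (enc_list (map enc_gate gs))) = order"
    unfolding order_def U_def torder_tgates xs_def[symmetric] ..
  have red: "treduce d (Branch x (enc_unary k)) = tfei (titems order V) V (tcolours q (enc_unary k))"
    unfolding treduce_def Let_def x enc_circuit_def using order by (simp add: V_def FT_def q_def)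
  have q1: "q \<ge> 1" by (simp add: q_def)
  have "\<exists>y I. tfei (titems order V) V (tcolours q (enc_unary k)) = Branch y (enc_unary (K * K)) \<and> budget I = K * K \<and> fei_encodes y I \<and> fei_valid I \<and>
    underlying_bipartite (graph I) \<and> (\<forall>a\<in>parcs (graph I). capacity I a = 1) \<and>
    (fei_yes I \<longleftrightarrow> (\<exists>R. R \<times> R \<subseteq> {(u, v). Branch u v \<in> set (dec (titems order V))} \<and> card R = K))"
  proof (rule tfei_correct)
    show "distinct (dec (tcolours q (enc_unary k)))" "length (dec (tcolours q (enc_unary k))) = K"
      using tcolours[OF q1] by (simp_all add: K_def)
    show "2 \<le> K" by (simp add: K_def)
    show "distinct (dec (titems order V))" by (simp add: titems_def)
    show "\<exists>u v. e = Branch u v \<and> u \<in> set (dec V) \<and> v \<in> set (dec V)" if "e \<in> set (dec (titems order V))" for e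
      using that by (auto simp: titems_def)
  qed
  then obtain y I where I: "tfei (titems order V) V (tcolours q (enc_unary k)) = Branch y (enc_unary (K * K))" "budget I = K * K" "fei_encodes y I"
    "fei_valid I" "underlying_bipartite (graph I)" "\<forall>a\<in>parcs (graph I). capacity I a = 1"
    "fei_yes I \<longleftrightarrow> (\<exists>R. R \<times> R \<subseteq> {(u, v). Branch u v \<in> set (dec (titems order V))} \<and> card R = K)" by blast
  have nb: "new_budget d k = K * K" by (simp add: new_budget_def K_def q_def)
  have "(x, k) \<in> WCS 1 d \<longleftrightarrow> (\<exists>S\<subseteq>input_nodes (gs, out). card S = k \<and> satisfies S (gs, out))"
    unfolding WCS_def x using wf weft depth by (auto simp: enc_circuit_inject)
  also have "\<dots> \<longleftrightarrow> (\<exists>S\<subseteq>set xs. card S = k \<and> (\<exists>\<Phi>\<in>Fam. \<forall>c\<in>set \<Phi>. \<not> agrees S c))"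
  proof -
    have ag: "agrees (enc_nat ` S) (map (\<lambda>(j, w). (enc_nat j, w)) c) \<longleftrightarrow> matches S c" for S c
      by (auto simp: agrees_def matches_def image_iff)
    have sat: "satisfies S (gs, out) \<longleftrightarrow> (\<exists>\<Phi>\<in>Fam. \<forall>c\<in>set \<Phi>. \<not> agrees (enc_nat ` S) c)" for S
      unfolding satisfies_iff_refutations[OF wf weft depth] Fam_def by (simp add: keyed_def ag)
    have inj: "inj_on enc_nat S" for S by (simp add: inj_on_def)
    have img: "(\<exists>S\<subseteq>enc_nat ` A. Q S) \<longleftrightarrow> (\<exists>S\<subseteq>A. Q (enc_nat ` S))" for A Q
      by (metis image_mono subset_imageE)
    have "set xs = enc_nat ` input_nodes (gs, out)" by (simp add: xs_def set_input_list[of gs out])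
    then have "(\<exists>S\<subseteq>set xs. card S = k \<and> (\<exists>\<Phi>\<in>Fam. \<forall>c\<in>set \<Phi>. \<not> agrees S c)) \<longleftrightarrow>
      (\<exists>S\<subseteq>input_nodes (gs, out). card (enc_nat ` S) = k \<and> (\<exists>\<Phi>\<in>Fam. \<forall>c\<in>set \<Phi>. \<not> agrees (enc_nat ` S) c))"
      by (simp only: img)
    then show ?thesis unfolding sat by (simp add: card_image[OF inj])
  qed
  also have "\<dots> \<longleftrightarrow> fei_yes I" unfolding I(7) K_def V_def by (rule selection_iff_titems[OF FT])
  also have "\<dots> \<longleftrightarrow> (y, K * K) \<in> FEI"
  proof
    assume "fei_yes I"
    then have "(y, budget I) \<in> FEI" unfolding FEI_def using I(3,4) by blast
    then show "(y, K * K) \<in> FEI" by (simp only: I(2))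
  next
    assume "(y, K * K) \<in> FEI"
    then obtain J where "fei_encodes y J" "fei_yes J" unfolding FEI_def by blast
    then show "fei_yes I" using fei_yes_unique[OF _ I(3)] by blast
  qed
  finally have "(x, k) \<in> WCS 1 d \<longleftrightarrow> (y, K * K) \<in> FEI" .
  moreover have "(y, budget I) \<in> FEI_bipartite_unit_instances"
    unfolding FEI_bipartite_unit_instances_def using I(3-6) by blast
  ultimately show ?thesis unfolding nb red using I(1,2) by simp
qed

section \<open>Computable bounds and composed running times\<close>

primrec tpower :: "nat \<Rightarrow> tree \<Rightarrow> tree" where
  "tpower 0 t = enc_unary 1"
| "tpower (Suc b) t = tbind (\<lambda>_. t) (tpower b t)"

text \<open>In unary, replacing every digit of one numeral by a copy of another multiplies the
  two.\<close>

lemma tpower: "tpower b (enc_unary m) = enc_unary (m ^ b)"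
proof (induction b)
  case (Suc b)
  have "concat (replicate n (replicate m Leaf)) = replicate (n * m) Leaf" for n
    by (induction n) (auto simp: replicate_add)
  moreover have "dec (tpower (Suc b) (enc_unary m)) = concat (map (\<lambda>_. dec (enc_unary m)) (dec (enc_unary (m ^ b))))"
    by (simp only: tpower.simps dec_tbind Suc)
  ultimately have "dec (tpower (Suc b) (enc_unary m)) = dec (enc_unary (m ^ Suc b))"
    by (simp add: enc_unary_def map_replicate_const mult.commute)
  then show ?case unfolding dec_eq_iff .
qed simp

lemma ptime_tpower[ptime_intros]: "ptime F \<Longrightarrow> ptime (\<lambda>x. tpower b (F x))"
proof (induction b arbitrary: F)
  case (Suc b)
  have "ptime (tpower (Suc b))" unfolding tpower.simps by (intro ptime_intros Suc.IH)
  then show ?case using Suc.prems by (rule ptime_comp)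
qed (simp add: ptime_const)

text \<open>The second program starts in whatever store the first one leaves, which
  \<open>computes\<close> permits. The size bound on \<open>y\<close> turns the running time of the
  first into a bound on the input of the second.\<close>

lemma runs_then_ptime:
  assumes "computes q N F e" "runs p x n y"
  shows "\<exists>m. runs (Seq p q) x (n + m) (F y) \<and> m \<le> (tsize y + 2) ^ e \<and> tsize y \<le> tsize x + n"
proof -
  obtain s' where s': "exec p ((\<lambda>_. Leaf)(0 := x)) n s'" "s' 0 = y" using assms(2) by (auto simp: runs_def)
  obtain s'' m where s'': "exec q s' m s''" "m \<le> (tsize y + 2) ^ e" "s'' 0 = F y"
    using assms(1) s'(2) unfolding computes_def exec_le_def by metis
  have "tsize y \<le> tsize x + n" using exec_tsize[OF s'(1), of 0] s'(2) by simp
  then show ?thesis using exec_Seq[OF s'(1) s''(1)] s''(2,3) unfolding runs_def by blast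
qed

text \<open>Both the new time factor and the new parameter bound are brought into this shape, so no
  further arithmetic on computable functions is required.\<close>

lemma computable_power:
  assumes "computable f"
  shows "computable (\<lambda>n. (f n + a) ^ b)"
proof -
  obtain p where p: "\<forall>n. \<exists>t. runs p (enc_unary n) t (enc_unary (f n))" using assms unfolding computable_def by blast
  have "ptime (\<lambda>x. tpower b (tapp x (enc_unary a)))" by (intro ptime_intros)
  then obtain q N e where q: "computes q N (\<lambda>x. tpower b (tapp x (enc_unary a))) e" unfolding ptime_def by blast
  have "tpower b (tapp (enc_unary m) (enc_unary a)) = enc_unary ((m + a) ^ b)" for m
  proof -
    have "tapp (enc_unary m) (enc_unary a) = enc_unary (m + a)"
      by (intro iffD1[OF dec_eq_iff]) (simp add: enc_unary_def replicate_add)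
    then show ?thesis by (simp add: tpower)
  qed
  then have "\<exists>t. runs (Seq p q) (enc_unary n) t (enc_unary ((f n + a) ^ b))" for n
    using p runs_then_ptime[OF q] by metis
  then show ?thesis unfolding computable_def by blast
qed

lemma tsize_enc_unary: "tsize (enc_unary k) = 2 * k + 1"
  by (induction k) (auto simp: enc_unary_def)

text \<open>A polynomial applied to a product of a parameter part \<open>a\<close> and a power of
  \<open>m\<close> has to be split into such a product again. The 6 arises from
  \<open>2 * m + 4 \<le> 6 * m ^ (c + 1)\<close>, where \<open>2 * m + 2\<close> bounds the size of
  the encoded pair of input and parameter.\<close>

lemma composed_time_bound:
  fixes a k m n n' c e z :: nat
  assumes n: "n \<le> a * m ^ c" and z: "z \<le> 2 * m + 2 + n" and n': "n' \<le> (z + 2) ^ e" and m: "m \<ge> 1"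
  shows "n + n' \<le> (a + 6) ^ (e + 1) * m ^ (c + (c + 1) * e)"
proof -
  have mc: "m ^ c \<le> m ^ (c + 1)" "m \<le> m ^ (c + 1)" "1 \<le> m ^ (c + 1)"
    using m by (auto intro: power_increasing self_le_power)
  have "z + 2 \<le> 2 * m + 4 + a * m ^ c" using z n by linarith
  also have "\<dots> \<le> 2 * m ^ (c + 1) + 4 * m ^ (c + 1) + a * m ^ (c + 1)"
    using mc mult_le_mono2[OF mc(1), of a] by linarith
  finally have "z + 2 \<le> (a + 6) * m ^ (c + 1)" by (simp only: distrib_right)
  then have "(z + 2) ^ e \<le> ((a + 6) * m ^ (c + 1)) ^ e" by (rule power_mono) simp
  then have 1: "n' \<le> (a + 6) ^ e * m ^ ((c + 1) * e)" using n' by (simp only: power_mult_distrib power_mult)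
  have 2: "m ^ c \<le> m ^ (c + (c + 1) * e)" "m ^ ((c + 1) * e) \<le> m ^ (c + (c + 1) * e)"
    using m by (auto intro!: power_increasing)
  have "n + n' \<le> a * m ^ (c + (c + 1) * e) + (a + 6) ^ e * m ^ (c + (c + 1) * e)"
    using n 1 mult_le_mono2[OF 2(1), of a] mult_le_mono2[OF 2(2), of "(a + 6) ^ e"] by linarith
  also have "\<dots> = (a + (a + 6) ^ e) * m ^ (c + (c + 1) * e)" by (simp only: distrib_right)
  also have "a + (a + 6) ^ e \<le> (a + 6) ^ (e + 1)"
  proof -
    have "a * 1 \<le> a * (a + 6) ^ e" by (intro mult_le_mono) auto
    moreover have "(a + 6) ^ (e + 1) = a * (a + 6) ^ e + 6 * (a + 6) ^ e" by (simp add: distrib_right)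
    ultimately show ?thesis by linarith
  qed
  finally show ?thesis by simp
qed

text \<open>The successor due to the universal vertex is absorbed by raising the base from
  \<open>l + 1\<close> to \<open>g + 2\<close>, since powers are strictly monotone.\<close>

lemma new_budget_le: "l \<le> g \<Longrightarrow> new_budget d l \<le> (g + 2) ^ (2 * 2 ^ Suc d)"
proof -
  assume "l \<le> g"
  define q where "q = (2 :: nat) ^ Suc d"
  have "(l + 1) ^ q < (g + 2) ^ q" using \<open>l \<le> g\<close> by (intro power_strict_mono) (auto simp: q_def)
  then have "Suc ((l + 1) ^ q) \<le> (g + 2) ^ q" by (rule Suc_leI)
  then have "Suc ((l + 1) ^ q) * Suc ((l + 1) ^ q) \<le> (g + 2) ^ q * (g + 2) ^ q" by (rule mult_le_mono) fact
  then show ?thesis unfolding new_budget_def q_def by (simp only: power_add[symmetric] mult_2)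
qed

theorem theorem6:
  shows "W_hard_on 1 FEI FEI_bipartite_unit_instances"
  unfolding W_hard_on_def
proof
  fix P assume "P \<in> W 1"
  then obtain d where "fpt_reduction P (WCS 1 d) (WCS_instances 1 d)" unfolding W_def by blast
  then obtain p f g c where f: "computable f" "computable g" and red: "\<And>x k. \<exists>n y l.
       runs p (Branch x (enc_unary k)) n (Branch y (enc_unary l)) \<and> n \<le> f k * (tsize x + k) ^ c \<and> l \<le> g k \<and>
       (y, l) \<in> WCS_instances 1 d \<and> ((x, k) \<in> P \<longleftrightarrow> (y, l) \<in> WCS 1 d)"
    unfolding fpt_reduction_def by blast
  \<comment> \<open>The program and its exponent \<open>e\<close> depend on \<open>d\<close> only,
    and \<open>d\<close> is fixed by \<open>P\<close>.\<close>
  obtain q N e where q: "computes q N (treduce d) e" using ptime_treduce unfolding ptime_def by blast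
  have "\<exists>n y l. runs (Seq p q) (Branch x (enc_unary k)) n (Branch y (enc_unary l)) \<and>
     n \<le> (f k + 6) ^ (e + 1) * (tsize x + k) ^ (c + (c + 1) * e) \<and> l \<le> (g k + 2) ^ (2 * 2 ^ Suc d) \<and>
     (y, l) \<in> FEI_bipartite_unit_instances \<and> ((x, k) \<in> P \<longleftrightarrow> (y, l) \<in> FEI)" for x k
  proof -
    obtain n y l where r: "runs p (Branch x (enc_unary k)) n (Branch y (enc_unary l))" "n \<le> f k * (tsize x + k) ^ c" "l \<le> g k"
       "(y, l) \<in> WCS_instances 1 d" "(x, k) \<in> P \<longleftrightarrow> (y, l) \<in> WCS 1 d" using red by blast
    obtain m where m: "runs (Seq p q) (Branch x (enc_unary k)) (n + m) (treduce d (Branch y (enc_unary l)))"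
      "m \<le> (tsize (Branch y (enc_unary l)) + 2) ^ e" "tsize (Branch y (enc_unary l)) \<le> tsize (Branch x (enc_unary k)) + n"
      using runs_then_ptime[OF q r(1)] by blast
    obtain y' where y': "treduce d (Branch y (enc_unary l)) = Branch y' (enc_unary (new_budget d l))"
      "(y', new_budget d l) \<in> FEI_bipartite_unit_instances" "(y, l) \<in> WCS 1 d \<longleftrightarrow> (y', new_budget d l) \<in> FEI"
      using treduce_correct[OF r(4)] by blast
    have "tsize x \<ge> 1" using tsize_pos[of x] by linarith
    then have "n + m \<le> (f k + 6) ^ (e + 1) * (tsize x + k) ^ (c + (c + 1) * e)"
      using m(3) tsize_enc_unary[of k] by (intro composed_time_bound[OF r(2) _ m(2)]) auto
    then show ?thesis using m(1) y' r(5) new_budget_le[OF r(3)] by metis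
  qed
  moreover have "computable (\<lambda>k. (f k + 6) ^ (e + 1))" "computable (\<lambda>k. (g k + 2) ^ (2 * 2 ^ Suc d))"
    by (intro computable_power f)+
  ultimately show "fpt_reduction P FEI FEI_bipartite_unit_instances"
    unfolding fpt_reduction_def by blast
qed

end
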